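(* With $\bm\sigma^*$, $\mathcal T^*$ and $H^*$ as in the context (where $\mathcal T^*$ is the set of $\bm\theta$-components of saddle points of $H$), the following hold. (a) $J(\bm\theta,\mathbf A)\le H^*$ for every $(\bm\theta,\mathbf A)\in\mathcal B$. (b) If $\bm\theta^*\in\mathcal T^*$, then $(\bm\theta^*,\lambda_-(\bm\theta^* )\mathbf I)$ is a maximizer of $J$ on $\mathcal B$, and $J(\bm\theta^*,\lambda_-(\bm\theta^* )\mathbf I)=H^*$. (c) If $\bm\theta^*\in\mathcal T^*$, then a pair $(\bm\theta^*,\mathbf A)\in\mathcal B$ is a maximizer of $J$ over $\mathcal B$ if and only if $$\mathbf A^{-1}\bm\sigma_i^*=\frac1{\lambda_-(\bm\theta^* )}\bm\sigma_i^*\quad\text{a.e. in }\Omega,\qquad i=1,\dots,m.$$ (d) Conversely, if $(\bm\theta,\mathbf A)\in\mathcal B$ is a maximizer of $J$ over $\mathcal B$, then $\bm\theta$ maximizes $I$ over $\mathcal T$, and consequently $\mathbf A^{-1}\bm\sigma_i^*=\frac1{\lambda_-(\bm\theta)}\bm\sigma_i^*$ a.e. in $\Omega$ for $i=1,\dots,m$.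
   Context: Setting. $\Omega\subseteq\mathbb R^d$ is open and bounded, $\mu$ is the $d$-dimensional Lebesgue measure, $N,m\ge1$. $\mathbf M_1,\dots,\mathbf M_N$ are symmetric positive definite $d\times d$ real matrices; $\lambda_1(\mathbf M)$ and $\lambda_d(\mathbf M)$ denote the smallest and largest eigenvalue of a symmetric matrix $\mathbf M$; $\mathbf I$ is the identity matrix. $q_1,\dots,q_N\ge0$ are prescribed amounts with $\sum_{i=1}^Nq_i=\mu(\Omega)$, $f_1,\dots,f_m\in H^{-1}(\Omega)$, and $\mu_1,\dots,\mu_m>0$ are weights. Let $K=\{\bm\theta\in[0,1]^N:\sum_{i=1}^N\theta_i=1\}$, and $\mathcal T=\{\bm\theta\in L^\infty(\Omega;K):\int_\Omega\theta_i\,d\mathbf x=q_i,\ i=1,\dots,N\}$. For $\bm\theta\in K$ define $\lambda_-(\bm\theta)$ and $\lambda_+(\bm\theta)$ by $\frac1{\lambda_-(\bm\theta)}=\sum_{i=1}^N\frac{\theta_i}{\lambda_1(\mathbf M_i)}$ and $\lambda_+(\bm\theta)=\sum_{i=1}^N\theta_i\lambda_d(\mathbf M_i)$. Let $$\mathcal B=\{(\bm\theta,\mathbf A)\in L^\infty(\Omega;K\times\mathrm{Sym}_d):\bm\theta\in\mathcal T,\ \lambda_-(\bm\theta)\mathbf I\le\mathbf A\le\lambda_+(\bm\theta)\mathbf I\ \text{a.e. on }\Omega\},$$ where $\mathrm{Sym}_d$ is the space of symmetric $d\times d$ real matrices. For $(\bm\theta,\mathbf A)\in\mathcal B$ let $u_i\in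 H^1_0(\Omega)$ be the unique solution of $-\mathrm{div}(\mathbf A\nabla u_i)=f_i$, $i=1,\dots,m$, and put $J(\bm\theta,\mathbf A)=\sum_{i=1}^m\mu_i\int_\Omega f_iu_i\,d\mathbf x$ (the integral meaning the $H^{-1}$–$H^1_0$ duality pairing). For $\bm\theta\in\mathcal T$ put $I(\bm\theta)=J(\bm\theta,\lambda_-(\bm\theta)\mathbf I)$. Let $\mathcal S=\{\bm\sigma=(\bm\sigma_1,\dots,\bm\sigma_m)\in L^2(\Omega;\mathbb R^d)^m:-\mathrm{div}\,\bm\sigma_i=f_i,\ i=1,\dots,m\}$ and $$H(\bm\theta,\bm\sigma)=\sum_{i=1}^m\mu_i\int_\Omega\frac{|\bm\sigma_i|^2}{\lambda_-(\bm\theta)}\,d\mathbf x,\qquad \bm\theta\in\mathcal T,\ \bm\sigma\in\mathcal S.$$ A saddle point of $H$ is a pair $(\bm\theta^*,\bm\sigma^* )\in\mathcal T\times\mathcal S$ with $H(\bm\theta,\bm\sigma^* )\le H(\bm\theta^*,\bm\sigma^* )\le H(\bm\theta^*,\bm\sigma)$ for all $\bm\theta\in\mathcal T,\bm\sigma\in\mathcal S$. By the classical saddle-point theorem, saddle points exist, and their set has the form $\mathcal T^*\times\{\bm\sigma^*\}$ with $\mathcal T^*\subseteq\mathcal T$ convex and a unique $\bm\sigma^*\in\mathcal S$; $H^*$ denotes the common value of $H$ at the saddle points. *)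

theory Defs
  imports "HOL-Analysis.Analysis"
begin

text \<open>
  Elements of Lebesgue and Sobolev spaces over \<open>\<Omega>\<close> are represented by total functions on
  \<open>real ^ 'd\<close>; values outside \<open>\<Omega>\<close> and on null subsets of \<open>\<Omega>\<close> are irrelevant, because every condition
  is expressed through the measure \<open>lebesgue_on \<Omega>\<close>.
\<close>

subsection \<open>Eigenvalues and order of symmetric matrices\<close>

definition eigenvalues :: "real ^ 'd ^ 'd \<Rightarrow> real set" where
  "eigenvalues M = {c. \<exists>v. v \<noteq> 0 \<and> M *v v = c *\<^sub>R v}"

definition lambda_min :: "real ^ 'd ^ 'd \<Rightarrow> real" where
  "lambda_min M = Min (eigenvalues M)"

definition lambda_max :: "real ^ 'd ^ 'd \<Rightarrow> real" where
  "lambda_max M = Max (eigenvalues M)"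

definition symmetric_mat :: "real ^ 'd ^ 'd \<Rightarrow> bool" where
  "symmetric_mat M \<longleftrightarrow> transpose M = M"

definition spd_mat :: "real ^ 'd ^ 'd \<Rightarrow> bool" where
  "spd_mat M \<longleftrightarrow> symmetric_mat M \<and> (\<forall>v. v \<noteq> 0 \<longrightarrow> v \<bullet> (M *v v) > 0)"

definition loewner_le :: "real ^ 'd ^ 'd \<Rightarrow> real ^ 'd ^ 'd \<Rightarrow> bool" where
  "loewner_le A B \<longleftrightarrow> (\<forall>v. v \<bullet> (A *v v) \<le> v \<bullet> (B *v v))"

subsection \<open>Lebesgue spaces\<close>

definition L2 :: "(real ^ 'd) set \<Rightarrow> (real ^ 'd \<Rightarrow> 'b::euclidean_space) set" where
  "L2 \<Omega> = {u. u \<in> borel_measurable (lebesgue_on \<Omega>) \<and>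
              integrable (lebesgue_on \<Omega>) (\<lambda>x. (norm (u x))\<^sup>2)}"

definition Linf :: "(real ^ 'd) set \<Rightarrow> (real ^ 'd \<Rightarrow> 'b::euclidean_space) set" where
  "Linf \<Omega> = {u. u \<in> borel_measurable (lebesgue_on \<Omega>) \<and>
                (\<exists>C. AE x in lebesgue_on \<Omega>. norm (u x) \<le> C)}"

subsection \<open>Test functions and Sobolev spaces\<close>

definition partial :: "'d \<Rightarrow> (real ^ 'd \<Rightarrow> real) \<Rightarrow> real ^ 'd \<Rightarrow> real" where
  "partial i \<phi> x = frechet_derivative \<phi> (at x) (axis i 1)"

fun Ck :: "nat \<Rightarrow> (real ^ 'd \<Rightarrow> real) \<Rightarrow> bool" where
  "Ck 0 \<phi> \<longleftrightarrow> continuous_on UNIV \<phi>"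
| "Ck (Suc k) \<phi> \<longleftrightarrow> (\<forall>x. \<phi> differentiable (at x)) \<and> (\<forall>i. Ck k (partial i \<phi>))"

definition test_functions :: "(real ^ 'd) set \<Rightarrow> (real ^ 'd \<Rightarrow> real) set" where
  "test_functions \<Omega> = {\<phi>. (\<forall>k. Ck k \<phi>) \<and> compact (closure {x. \<phi> x \<noteq> 0}) \<and>
                          closure {x. \<phi> x \<noteq> 0} \<subseteq> \<Omega>}"

definition is_weak_grad ::
  "(real ^ 'd) set \<Rightarrow> (real ^ 'd \<Rightarrow> real) \<Rightarrow> (real ^ 'd \<Rightarrow> real ^ 'd) \<Rightarrow> bool" where
  "is_weak_grad \<Omega> u g \<longleftrightarrow> g \<in> L2 \<Omega> \<and>
     (\<forall>\<phi> \<in> test_functions \<Omega>. \<forall>i.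
        (\<integral>x. u x * partial i \<phi> x \<partial>lebesgue_on \<Omega>) = - (\<integral>x. g x $ i * \<phi> x \<partial>lebesgue_on \<Omega>))"

definition H1 :: "(real ^ 'd) set \<Rightarrow> (real ^ 'd \<Rightarrow> real) set" where
  "H1 \<Omega> = {u. u \<in> L2 \<Omega> \<and> (\<exists>g. is_weak_grad \<Omega> u g)}"

text \<open>The weak gradient is unique up to null sets, so the choice of a representative is immaterial.\<close>

definition wgrad :: "(real ^ 'd) set \<Rightarrow> (real ^ 'd \<Rightarrow> real) \<Rightarrow> real ^ 'd \<Rightarrow> real ^ 'd" where
  "wgrad \<Omega> u = (SOME g. is_weak_grad \<Omega> u g)"

definition H1_norm :: "(real ^ 'd) set \<Rightarrow> (real ^ 'd \<Rightarrow> real) \<Rightarrow> real" where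
  "H1_norm \<Omega> u = sqrt ((\<integral>x. (u x)\<^sup>2 \<partial>lebesgue_on \<Omega>) +
                       (\<integral>x. (norm (wgrad \<Omega> u x))\<^sup>2 \<partial>lebesgue_on \<Omega>))"

definition H10 :: "(real ^ 'd) set \<Rightarrow> (real ^ 'd \<Rightarrow> real) set" where
  "H10 \<Omega> = {u \<in> H1 \<Omega>. \<exists>\<phi>. (\<forall>n. \<phi> n \<in> test_functions \<Omega>) \<and>
                         (\<lambda>n. H1_norm \<Omega> (\<lambda>x. \<phi> n x - u x)) \<longlonglongrightarrow> 0}"

text \<open>
  An element of \<open>H\<^sup>-\<^sup>1\<close> is a bounded linear functional on \<open>H10 \<Omega>\<close>; its values outside \<open>H10 \<Omega>\<close> are
  irrelevant. Linearity and boundedness force it to respect equality almost everywhere, and its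
  application to a function is the duality pairing.
\<close>

definition Hm1 :: "(real ^ 'd) set \<Rightarrow> ((real ^ 'd \<Rightarrow> real) \<Rightarrow> real) set" where
  "Hm1 \<Omega> = {f. (\<forall>u\<in>H10 \<Omega>. \<forall>v\<in>H10 \<Omega>. f (\<lambda>x. u x + v x) = f u + f v) \<and>
               (\<forall>u\<in>H10 \<Omega>. \<forall>c. f (\<lambda>x. c * u x) = c * f u) \<and>
               (\<exists>C. \<forall>u\<in>H10 \<Omega>. \<bar>f u\<bar> \<le> C * H1_norm \<Omega> u)}"

text \<open>The equation \<open>- div \<sigma> = f\<close> in \<open>H\<^sup>-\<^sup>1\<close>.\<close>

definition neg_div_eq ::
  "(real ^ 'd) set \<Rightarrow> (real ^ 'd \<Rightarrow> real ^ 'd) \<Rightarrow> ((real ^ 'd \<Rightarrow> real) \<Rightarrow> real) \<Rightarrow> bool" where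
  "neg_div_eq \<Omega> \<sigma> f \<longleftrightarrow> (\<forall>v\<in>H10 \<Omega>. (\<integral>x. \<sigma> x \<bullet> wgrad \<Omega> v x \<partial>lebesgue_on \<Omega>) = f v)"

text \<open>
  The solution in \<open>H10 \<Omega>\<close> of \<open>- div (A \<nabla>u) = f\<close>, which is unique up to null sets for the
  coefficients considered below.
\<close>

definition dirichlet_solution ::
  "(real ^ 'd) set \<Rightarrow> (real ^ 'd \<Rightarrow> real ^ 'd ^ 'd) \<Rightarrow> ((real ^ 'd \<Rightarrow> real) \<Rightarrow> real)
     \<Rightarrow> real ^ 'd \<Rightarrow> real" where
  "dirichlet_solution \<Omega> A f =
     (SOME u. u \<in> H10 \<Omega> \<and> neg_div_eq \<Omega> (\<lambda>x. A x *v wgrad \<Omega> u x) f)"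

subsection \<open>Relaxed designs\<close>

definition K :: "(real ^ 'n) set" where
  "K = {\<theta>. (\<forall>i. 0 \<le> \<theta> $ i \<and> \<theta> $ i \<le> 1) \<and> (\<Sum>i\<in>UNIV. \<theta> $ i) = 1}"

definition T :: "(real ^ 'd) set \<Rightarrow> ('n \<Rightarrow> real) \<Rightarrow> (real ^ 'd \<Rightarrow> real ^ 'n) set" where
  "T \<Omega> q = {\<theta> \<in> Linf \<Omega>. (AE x in lebesgue_on \<Omega>. \<theta> x \<in> K) \<and>
                        (\<forall>i. (\<integral>x. \<theta> x $ i \<partial>lebesgue_on \<Omega>) = q i)}"

definition lam_minus :: "('n \<Rightarrow> real ^ 'd ^ 'd) \<Rightarrow> real ^ 'n \<Rightarrow> real" where
  "lam_minus M \<theta> = 1 / (\<Sum>i\<in>UNIV. \<theta> $ i / lambda_min (M i))"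

definition lam_plus :: "('n \<Rightarrow> real ^ 'd ^ 'd) \<Rightarrow> real ^ 'n \<Rightarrow> real" where
  "lam_plus M \<theta> = (\<Sum>i\<in>UNIV. \<theta> $ i * lambda_max (M i))"

definition B ::
  "(real ^ 'd) set \<Rightarrow> ('n \<Rightarrow> real ^ 'd ^ 'd) \<Rightarrow> ('n \<Rightarrow> real)
     \<Rightarrow> ((real ^ 'd \<Rightarrow> real ^ 'n) \<times> (real ^ 'd \<Rightarrow> real ^ 'd ^ 'd)) set" where
  "B \<Omega> M q = {(\<theta>, A). \<theta> \<in> T \<Omega> q \<and> A \<in> Linf \<Omega> \<and>
     (AE x in lebesgue_on \<Omega>. symmetric_mat (A x) \<and>
        loewner_le (lam_minus M (\<theta> x) *\<^sub>R mat 1) (A x) \<and>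
        loewner_le (A x) (lam_plus M (\<theta> x) *\<^sub>R mat 1))}"

definition J ::
  "(real ^ 'd) set \<Rightarrow> ('m \<Rightarrow> (real ^ 'd \<Rightarrow> real) \<Rightarrow> real) \<Rightarrow> ('m \<Rightarrow> real)
     \<Rightarrow> (real ^ 'd \<Rightarrow> real ^ 'n) \<times> (real ^ 'd \<Rightarrow> real ^ 'd ^ 'd) \<Rightarrow> real" where
  "J \<Omega> f w = (\<lambda>(\<theta>, A). \<Sum>i\<in>UNIV. w i * f i (dirichlet_solution \<Omega> A (f i)))"

definition I ::
  "(real ^ 'd) set \<Rightarrow> ('n \<Rightarrow> real ^ 'd ^ 'd) \<Rightarrow> ('m \<Rightarrow> (real ^ 'd \<Rightarrow> real) \<Rightarrow> real) \<Rightarrow> ('m \<Rightarrow> real)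
     \<Rightarrow> (real ^ 'd \<Rightarrow> real ^ 'n) \<Rightarrow> real" where
  "I \<Omega> M f w \<theta> = J \<Omega> f w (\<theta>, \<lambda>x. lam_minus M (\<theta> x) *\<^sub>R mat 1)"

subsection \<open>The saddle-point problem\<close>

definition S ::
  "(real ^ 'd) set \<Rightarrow> ('m \<Rightarrow> (real ^ 'd \<Rightarrow> real) \<Rightarrow> real) \<Rightarrow> ('m \<Rightarrow> real ^ 'd \<Rightarrow> real ^ 'd) set" where
  "S \<Omega> f = {\<sigma>. \<forall>i. \<sigma> i \<in> L2 \<Omega> \<and> neg_div_eq \<Omega> (\<sigma> i) (f i)}"

definition H ::
  "(real ^ 'd) set \<Rightarrow> ('n \<Rightarrow> real ^ 'd ^ 'd) \<Rightarrow> ('m \<Rightarrow> real)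
     \<Rightarrow> (real ^ 'd \<Rightarrow> real ^ 'n) \<times> ('m \<Rightarrow> real ^ 'd \<Rightarrow> real ^ 'd) \<Rightarrow> real" where
  "H \<Omega> M w = (\<lambda>(\<theta>, \<sigma>).
     \<Sum>i\<in>UNIV. w i * (\<integral>x. (norm (\<sigma> i x))\<^sup>2 / lam_minus M (\<theta> x) \<partial>lebesgue_on \<Omega>))"

definition saddle_points ::
  "(real ^ 'd) set \<Rightarrow> ('n \<Rightarrow> real ^ 'd ^ 'd) \<Rightarrow> ('n \<Rightarrow> real)
     \<Rightarrow> ('m \<Rightarrow> (real ^ 'd \<Rightarrow> real) \<Rightarrow> real) \<Rightarrow> ('m \<Rightarrow> real)
     \<Rightarrow> ((real ^ 'd \<Rightarrow> real ^ 'n) \<times> ('m \<Rightarrow> real ^ 'd \<Rightarrow> real ^ 'd)) set" where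
  "saddle_points \<Omega> M q f w = {(\<theta>s, \<sigma>s). \<theta>s \<in> T \<Omega> q \<and> \<sigma>s \<in> S \<Omega> f \<and>
     (\<forall>\<theta>\<in>T \<Omega> q. H \<Omega> M w (\<theta>, \<sigma>s) \<le> H \<Omega> M w (\<theta>s, \<sigma>s)) \<and>
     (\<forall>\<sigma>\<in>S \<Omega> f. H \<Omega> M w (\<theta>s, \<sigma>s) \<le> H \<Omega> M w (\<theta>s, \<sigma>))}"

definition Tstar ::
  "(real ^ 'd) set \<Rightarrow> ('n \<Rightarrow> real ^ 'd ^ 'd) \<Rightarrow> ('n \<Rightarrow> real)
     \<Rightarrow> ('m \<Rightarrow> (real ^ 'd \<Rightarrow> real) \<Rightarrow> real) \<Rightarrow> ('m \<Rightarrow> real)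
     \<Rightarrow> (real ^ 'd \<Rightarrow> real ^ 'n) set" where
  "Tstar \<Omega> M q f w = fst ` saddle_points \<Omega> M q f w"

end

(* Duality: for (theta, A) in B and any sigma in S, integrating the pointwise inequality
   2 sigma.g - A g.g <= |sigma|^2 / lam_minus(theta) at g = grad u_i gives J(theta, A) <= H(theta, sigma).
   Equality holds iff sigma_i = lam_minus(theta) grad u_i = A grad u_i a.e. for all i, and for
   A = lam_minus(theta) I the right-hand side is minimised by the flux of the solution.
   Since H is affine in theta, I = min H(., sigma) is concave; a maximiser of I, together with its
   flux, is a saddle point by perturbing theta along segments. The four claims are read off from the
   equality case. The linear theory needed (weak gradients, Poincare inequality, solvability of the
   Dirichlet problem) is obtained by minimising sequences directly in H10. *)
theory Submission
  imports Defs "HOL-Computational_Algebra.Polynomial"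
begin

section \<open>Square-integrable functions\<close>

text \<open>The obstacle is compactness: bounded sequences of designs converge only weakly, while
  the argument uses strong limits throughout. Both extremal problems are therefore solved by almost
  optimal sequences that a parallelogram identity makes Cauchy. In \<open>dirichlet_exists\<close>
  coercivity of the energy provides this. In \<open>maximizer_exists\<close> the objective is
  concave but not known to be strictly concave, so small norm enters as a second criterion. The
  perturbation step differentiates nothing. For a maximiser, moving the design by a fraction t
  shifts the optimal flux by a weighted squared norm of order t, and Young's inequality turns this
  into the saddle inequality. A coefficient above \<open>lam_minus\<close> loses nothing precisely
  where it acts on the gradients as the scalar one does. Hence maximisers in \<open>B\<close> need
  not be scalar, and the equality case rests on the kernel of a positive semidefinite matrix.
  Computations use \<open>inv_lam\<close>, the reciprocal of \<open>lam_minus\<close>, because it is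
  the reciprocal that is affine in the design.\<close>

definition l2sq :: "(real ^ 'd) set \<Rightarrow> (real ^ 'd \<Rightarrow> 'b::euclidean_space) \<Rightarrow> real" where
  "l2sq \<Omega> u = (\<integral>x. (norm (u x))\<^sup>2 \<partial>lebesgue_on \<Omega>)"

lemma norm_add_sq_le: "(norm (a + b))\<^sup>2 \<le> 2 * (norm a)\<^sup>2 + 2 * (norm (b::'a::real_inner))\<^sup>2"
proof -
  have "2 * (norm a)\<^sup>2 + 2 * (norm b)\<^sup>2 - (norm (a + b))\<^sup>2 = (norm (a - b))\<^sup>2"
    by (simp add: power2_norm_eq_inner algebra_simps inner_commute)
  then show ?thesis by (smt (verit) zero_le_power2)
qed

lemma L2_measurable: "u \<in> L2 \<Omega> \<Longrightarrow> u \<in> borel_measurable (lebesgue_on \<Omega>)"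
  and L2_integrable: "u \<in> L2 \<Omega> \<Longrightarrow> integrable (lebesgue_on \<Omega>) (\<lambda>x. (norm (u x))\<^sup>2)"
  by (auto simp: L2_def)

lemma L2_bound:
  assumes "v \<in> borel_measurable (lebesgue_on \<Omega>)" "u \<in> L2 \<Omega>"
    and "AE x in lebesgue_on \<Omega>. norm (v x) \<le> C * norm (u x)"
  shows "v \<in> L2 \<Omega>"
proof -
  have "integrable (lebesgue_on \<Omega>) (\<lambda>x. C\<^sup>2 * (norm (u x))\<^sup>2)"
    using L2_integrable[OF assms(2)] by simp
  moreover have "AE x in lebesgue_on \<Omega>. norm ((norm (v x))\<^sup>2) \<le> norm (C\<^sup>2 * (norm (u x))\<^sup>2)"
    using assms(3)
  proof eventually_elim
    case (elim x)
    from power_mono[OF elim norm_ge_zero, of 2] show ?case by (simp add: power_mult_distrib)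
  qed
  ultimately have "integrable (lebesgue_on \<Omega>) (\<lambda>x. (norm (v x))\<^sup>2)"
    by (elim Bochner_Integration.integrable_bound) (use assms(1) in auto)
  then show ?thesis
    unfolding L2_def using assms(1) by auto
qed

section \<open>Linear structure of L2 and the L2 pairing\<close>

lemma L2_zero: "(\<lambda>x. 0) \<in> L2 \<Omega>"
  by (simp add: L2_def)

lemma L2_add: assumes "u \<in> L2 \<Omega>" "v \<in> L2 \<Omega>" shows "(\<lambda>x. u x + v x) \<in> L2 \<Omega>"
proof -
  have "integrable (lebesgue_on \<Omega>) (\<lambda>x. 2 * (norm (u x))\<^sup>2 + 2 * (norm (v x))\<^sup>2)"
    using L2_integrable[OF assms(1)] L2_integrable[OF assms(2)] by simp
  then have "integrable (lebesgue_on \<Omega>) (\<lambda>x. (norm (u x + v x))\<^sup>2)"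
    by (rule Bochner_Integration.integrable_bound)
      (use L2_measurable[OF assms(1)] L2_measurable[OF assms(2)] norm_add_sq_le in auto)
  then show ?thesis using assms by (auto simp: L2_def)
qed

lemma L2_scaleR: "u \<in> L2 \<Omega> \<Longrightarrow> (\<lambda>x. c *\<^sub>R u x) \<in> L2 \<Omega>"
  by (rule L2_bound[of _ _ u "\<bar>c\<bar>"]) (auto simp: L2_def)

lemma L2_mult: "u \<in> L2 \<Omega> \<Longrightarrow> (\<lambda>x. c * u x) \<in> L2 \<Omega>" for c :: real
  using L2_scaleR[of u \<Omega> c] by simp

lemma L2_diff: assumes "u \<in> L2 \<Omega>" "v \<in> L2 \<Omega>" shows "(\<lambda>x. u x - v x) \<in> L2 \<Omega>"
  using L2_add[OF assms(1) L2_scaleR[OF assms(2), of "-1"]] by simp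

lemma L2_component: "u \<in> L2 \<Omega> \<Longrightarrow> (\<lambda>x. u x $ i) \<in> L2 \<Omega>" for u :: "real ^ 'd \<Rightarrow> real ^ 'k"
  by (rule L2_bound[of _ _ u 1]) (use component_le_norm_cart in \<open>auto simp: L2_def cart_eq_inner_axis\<close>)

lemma integrable_inner_L2:
  assumes "u \<in> L2 \<Omega>" "v \<in> L2 \<Omega>" shows "integrable (lebesgue_on \<Omega>) (\<lambda>x. u x \<bullet> v x)"
proof -
  have "integrable (lebesgue_on \<Omega>) (\<lambda>x. (norm (u x))\<^sup>2 + (norm (v x))\<^sup>2)"
    using L2_integrable[OF assms(1)] L2_integrable[OF assms(2)] by simp
  then show ?thesis
  proof (rule Bochner_Integration.integrable_bound)
    show "AE x in lebesgue_on \<Omega>. norm (u x \<bullet> v x) \<le> norm ((norm (u x))\<^sup>2 + (norm (v x))\<^sup>2)"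
    proof (rule always_eventually, rule allI)
      fix x
      have "norm (u x \<bullet> v x) \<le> norm (u x) * norm (v x)" by (simp add: Cauchy_Schwarz_ineq2)
      also have "\<dots> \<le> (norm (u x))\<^sup>2 + (norm (v x))\<^sup>2"
        using sum_squares_bound[of "norm (u x)" "norm (v x)"] mult_nonneg_nonneg[OF norm_ge_zero[of "u x"] norm_ge_zero[of "v x"]]
        by linarith
      finally show "norm (u x \<bullet> v x) \<le> norm ((norm (u x))\<^sup>2 + (norm (v x))\<^sup>2)" by simp
    qed
  qed (use L2_measurable[OF assms(1)] L2_measurable[OF assms(2)] in measurable)
qed

lemma integrable_mult_L2:
  "u \<in> L2 \<Omega> \<Longrightarrow> v \<in> L2 \<Omega> \<Longrightarrow> integrable (lebesgue_on \<Omega>) (\<lambda>x. u x * v x :: real)"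
  using integrable_inner_L2[of u \<Omega> v] by simp

lemma l2sq_nonneg [simp]: "l2sq \<Omega> u \<ge> 0"
  by (simp add: l2sq_def)

lemma l2sq_scaleR: "l2sq \<Omega> (\<lambda>x. c *\<^sub>R u x) = c\<^sup>2 * l2sq \<Omega> u"
  by (simp add: l2sq_def power_mult_distrib)

lemma l2sq_minus_commute: "l2sq \<Omega> (\<lambda>x. u x - v x) = l2sq \<Omega> (\<lambda>x. v x - u x)"
  by (simp add: l2sq_def norm_minus_commute)

lemma l2sq_add_le:
  assumes "u \<in> L2 \<Omega>" "v \<in> L2 \<Omega>"
  shows "l2sq \<Omega> (\<lambda>x. u x + v x) \<le> 2 * l2sq \<Omega> u + 2 * l2sq \<Omega> v"
proof -
  have "l2sq \<Omega> (\<lambda>x. u x + v x) \<le> (\<integral>x. 2 * (norm (u x))\<^sup>2 + 2 * (norm (v x))\<^sup>2 \<partial>lebesgue_on \<Omega>)"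
    unfolding l2sq_def using L2_integrable[OF L2_add[OF assms]] L2_integrable[OF assms(1)]
      L2_integrable[OF assms(2)]
    by (intro integral_mono norm_add_sq_le) auto
  also have "\<dots> = 2 * l2sq \<Omega> u + 2 * l2sq \<Omega> v"
    unfolding l2sq_def using L2_integrable[OF assms(1)] L2_integrable[OF assms(2)] by simp
  finally show ?thesis .
qed

lemma l2sq_diff_le:
  assumes "u \<in> L2 \<Omega>" "v \<in> L2 \<Omega>" "z \<in> L2 \<Omega>"
  shows "l2sq \<Omega> (\<lambda>x. u x - v x) \<le> 2 * l2sq \<Omega> (\<lambda>x. u x - z x) + 2 * l2sq \<Omega> (\<lambda>x. z x - v x)"
  using l2sq_add_le[OF L2_diff[OF assms(1,3)] L2_diff[OF assms(3,2)]] by simp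

lemma l2sq_cong_AE:
  assumes "u \<in> L2 \<Omega>" "v \<in> L2 \<Omega>" "AE x in lebesgue_on \<Omega>. u x = v x"
  shows "l2sq \<Omega> u = l2sq \<Omega> v"
  unfolding l2sq_def using L2_integrable[OF assms(1)] L2_integrable[OF assms(2)] assms(3)
  by (intro integral_cong_AE) (auto elim!: eventually_mono)

text \<open>The squared norm of u + t v is a nonnegative quadratic in t, so its discriminant is not
  positive. If v has norm zero, it is affine in t and its slope must vanish.\<close>

lemma l2_Cauchy_Schwarz:
  assumes "u \<in> L2 \<Omega>" "v \<in> L2 \<Omega>"
  shows "(\<integral>x. u x \<bullet> v x \<partial>lebesgue_on \<Omega>)\<^sup>2 \<le> l2sq \<Omega> u * l2sq \<Omega> v"
proof -
  let ?c = "\<integral>x. u x \<bullet> v x \<partial>lebesgue_on \<Omega>"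
  have "0 \<le> l2sq \<Omega> u + 2 * t * ?c + t\<^sup>2 * l2sq \<Omega> v" for t
  proof -
    have "(norm (u x + t *\<^sub>R v x))\<^sup>2 = (norm (u x))\<^sup>2 + 2 * t * (u x \<bullet> v x) + t\<^sup>2 * (norm (v x))\<^sup>2" for x
      unfolding power2_norm_eq_inner by (simp add: algebra_simps inner_commute power2_eq_square)
    then have "l2sq \<Omega> (\<lambda>x. u x + t *\<^sub>R v x) = l2sq \<Omega> u + 2 * t * ?c + t\<^sup>2 * l2sq \<Omega> v"
      unfolding l2sq_def using L2_integrable[OF assms(1)] L2_integrable[OF assms(2)] integrable_inner_L2[OF assms]
      by simp
    then show ?thesis by (metis l2sq_nonneg)
  qed
  note q = this
  show ?thesis
  proof (cases "l2sq \<Omega> v = 0")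
    case True
    have "?c = 0"
    proof (rule ccontr)
      assume "?c \<noteq> 0"
      \<comment> \<open>At this t the affine function has the value
        \<open>- l2sq \<Omega> u - 2\<close>.\<close>
      then show False using q[of "- (l2sq \<Omega> u + 1) / ?c"] True l2sq_nonneg[of \<Omega> u] by simp
    qed
    then show ?thesis by simp
  next
    case False
    then have p: "l2sq \<Omega> v > 0" by (simp add: order_less_le)
    have "0 \<le> l2sq \<Omega> u - ?c\<^sup>2 / l2sq \<Omega> v"
      using q[of "- ?c / l2sq \<Omega> v"] p by (simp add: field_simps power2_eq_square)
    then show ?thesis using p by (simp add: field_simps)
  qed
qed

text \<open>The rate 1/4^n leaves room for a weight 2^n: the weighted squared increments still have
  a finite total integral, so almost everywhere they are bounded, and the increments decay like
  (1/2)^(n/2). Summable squares alone would not make the increments summable.\<close>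

lemma AE_convergent_of_l2_summable:
  fixes u :: "nat \<Rightarrow> real ^ 'd \<Rightarrow> 'b::euclidean_space"
  assumes u: "\<And>n. u n \<in> L2 \<Omega>" and b: "\<And>n. l2sq \<Omega> (\<lambda>x. u (Suc n) x - u n x) \<le> (1/4)^n"
  shows "AE x in lebesgue_on \<Omega>. convergent (\<lambda>n. u n x)"
proof -
  define d where "d n x = u (Suc n) x - u n x" for n x
  have dL: "d n \<in> L2 \<Omega>" for n unfolding d_def using u L2_diff by blast
  have [measurable]: "d n \<in> borel_measurable (lebesgue_on \<Omega>)" for n using dL L2_measurable by blast
  have "(\<integral>\<^sup>+x. (\<Sum>n. ennreal (2^n * (norm (d n x))\<^sup>2)) \<partial>lebesgue_on \<Omega>)
      = (\<Sum>n. \<integral>\<^sup>+x. ennreal (2^n * (norm (d n x))\<^sup>2) \<partial>lebesgue_on \<Omega>)"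
    by (rule nn_integral_suminf) measurable
  also have "\<dots> = (\<Sum>n. ennreal (2^n * l2sq \<Omega> (d n)))"
    unfolding l2sq_def by (subst nn_integral_eq_integral) (use L2_integrable[OF dL] in auto)
  also have "\<dots> \<le> (\<Sum>n. ennreal ((1/2)^n))"
  proof (intro suminf_le ennreal_leI)
    fix n
    have "2^n * l2sq \<Omega> (d n) \<le> 2^n * (1/4)^n" using b[of n] unfolding d_def by simp
    also have "\<dots> = (1/2)^n" by (simp flip: power_mult_distrib)
    finally show "2^n * l2sq \<Omega> (d n) \<le> (1/2)^n" .
  qed auto
  also have "\<dots> = ennreal (\<Sum>n. (1/2)^n)" by (rule suminf_ennreal2) auto
  also have "\<dots> < \<infinity>" by simp
  finally have "AE x in lebesgue_on \<Omega>. (\<Sum>n. ennreal (2^n * (norm (d n x))\<^sup>2)) \<noteq> \<infinity>"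
    by (intro nn_integral_PInf_AE) (auto simp: top.not_eq_extremum)
  then show ?thesis
  proof eventually_elim
    case (elim x)
    have "summable (\<lambda>n. 2^n * (norm (d n x))\<^sup>2)"
      using elim by (intro summable_suminf_not_top) auto
    then have "Bseq (\<lambda>n. 2^n * (norm (d n x))\<^sup>2)"
      by (intro convergent_imp_Bseq convergentI[OF summable_LIMSEQ_zero])
    then obtain C where "\<forall>n. norm (2^n * (norm (d n x))\<^sup>2) \<le> C"
      by (auto elim: BseqE)
    then have C: "2^n * (norm (d n x))\<^sup>2 \<le> C" for n
      by (auto simp: abs_le_iff)
    have "norm (d n x) \<le> sqrt C * (sqrt (1/2))^n" for n
    proof -
      have "(norm (d n x))\<^sup>2 \<le> C * (1/2)^n" using C[of n] by (simp add: field_simps)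
      then have "norm (d n x) \<le> sqrt (C * (1/2)^n)" by (simp add: real_le_rsqrt)
      then show ?thesis by (simp add: real_sqrt_mult real_sqrt_power)
    qed
    moreover have "summable (\<lambda>n. sqrt C * (sqrt (1/2))^n)"
      by (intro summable_mult summable_geometric) (simp add: real_sqrt_divide)
    ultimately have "summable (\<lambda>n. d n x)"
      by (elim summable_comparison_test') auto
    then have "convergent (\<lambda>n. \<Sum>i<n. d i x)" by (simp add: summable_iff_convergent)
    moreover have "(\<Sum>i<n. d i x) = u n x - u 0 x" for n
      unfolding d_def by (induction n) auto
    ultimately have "convergent (\<lambda>n. u n x - u 0 x)" by simp
    from convergent_add[OF this convergent_const[of "u 0 x"]] show ?case by simp
  qed
qed

lemma l2_Cauchy_subseq:
  assumes c: "\<And>e. e > 0 \<Longrightarrow> \<exists>N. \<forall>m\<ge>N. \<forall>n\<ge>N. l2sq \<Omega> (\<lambda>x. u m x - u n x) < e"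
  obtains r :: "nat \<Rightarrow> nat"
  where "strict_mono r" "\<And>n. l2sq \<Omega> (\<lambda>x. u (r (Suc n)) x - u (r n) x) \<le> (1/4)^n"
proof -
  have "\<forall>k. \<exists>N. \<forall>m\<ge>N. \<forall>n\<ge>N. l2sq \<Omega> (\<lambda>x. u m x - u n x) < (1/4)^k"
    using c by simp
  then obtain N where N: "\<And>k m n. m \<ge> N k \<Longrightarrow> n \<ge> N k \<Longrightarrow> l2sq \<Omega> (\<lambda>x. u m x - u n x) < (1/4)^k"
    by metis
  \<comment> \<open>The maximum enforces strict growth and the threshold of the next rate at the
    same time.\<close>
  define r where "r = rec_nat (N 0) (\<lambda>k rk. max (Suc rk) (N (Suc k)))"
  have r0: "r 0 = N 0" and rS: "r (Suc k) = max (Suc (r k)) (N (Suc k))" for k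
    by (simp_all add: r_def)
  have rN: "r k \<ge> N k" for k by (cases k) (simp_all add: r0 rS)
  have inc: "r (Suc k) > r k" for k by (simp add: rS)
  show ?thesis
  proof (rule that[of r])
    show "strict_mono r" using inc by (simp add: strict_mono_Suc_iff)
    show "l2sq \<Omega> (\<lambda>x. u (r (Suc n)) x - u (r n) x) \<le> (1/4)^n" for n
      using N[OF le_trans[OF rN less_imp_le[OF inc]] rN] by (rule less_imp_le)
  qed
qed

text \<open>Riesz-Fischer. The almost everywhere convergent subsequence is exported as well:
  pointwise constraints on designs and dominated convergence are applied along it.\<close>

lemma L2_complete:
  fixes u :: "nat \<Rightarrow> real ^ 'd \<Rightarrow> 'b::euclidean_space"
  assumes u: "\<And>n. u n \<in> L2 \<Omega>"
    and c: "\<And>e. e > 0 \<Longrightarrow> \<exists>N. \<forall>m\<ge>N. \<forall>n\<ge>N. l2sq \<Omega> (\<lambda>x. u m x - u n x) < e"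
  obtains v and r :: "nat \<Rightarrow> nat"
  where "v \<in> L2 \<Omega>" "(\<lambda>n. l2sq \<Omega> (\<lambda>x. u n x - v x)) \<longlonglongrightarrow> 0"
    "strict_mono r" "AE x in lebesgue_on \<Omega>. (\<lambda>n. u (r n) x) \<longlonglongrightarrow> v x"
proof -
  from l2_Cauchy_subseq[OF c] obtain r where r: "strict_mono r"
    "\<And>n. l2sq \<Omega> (\<lambda>x. u (r (Suc n)) x - u (r n) x) \<le> (1/4)^n" by blast
  define v where "v x = lim (\<lambda>n. u (r n) x)" for x
  have [measurable]: "u n \<in> borel_measurable (lebesgue_on \<Omega>)" for n using L2_measurable[OF u] .
  have [measurable]: "v \<in> borel_measurable (lebesgue_on \<Omega>)"
    unfolding v_def by (rule borel_measurable_lim_metric) measurable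
  have "AE x in lebesgue_on \<Omega>. convergent (\<lambda>n. u (r n) x)"
    using AE_convergent_of_l2_summable[of "\<lambda>n. u (r n)"] u r(2) by blast
  then have ae: "AE x in lebesgue_on \<Omega>. (\<lambda>n. u (r n) x) \<longlonglongrightarrow> v x"
    by eventually_elim (simp add: v_def convergent_LIMSEQ_iff)
  \<comment> \<open>Fatou along the subsequence with the first index fixed. It yields both the
    membership of \<open>u n - v\<close> in \<open>L2\<close> and the rate of convergence.\<close>
  have fatou: "integrable (lebesgue_on \<Omega>) (\<lambda>x. (norm (u n x - v x))\<^sup>2) \<and> l2sq \<Omega> (\<lambda>x. u n x - v x) \<le> e"
    if N: "\<forall>m\<ge>N. \<forall>n\<ge>N. l2sq \<Omega> (\<lambda>x. u m x - u n x) < e" and n: "n \<ge> N" for n N e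
  proof -
    have e: "e \<ge> 0" using N n l2sq_nonneg by (meson order.strict_trans1 less_imp_le)
    have "(\<integral>\<^sup>+x. ennreal ((norm (u n x - v x))\<^sup>2) \<partial>lebesgue_on \<Omega>)
        = (\<integral>\<^sup>+x. liminf (\<lambda>k. ennreal ((norm (u n x - u (r k) x))\<^sup>2)) \<partial>lebesgue_on \<Omega>)"
    proof (rule nn_integral_cong_AE)
      show "AE x in lebesgue_on \<Omega>. ennreal ((norm (u n x - v x))\<^sup>2)
          = liminf (\<lambda>k. ennreal ((norm (u n x - u (r k) x))\<^sup>2))"
        using ae
      proof eventually_elim
        case (elim x)
        have "(\<lambda>k. ennreal ((norm (u n x - u (r k) x))\<^sup>2)) \<longlonglongrightarrow> ennreal ((norm (u n x - v x))\<^sup>2)"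
          by (intro tendsto_ennrealI tendsto_intros elim)
        from lim_imp_Liminf[OF _ this] show ?case by simp
      qed
    qed
    also have "\<dots> \<le> liminf (\<lambda>k. \<integral>\<^sup>+x. ennreal ((norm (u n x - u (r k) x))\<^sup>2) \<partial>lebesgue_on \<Omega>)"
      by (rule nn_integral_liminf) measurable
    also have "\<dots> = liminf (\<lambda>k. ennreal (l2sq \<Omega> (\<lambda>x. u n x - u (r k) x)))"
      unfolding l2sq_def
      by (subst nn_integral_eq_integral) (use L2_integrable[OF L2_diff[OF u u]] in auto)
    also have "\<dots> \<le> ennreal e"
    proof (rule Liminf_le)
      have "\<forall>\<^sub>F k in sequentially. N \<le> r k"
        using r(1) by (meson eventually_sequentiallyI le_trans seq_suble)
      then show "\<forall>\<^sub>F k in sequentially. ennreal (l2sq \<Omega> (\<lambda>x. u n x - u (r k) x)) \<le> ennreal e"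
        by eventually_elim (use N n in \<open>auto simp: less_imp_le intro!: ennreal_leI\<close>)
    qed simp
    finally have le: "(\<integral>\<^sup>+x. ennreal ((norm (u n x - v x))\<^sup>2) \<partial>lebesgue_on \<Omega>) \<le> ennreal e" .
    have i: "integrable (lebesgue_on \<Omega>) (\<lambda>x. (norm (u n x - v x))\<^sup>2)"
      by (rule integrableI_bounded) (use le in \<open>auto simp: le_less_trans\<close>)
    moreover have "l2sq \<Omega> (\<lambda>x. u n x - v x) \<le> e"
      using le e unfolding l2sq_def by (subst (asm) nn_integral_eq_integral[OF i]) auto
    ultimately show ?thesis by blast
  qed
  obtain N where "\<forall>m\<ge>N. \<forall>n\<ge>N. l2sq \<Omega> (\<lambda>x. u m x - u n x) < 1" using c[of 1] by auto
  then have "(\<lambda>x. u N x - v x) \<in> L2 \<Omega>" using fatou[of N 1 N] by (auto simp: L2_def)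
  from L2_diff[OF u[of N] this] have v: "v \<in> L2 \<Omega>" by simp
  have "(\<lambda>n. l2sq \<Omega> (\<lambda>x. u n x - v x)) \<longlonglongrightarrow> 0"
  proof (rule LIMSEQ_I)
    fix e :: real assume "e > 0"
    then obtain N where "\<forall>m\<ge>N. \<forall>n\<ge>N. l2sq \<Omega> (\<lambda>x. u m x - u n x) < e/2" using c[of "e/2"] by auto
    then have "\<forall>n\<ge>N. l2sq \<Omega> (\<lambda>x. u n x - v x) \<le> e/2" using fatou by blast
    then show "\<exists>N. \<forall>n\<ge>N. norm (l2sq \<Omega> (\<lambda>x. u n x - v x) - 0) < e"
      using \<open>e > 0\<close> by (intro exI[of _ N]) (auto intro: le_less_trans)
  qed
  with v r(1) ae show ?thesis using that by blast
qed

lemma l2_inner_tendsto: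
  assumes u: "\<And>n. u n \<in> L2 \<Omega>" and v: "v \<in> L2 \<Omega>" and z: "z \<in> L2 \<Omega>"
    and l: "(\<lambda>n. l2sq \<Omega> (\<lambda>x. u n x - v x)) \<longlonglongrightarrow> 0"
  shows "(\<lambda>n. \<integral>x. u n x \<bullet> z x \<partial>lebesgue_on \<Omega>) \<longlonglongrightarrow> (\<integral>x. v x \<bullet> z x \<partial>lebesgue_on \<Omega>)"
proof -
  have "(\<lambda>n. ((\<integral>x. u n x \<bullet> z x \<partial>lebesgue_on \<Omega>) - (\<integral>x. v x \<bullet> z x \<partial>lebesgue_on \<Omega>))\<^sup>2) \<longlonglongrightarrow> 0"
  proof (rule tendsto_sandwich[OF _ _ tendsto_const])
    show "\<forall>\<^sub>F n in sequentially. ((\<integral>x. u n x \<bullet> z x \<partial>lebesgue_on \<Omega>) - (\<integral>x. v x \<bullet> z x \<partial>lebesgue_on \<Omega>))\<^sup>2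
        \<le> l2sq \<Omega> (\<lambda>x. u n x - v x) * l2sq \<Omega> z"
      using l2_Cauchy_Schwarz[OF L2_diff[OF u v] z] integrable_inner_L2[OF u z] integrable_inner_L2[OF v z]
      by (simp add: inner_diff_left)
    show "(\<lambda>n. l2sq \<Omega> (\<lambda>x. u n x - v x) * l2sq \<Omega> z) \<longlonglongrightarrow> 0"
      by (rule tendsto_mult_left_zero[OF l])
  qed auto
  then have "(\<lambda>n. (\<integral>x. u n x \<bullet> z x \<partial>lebesgue_on \<Omega>) - (\<integral>x. v x \<bullet> z x \<partial>lebesgue_on \<Omega>)) \<longlonglongrightarrow> 0"
    using tendsto_real_sqrt tendsto_rabs_zero_iff by fastforce
  then show ?thesis by (rule LIM_zero_cancel)
qed

section \<open>Smooth functions and test functions\<close>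

definition smooth :: "(real ^ 'd \<Rightarrow> real) \<Rightarrow> bool" where
  "smooth \<phi> \<longleftrightarrow> (\<forall>k. Ck k \<phi>)"

lemma Ck_Suc_imp: "Ck (Suc k) \<phi> \<Longrightarrow> Ck k \<phi>"
proof (induction k arbitrary: \<phi>)
  case 0
  then show ?case
    by (auto simp: differentiable_imp_continuous_within continuous_on_eq_continuous_within)
next
  case (Suc k)
  then show ?case by (metis Ck.simps(2))
qed

lemma smooth_imp_differentiable: "smooth \<phi> \<Longrightarrow> \<phi> differentiable (at x)"
  unfolding smooth_def by (metis Ck.simps(2))

lemma smooth_partial: "smooth \<phi> \<Longrightarrow> smooth (partial i \<phi>)"
  unfolding smooth_def by (metis Ck.simps(2))

lemma smooth_imp_continuous: "smooth \<phi> \<Longrightarrow> continuous_on A \<phi>"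
  unfolding smooth_def by (metis Ck.simps(1) continuous_on_subset subset_UNIV)

section \<open>Calculus of partial derivatives\<close>

lemma has_derivative_partial_eq: "(\<phi> has_derivative D) (at x) \<Longrightarrow> partial i \<phi> x = D (axis i 1)"
  unfolding partial_def by (metis frechet_derivative_at)

lemma differentiable_imp_has_derivative:
  "\<phi> differentiable (at x) \<Longrightarrow> (\<phi> has_derivative frechet_derivative \<phi> (at x)) (at x)"
  by (simp add: frechet_derivative_works)

lemma partial_const: "partial i (\<lambda>x. c) = (\<lambda>x. 0)"
  by (rule ext, rule has_derivative_partial_eq[where D="\<lambda>h. 0", simplified]) simp

lemma partial_add:
  assumes "\<phi> differentiable (at x)" "\<psi> differentiable (at x)"
  shows "partial i (\<lambda>x. \<phi> x + \<psi> x) x = partial i \<phi> x + partial i \<psi> x"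
  using has_derivative_partial_eq[OF has_derivative_add[OF assms[THEN differentiable_imp_has_derivative]]]
  by (simp add: partial_def)

lemma partial_mult:
  assumes "\<phi> differentiable (at x)" "\<psi> differentiable (at x)"
  shows "partial i (\<lambda>x. \<phi> x * \<psi> x) x = \<phi> x * partial i \<psi> x + partial i \<phi> x * \<psi> x"
  using has_derivative_partial_eq[OF has_derivative_mult[OF assms[THEN differentiable_imp_has_derivative]]]
  by (simp add: partial_def)

lemma partial_comp:
  assumes "(h has_field_derivative h') (at (\<phi> x))" "\<phi> differentiable (at x)"
  shows "partial i (\<lambda>x. h (\<phi> x)) x = h' * partial i \<phi> x"
proof -
  have "((\<lambda>x. h (\<phi> x)) has_derivative (\<lambda>y. h' * frechet_derivative \<phi> (at x) y)) (at x)"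
    using has_derivative_compose[OF differentiable_imp_has_derivative[OF assms(2)]]
      assms(1) unfolding has_field_derivative_def by blast
  from has_derivative_partial_eq[OF this] show ?thesis by (simp add: partial_def)
qed

lemma partial_coord: "partial i (\<lambda>x. x $ j) = (\<lambda>x. if i = j then 1 else 0)"
proof
  fix x :: "real ^ 'a"
  have "((\<lambda>x. x $ j) has_derivative (\<lambda>h. h $ j)) (at x)"
    by (rule bounded_linear_imp_has_derivative) (rule bounded_linear_vec_nth)
  from has_derivative_partial_eq[OF this] show "partial i (\<lambda>x. x $ j) x = (if i = j then 1 else 0)"
    by (simp add: axis_def)
qed

section \<open>Closure properties of smooth functions\<close>

lemma Ck_const: "Ck k (\<lambda>x. c)"
  by (induction k arbitrary: c) (simp_all add: partial_const)

lemma smooth_const: "smooth (\<lambda>x. c)"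
  by (simp add: smooth_def Ck_const)

lemma smooth_coord: "smooth (\<lambda>x. x $ j)"
  unfolding smooth_def
proof
  fix k show "Ck k (\<lambda>x :: real ^ 'a. x $ j)"
    by (cases k) (auto simp: partial_coord Ck_const intro!: continuous_intros
        bounded_linear_imp_differentiable bounded_linear_vec_nth)
qed

lemma Ck_add: "Ck k \<phi> \<Longrightarrow> Ck k \<psi> \<Longrightarrow> Ck k (\<lambda>x. \<phi> x + \<psi> x)"
proof (induction k arbitrary: \<phi> \<psi>)
  case (Suc k)
  have "partial i (\<lambda>x. \<phi> x + \<psi> x) = (\<lambda>x. partial i \<phi> x + partial i \<psi> x)" for i
    using Suc.prems by (auto simp: partial_add)
  then show ?case using Suc by auto
qed (auto intro: continuous_on_add)

lemma smooth_add: "smooth \<phi> \<Longrightarrow> smooth \<psi> \<Longrightarrow> smooth (\<lambda>x. \<phi> x + \<psi> x)"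
  by (simp add: smooth_def Ck_add)

lemma Ck_mult: "Ck k \<phi> \<Longrightarrow> Ck k \<psi> \<Longrightarrow> Ck k (\<lambda>x. \<phi> x * \<psi> x)"
proof (induction k arbitrary: \<phi> \<psi>)
  case (Suc k)
  have eq: "partial i (\<lambda>x. \<phi> x * \<psi> x) = (\<lambda>x. \<phi> x * partial i \<psi> x + partial i \<phi> x * \<psi> x)" for i
    using Suc.prems by (auto simp: partial_mult)
  have "Ck k \<phi>" "Ck k \<psi>" using Suc.prems Ck_Suc_imp by blast+
  then have "Ck k (partial i (\<lambda>x. \<phi> x * \<psi> x))" for i
    unfolding eq using Suc.prems by (intro Ck_add Suc.IH) auto
  then show ?case using Suc.prems by auto
qed (auto intro: continuous_on_mult)

lemma smooth_mult: "smooth \<phi> \<Longrightarrow> smooth \<psi> \<Longrightarrow> smooth (\<lambda>x. \<phi> x * \<psi> x)"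
  by (simp add: smooth_def Ck_mult)

lemma smooth_cmult: "smooth \<phi> \<Longrightarrow> smooth (\<lambda>x. c * \<phi> x)"
  by (intro smooth_mult smooth_const)

lemma smooth_diff: "smooth \<phi> \<Longrightarrow> smooth \<psi> \<Longrightarrow> smooth (\<lambda>x. \<phi> x - \<psi> x)"
  using smooth_add[of \<phi> "\<lambda>x. (-1) * \<psi> x"] smooth_cmult[of \<psi> "-1"] by simp

lemma smooth_sum: "finite A \<Longrightarrow> (\<And>j. j \<in> A \<Longrightarrow> smooth (\<phi> j)) \<Longrightarrow> smooth (\<lambda>x. \<Sum>j\<in>A. \<phi> j x)"
  by (induction A rule: finite_induct) (auto intro: smooth_const smooth_add)

text \<open>The outer function comes with its whole chain of derivatives, because a partial
  derivative of \<open>h n\<close> composed with \<open>\<phi>\<close> involves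
  \<open>h (Suc n)\<close>; the induction on the order must let n vary.\<close>

lemma smooth_comp:
  fixes h :: "nat \<Rightarrow> real \<Rightarrow> real"
  assumes h: "\<And>n t. (h n has_field_derivative h (Suc n) t) (at t)" and \<phi>: "smooth \<phi>"
  shows "smooth (\<lambda>x. h n (\<phi> x))"
proof -
  have d: "(\<lambda>x. h n (\<phi> x)) differentiable (at x)" for n x
    using has_derivative_compose[OF differentiable_imp_has_derivative[OF smooth_imp_differentiable[OF \<phi>]]
        h[unfolded has_field_derivative_def]] by (rule differentiableI)
  have "Ck k (\<lambda>x. h n (\<phi> x))" for k
  proof (induction k arbitrary: n)
    case 0
    then show ?case using d by (auto intro: differentiable_imp_continuous_within simp: continuous_on_eq_continuous_within)
  next
    case (Suc k)
    have "partial i (\<lambda>x. h n (\<phi> x)) = (\<lambda>x. h (Suc n) (\<phi> x) * partial i \<phi> x)" for i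
      using partial_comp[OF h smooth_imp_differentiable[OF \<phi>]] by auto
    moreover have "Ck k (\<lambda>x. h (Suc n) (\<phi> x) * partial i \<phi> x)" for i
      using Suc smooth_partial[OF \<phi>, of i] by (intro Ck_mult) (auto simp: smooth_def)
    ultimately show ?case using d by simp
  qed
  then show ?thesis by (simp add: smooth_def)
qed

text \<open>The classical flat function exp(-1/t), with a polynomial factor in 1/t so that the
  family is closed under differentiation.\<close>

definition flat :: "real poly \<Rightarrow> real \<Rightarrow> real" where
  "flat p t = (if t > 0 then poly p (1/t) * exp (- (1/t)) else 0)"

lemma poly_mult_exp_minus_tendsto: "((\<lambda>s. poly p s * exp (- s)) \<longlongrightarrow> (0::real)) at_top"
proof -
  have "((\<lambda>s::real. \<Sum>i\<le>degree p. coeff p i * (s ^ i / exp s)) \<longlongrightarrow> (\<Sum>i\<le>degree p. coeff p i * 0)) at_top"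
    by (intro tendsto_intros tendsto_power_div_exp_0)
  then show ?thesis by (simp add: poly_altdef sum_distrib_right sum_divide_distrib exp_minus field_simps)
qed

text \<open>With s = 1/t, the derivative of p(s) exp(-s) in t is s^2 (p(s) - p'(s)) exp(-s), again
  of the same shape; at t = 0 the exponential dominates every polynomial in s.\<close>

lemma flat_has_derivative:
  "(flat p has_field_derivative flat ([:0,0,1:] * (p - pderiv p)) t) (at t)"
proof -
  consider "t > 0" | "t < 0" | "t = 0" by linarith
  then show ?thesis
  proof cases
    case 1
    have "((\<lambda>t. poly p (1/t) * exp (- (1/t))) has_field_derivative
        (poly p (1/t) * (exp (- (1/t)) * (1 / t^2)) + (poly (pderiv p) (1/t) * (- 1 / t^2)) * exp (- (1/t)))) (at t)"
      using 1 by (auto intro!: derivative_eq_intros DERIV_chain2[OF poly_DERIV] simp: power2_eq_square)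
    moreover have "poly p (1/t) * (exp (- (1/t)) * (1 / t^2)) + (poly (pderiv p) (1/t) * (- 1 / t^2)) * exp (- (1/t))
        = flat ([:0,0,1:] * (p - pderiv p)) t"
      using 1 by (simp add: flat_def algebra_simps power2_eq_square)
    ultimately have "((\<lambda>t. poly p (1/t) * exp (- (1/t))) has_field_derivative
        flat ([:0,0,1:] * (p - pderiv p)) t) (at t)" by simp
    then show ?thesis
      by (rule has_field_derivative_transform_within_open[of _ _ _ "{0<..}"]) (use 1 in \<open>auto simp: flat_def\<close>)
  next
    case 2
    have "((\<lambda>t. 0) has_field_derivative flat ([:0,0,1:] * (p - pderiv p)) t) (at t)"
      using 2 by (simp add: flat_def)
    then show ?thesis
      by (rule has_field_derivative_transform_within_open[of _ _ _ "{..<0}"]) (use 2 in \<open>auto simp: flat_def\<close>)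
  next
    case 3
    \<comment> \<open>The quotient \<open>flat p h / h\<close> equals s p(s) exp(-s) at s = 1/h,
      which explains the extra factor \<open>[:0,1:]\<close>.\<close>
    have "((\<lambda>h. poly ([:0,1:] * p) (inverse h) * exp (- (inverse h))) \<longlongrightarrow> 0) (at_right (0::real))"
      using filterlim_compose[OF poly_mult_exp_minus_tendsto filterlim_inverse_at_top_right] .
    then have r: "((\<lambda>h. flat p h / h) \<longlongrightarrow> 0) (at_right 0)"
      by (rule Lim_transform_eventually)
        (auto simp: flat_def eventually_at_filter field_simps)
    have l: "((\<lambda>h. flat p h / h) \<longlongrightarrow> 0) (at_left 0)"
      by (rule Lim_transform_eventually[OF tendsto_const]) (auto simp: flat_def eventually_at_filter)
    have "((\<lambda>h. flat p h / h) \<longlongrightarrow> 0) (at 0)"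
      using l r by (simp add: filterlim_split_at)
    then show ?thesis using 3 by (simp add: DERIV_def flat_def)
  qed
qed

lemma smooth_flat: "smooth \<phi> \<Longrightarrow> smooth (\<lambda>x. flat p (\<phi> x))"
  using smooth_comp[of "\<lambda>n. flat (((\<lambda>p. [:0,0,1:] * (p - pderiv p)) ^^ n) p)" \<phi> 0] flat_has_derivative
  by simp

lemma smooth_exp: "smooth \<phi> \<Longrightarrow> smooth (\<lambda>x. exp (\<phi> x))"
  using smooth_comp[of "\<lambda>n. exp" \<phi> 0] by (simp add: DERIV_exp)

text \<open>The function exp(-1/(r^2 - |x-c|^2)) cut off outside the ball. The squared distance is
  spelled out in coordinates so that the closure rules for \<open>smooth\<close> apply.\<close>

definition bump :: "real ^ 'd \<Rightarrow> real \<Rightarrow> real ^ 'd \<Rightarrow> real" where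
  "bump c r x = flat 1 (r\<^sup>2 - (\<Sum>j\<in>UNIV. (x $ j - c $ j) * (x $ j - c $ j)))"

lemma smooth_bump: "smooth (bump c r)"
  unfolding bump_def
  by (intro smooth_flat smooth_diff smooth_const smooth_sum smooth_mult smooth_coord) auto

lemma bump_arg: "r\<^sup>2 - (\<Sum>j\<in>UNIV. (x $ j - c $ j) * (x $ j - c $ j)) = r\<^sup>2 - (dist c x)\<^sup>2"
  by (simp add: dist_norm norm_minus_commute[of c x] power2_norm_eq_inner inner_vec_def)

lemma bump_pos_iff: "r > 0 \<Longrightarrow> bump c r x > 0 \<longleftrightarrow> x \<in> ball c r"
  unfolding bump_def bump_arg by (auto simp: flat_def abs_less_iff power_strict_mono dest: power2_less_imp_less)

lemma bump_nonneg: "bump c r x \<ge> 0"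
  by (simp add: bump_def flat_def)

section \<open>Test functions\<close>

lemma test_functionI:
  assumes "smooth \<phi>" "compact C" "C \<subseteq> \<Omega>" "\<And>x. \<phi> x \<noteq> 0 \<Longrightarrow> x \<in> C"
  shows "\<phi> \<in> test_functions \<Omega>"
proof -
  have "closure {x. \<phi> x \<noteq> 0} \<subseteq> C"
    using assms by (intro closure_minimal compact_imp_closed) auto
  moreover from this have "compact (closure {x. \<phi> x \<noteq> 0})"
    using compact_Int_closed[OF assms(2) closed_closure] by (metis inf.absorb2)
  ultimately show ?thesis using assms by (auto simp: test_functions_def smooth_def)
qed

lemma test_functionE:
  assumes "\<phi> \<in> test_functions \<Omega>"
  obtains C where "smooth \<phi>" "compact C" "C \<subseteq> \<Omega>" "\<And>x. \<phi> x \<noteq> 0 \<Longrightarrow> x \<in> C"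
  using assms that[of "closure {x. \<phi> x \<noteq> 0}"] closure_subset[of "{x. \<phi> x \<noteq> 0}"]
  by (auto simp: test_functions_def smooth_def)

lemma test_function_smooth: "\<phi> \<in> test_functions \<Omega> \<Longrightarrow> smooth \<phi>"
  by (simp add: test_functions_def smooth_def)

lemma test_function_subordinate:
  assumes "\<phi> \<in> test_functions \<Omega>" "smooth \<psi>" "\<And>x. \<phi> x = 0 \<Longrightarrow> \<psi> x = 0"
  shows "\<psi> \<in> test_functions \<Omega>"
proof -
  obtain C where C: "smooth \<phi>" "compact C" "C \<subseteq> \<Omega>" "\<And>x. \<phi> x \<noteq> 0 \<Longrightarrow> x \<in> C"
    using assms(1) by (rule test_functionE) blast
  show ?thesis
    by (rule test_functionI[OF assms(2) C(2,3)]) (use C(4) assms(3) in blast)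
qed

lemma test_function_add:
  assumes "\<phi> \<in> test_functions \<Omega>" "\<psi> \<in> test_functions \<Omega>"
  shows "(\<lambda>x. \<phi> x + \<psi> x) \<in> test_functions \<Omega>"
proof -
  obtain C where C: "smooth \<phi>" "compact C" "C \<subseteq> \<Omega>" "\<And>x. \<phi> x \<noteq> 0 \<Longrightarrow> x \<in> C"
    using assms(1) by (rule test_functionE) blast
  obtain D where D: "smooth \<psi>" "compact D" "D \<subseteq> \<Omega>" "\<And>x. \<psi> x \<noteq> 0 \<Longrightarrow> x \<in> D"
    using assms(2) by (rule test_functionE) blast
  show ?thesis
  proof (rule test_functionI[of _ "C \<union> D"])
    show "x \<in> C \<union> D" if "\<phi> x + \<psi> x \<noteq> 0" for x
      using that C(4)[of x] D(4)[of x] by (cases "\<phi> x = 0") auto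
  qed (use C D in \<open>auto intro: smooth_add\<close>)
qed

lemma test_function_cmult: "\<phi> \<in> test_functions \<Omega> \<Longrightarrow> (\<lambda>x. c * \<phi> x) \<in> test_functions \<Omega>"
  by (rule test_function_subordinate) (auto intro: smooth_cmult test_function_smooth)

lemma test_function_zero: "(\<lambda>x. 0) \<in> test_functions \<Omega>"
  by (rule test_functionI[of _ "{}"]) (auto intro: smooth_const)

lemma test_function_partial:
  assumes "\<phi> \<in> test_functions \<Omega>" shows "partial i \<phi> \<in> test_functions \<Omega>"
proof -
  obtain C where C: "smooth \<phi>" "compact C" "C \<subseteq> \<Omega>" "\<And>x. \<phi> x \<noteq> 0 \<Longrightarrow> x \<in> C"
    using assms by (rule test_functionE) blast
  have "partial i \<phi> x = 0" if "x \<notin> C" for x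
  proof -
    have "((\<lambda>x. 0) has_derivative (\<lambda>h. 0)) (at x)" by simp
    then have "(\<phi> has_derivative (\<lambda>h. 0)) (at x)"
      by (rule has_derivative_transform_within_open[where s = "- C"])
        (use C that in \<open>auto intro: open_Compl compact_imp_closed\<close>)
    from has_derivative_partial_eq[OF this] show ?thesis .
  qed
  then show ?thesis
    by (intro test_functionI[OF smooth_partial[OF C(1)] C(2,3)]) auto
qed

lemma test_function_bounded:
  assumes "\<phi> \<in> test_functions \<Omega>" obtains b where "\<And>x. \<bar>\<phi> x\<bar> \<le> b" "b \<ge> 0"
proof -
  obtain C where C: "smooth \<phi>" "compact C" "\<And>x. \<phi> x \<noteq> 0 \<Longrightarrow> x \<in> C"
    using assms by (rule test_functionE) blast
  have "bounded (\<phi> ` C)"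
    using C by (intro compact_imp_bounded compact_continuous_image smooth_imp_continuous)
  then obtain b where "b > 0" "\<forall>x\<in>C. \<bar>\<phi> x\<bar> \<le> b"
    by (auto simp: bounded_pos)
  then have b: "\<And>x. x \<in> C \<Longrightarrow> \<bar>\<phi> x\<bar> \<le> b" "b \<ge> 0" by auto
  then have "\<bar>\<phi> x\<bar> \<le> b" for x using C(3)[of x] b by (cases "\<phi> x = 0") auto
  with \<open>b \<ge> 0\<close> show ?thesis using that by blast
qed

section \<open>Integrals of test functions and of their derivatives\<close>

lemma smooth_borel_measurable: "smooth \<phi> \<Longrightarrow> \<phi> \<in> borel_measurable borel"
  by (intro borel_measurable_continuous_onI smooth_imp_continuous)

lemma borel_measurable_lebesgue_on_of_borel:
  "g \<in> borel_measurable borel \<Longrightarrow> g \<in> borel_measurable (lebesgue_on A)"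
  by (intro measurable_restrict_space1 measurable_completion) simp

text \<open>Moves integrals to the whole space, where translation invariance is available.\<close>

lemma integral_lebesgue_on_eq_lborel:
  fixes \<phi> :: "real ^ 'd \<Rightarrow> real"
  assumes "\<Omega> \<in> sets lebesgue" "\<phi> \<in> borel_measurable borel" "\<And>x. x \<notin> \<Omega> \<Longrightarrow> \<phi> x = 0"
  shows "(\<integral>x. \<phi> x \<partial>lebesgue_on \<Omega>) = (\<integral>x. \<phi> x \<partial>lborel)"
proof -
  have "(\<integral>x. \<phi> x \<partial>lebesgue_on \<Omega>) = (\<integral>x. indicator \<Omega> x *\<^sub>R \<phi> x \<partial>lebesgue)"
    by (rule integral_restrict_space) (use assms(1) in auto)
  also have "\<dots> = (\<integral>x. \<phi> x \<partial>lebesgue)"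
    by (rule Bochner_Integration.integral_cong) (use assms(3) in \<open>auto simp: indicator_def\<close>)
  also have "\<dots> = (\<integral>x. \<phi> x \<partial>lborel)"
    by (rule integral_completion) (use assms(2) in simp)
  finally show ?thesis .
qed

lemma integral_lborel_translate:
  fixes \<phi> :: "real ^ 'd \<Rightarrow> real"
  assumes "\<phi> \<in> borel_measurable borel"
  shows "(\<integral>x. \<phi> (c + x) \<partial>lborel) = (\<integral>x. \<phi> x \<partial>lborel)"
proof -
  have "(\<integral>x. \<phi> x \<partial>lborel) = (\<integral>x. \<phi> x \<partial>distr lborel borel ((+) c))" by (simp add: lborel_distr_plus)
  also have "\<dots> = (\<integral>x. \<phi> (c + x) \<partial>lborel)" by (rule integral_distr) (use assms in auto)
  finally show ?thesis by simp
qed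

text \<open>By translation invariance every difference quotient has integral zero, and dominated
  convergence passes to the derivative. This gives integration by parts without iterated
  integrals.\<close>

lemma integral_partial_eq_0:
  fixes \<psi> :: "real ^ 'd \<Rightarrow> real"
  assumes "\<Omega> \<in> sets lebesgue" "\<psi> \<in> test_functions \<Omega>"
  shows "(\<integral>x. partial i \<psi> x \<partial>lebesgue_on \<Omega>) = 0"
proof -
  obtain C where C: "smooth \<psi>" "compact C" "C \<subseteq> \<Omega>" "\<And>x. \<psi> x \<noteq> 0 \<Longrightarrow> x \<in> C"
    using assms(2) by (rule test_functionE) blast
  have pt: "partial i \<psi> \<in> test_functions \<Omega>" using test_function_partial[OF assms(2)] .
  obtain b where b: "\<And>x. \<bar>partial i \<psi> x\<bar> \<le> b" "b \<ge> 0" using test_function_bounded[OF pt] by blast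
  obtain R where R: "\<And>x. x \<in> C \<Longrightarrow> norm x \<le> R" using C(2) compact_imp_bounded bounded_iff by metis
  have m: "\<psi> \<in> borel_measurable borel" "partial i \<psi> \<in> borel_measurable borel"
    using C(1) smooth_partial smooth_borel_measurable by blast+
  define e :: "real ^ 'd" where "e = axis i 1"
  have ne: "norm e = 1" by (simp add: e_def)
  define h :: "nat \<Rightarrow> real" where "h n = 1 / Suc n" for n
  have h: "0 < h n" "h n \<le> 1" for n by (auto simp: h_def)
  have line: "((\<lambda>t. \<psi> (t *\<^sub>R e + x)) has_field_derivative partial i \<psi> (t *\<^sub>R e + x)) (at t)" for x t
  proof -
    have "((\<lambda>t. \<psi> (t *\<^sub>R e + x)) has_derivative
        (\<lambda>s. frechet_derivative \<psi> (at (t *\<^sub>R e + x)) (s *\<^sub>R e))) (at t)"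
      by (rule has_derivative_compose[OF _ differentiable_imp_has_derivative[OF smooth_imp_differentiable[OF C(1)]]])
        (auto intro!: derivative_eq_intros)
    moreover have "linear (frechet_derivative \<psi> (at (t *\<^sub>R e + x)))"
      using smooth_imp_differentiable[OF C(1)] linear_frechet_derivative by blast
    ultimately show ?thesis
      unfolding has_field_derivative_def partial_def e_def[symmetric]
      by (simp add: linear_scale mult_commute_abs)
  qed
  define D where "D n x = (\<psi> (h n *\<^sub>R e + x) - \<psi> x) / h n" for n x
  have Dm: "D n \<in> borel_measurable borel" for n
    unfolding D_def using m(1) by measurable
  have lim: "(\<lambda>n. D n x) \<longlonglongrightarrow> partial i \<psi> x" for x
  proof -
    have "((\<lambda>t. (\<psi> (t *\<^sub>R e + x) - \<psi> x) / t) \<longlongrightarrow> partial i \<psi> x) (at 0)"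
      using line[of x 0] by (simp add: DERIV_def)
    moreover have "filterlim h (at 0) sequentially"
      unfolding filterlim_at using h(1) LIMSEQ_Suc[OF lim_1_over_n[where 'a=real]]
      by (simp add: h_def[abs_def])
    ultimately show ?thesis unfolding D_def by (rule filterlim_compose)
  qed
  \<comment> \<open>Inside the ball the mean value theorem bounds the quotient by b. The support
    lies in the ball of radius R and the increments are at most 1, so the quotient vanishes beyond R
    + 1.\<close>
  have Db: "norm (D n x) \<le> b * indicator (cball 0 (R + 1)) x" for n x
  proof (cases "norm x \<le> R + 1")
    case True
    obtain z where "\<psi> (h n *\<^sub>R e + x) - \<psi> (0 *\<^sub>R e + x) = (h n - 0) * partial i \<psi> (z *\<^sub>R e + x)"
      using MVT2[OF h(1)[of n] line] by blast
    then have "D n x = partial i \<psi> (z *\<^sub>R e + x)" using h(1)[of n] by (simp add: D_def)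
    then show ?thesis using b True by simp
  next
    case False
    have "norm (h n *\<^sub>R e + x) \<ge> norm x - norm (h n *\<^sub>R e)"
      by (metis add.commute norm_diff_ineq)
    then have "norm (h n *\<^sub>R e + x) > R" using False h[of n] ne by simp
    then have "\<psi> (h n *\<^sub>R e + x) = 0" "\<psi> x = 0" using R False C(4) by force+
    then show ?thesis using b by (simp add: D_def)
  qed
  have cb: "integrable lborel (\<lambda>x. c * indicator (cball (0 :: real ^ 'd) r) x)" for c r :: real
    by (intro integrable_mult_right integrable_real_indicator emeasure_lborel_cball_finite) simp
  have "(\<lambda>n. \<integral>x. D n x \<partial>lborel) \<longlonglongrightarrow> (\<integral>x. partial i \<psi> x \<partial>lborel)"
    by (rule integral_dominated_convergence[OF _ _ cb[of b "R + 1"]]) (use m Dm lim Db in auto)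
  moreover have "(\<integral>x. D n x \<partial>lborel) = 0" for n
  proof -
    obtain c where c: "\<And>x. \<bar>\<psi> x\<bar> \<le> c" "c \<ge> 0" using test_function_bounded[OF assms(2)] by blast
    have "AE x in lborel. norm (\<psi> x) \<le> norm (c * indicator (cball 0 R) x)"
    proof (rule always_eventually, rule allI)
      show "norm (\<psi> x) \<le> norm (c * indicator (cball 0 R) x)" for x
        using c R C(4) by (cases "\<psi> x = 0") auto
    qed
    then have "integrable lborel \<psi>"
      by (rule Bochner_Integration.integrable_bound[OF cb[of c R], rotated]) (use m in auto)
    moreover from this have "integrable (distr lborel borel ((+) (h n *\<^sub>R e))) \<psi>"
      by (simp add: lborel_distr_plus)
    then have "integrable lborel (\<lambda>x. \<psi> (h n *\<^sub>R e + x))"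
      by (subst (asm) integrable_distr_eq) (use m in auto)
    ultimately show ?thesis
      unfolding D_def using integral_lborel_translate[OF m(1)] by simp
  qed
  ultimately have "(\<integral>x. partial i \<psi> x \<partial>lborel) = 0"
    by (simp add: LIMSEQ_const_iff)
  moreover have "\<And>x. x \<notin> \<Omega> \<Longrightarrow> partial i \<psi> x = 0" using pt test_functionE by blast
  ultimately show ?thesis
    by (subst integral_lebesgue_on_eq_lborel) (use assms m in auto)
qed

section \<open>The fundamental lemma of the calculus of variations\<close>

lemma exp_neg_n_tendsto_0: "t > (0::real) \<Longrightarrow> (\<lambda>n. exp (- (real n * t))) \<longlonglongrightarrow> 0"
proof -
  assume "t > 0"
  then have "(\<lambda>n. exp (- t) ^ n) \<longlonglongrightarrow> 0" by (intro LIMSEQ_realpow_zero) auto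
  then show ?thesis by (simp add: exp_of_nat_mult[symmetric])
qed

locale bounded_open =
  fixes \<Omega> :: "(real ^ 'd) set"
  assumes open_dom: "open \<Omega>" and bounded_dom: "bounded \<Omega>"
begin

lemma lebesgue_dom: "\<Omega> \<in> sets lebesgue" and lmeasurable_dom: "\<Omega> \<in> lmeasurable"
  using open_dom bounded_dom by (auto intro: lmeasurable_open)

lemma integrable_const_dom: "integrable (lebesgue_on \<Omega>) (\<lambda>x. c :: real)"
proof -
  interpret finite_measure "lebesgue_on \<Omega>"
    by (rule finite_measure_lebesgue_on[OF lmeasurable_dom])
  show ?thesis by (rule integrable_const)
qed

lemma L2_bounded:
  assumes "u \<in> borel_measurable (lebesgue_on \<Omega>)" "AE x in lebesgue_on \<Omega>. norm (u x) \<le> b"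
  shows "u \<in> L2 \<Omega>"
proof (rule L2_bound[OF assms(1)])
  show "(\<lambda>x. 1 :: real) \<in> L2 \<Omega>" by (simp add: L2_def integrable_const_dom)
  show "AE x in lebesgue_on \<Omega>. norm (u x) \<le> b * norm (1 :: real)" using assms(2) by simp
qed

lemma L2_const: "(\<lambda>x. c) \<in> L2 \<Omega>"
  by (rule L2_bounded) auto

lemma Linf_imp_L2: "u \<in> Linf \<Omega> \<Longrightarrow> u \<in> L2 \<Omega>"
  unfolding Linf_def using L2_bounded by blast

lemma test_function_L2: assumes "\<phi> \<in> test_functions \<Omega>" shows "\<phi> \<in> L2 \<Omega>"
proof -
  obtain b where "\<And>x. \<bar>\<phi> x\<bar> \<le> b" using test_function_bounded[OF assms] by blast
  then show ?thesis
    using L2_bounded[of \<phi> b] assms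
    by (auto intro!: borel_measurable_lebesgue_on_of_borel smooth_borel_measurable test_function_smooth)
qed

lemma integrable_L2: "u \<in> L2 \<Omega> \<Longrightarrow> integrable (lebesgue_on \<Omega>) u" for u :: "real ^ 'd \<Rightarrow> real"
  using integrable_mult_L2[OF _ L2_const[of 1]] by simp

text \<open>By Lindelof, U is a countable union of balls whose closures lie in U, each carrying a
  bump. With s the sum of the first n bumps, 1 - exp(-n s) stays in [0,1], vanishes wherever s does,
  and tends to 1 as soon as one bump is positive at the point.\<close>

lemma open_limit_of_test_functions:
  assumes "open U" "U \<subseteq> \<Omega>"
  obtains \<phi> :: "nat \<Rightarrow> real ^ 'd \<Rightarrow> real"
  where "\<And>n. \<phi> n \<in> test_functions \<Omega>" "\<And>n x. 0 \<le> \<phi> n x \<and> \<phi> n x \<le> 1"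
    "\<And>x. (\<lambda>n. \<phi> n x) \<longlonglongrightarrow> indicator U x"
proof -
  define F where "F = {b. \<exists>c r. r > 0 \<and> cball c r \<subseteq> U \<and> b = ball c r}"
  obtain G where G: "G \<subseteq> F" "countable G" "\<Union>G = \<Union>F"
    using Lindelof[of F] by (auto simp: F_def)
  have "\<Union>F = U"
  proof
    show "U \<subseteq> \<Union>F"
    proof
      fix x assume "x \<in> U"
      with assms(1) obtain r where "r > 0" "cball x r \<subseteq> U" by (meson open_contains_cball)
      then show "x \<in> \<Union>F" unfolding F_def by (auto intro!: exI[of _ "ball x r"])
    qed
  qed (use ball_subset_cball in \<open>fastforce simp: F_def\<close>)
  have "\<forall>b\<in>F. \<exists>\<psi>. \<psi> \<in> test_functions \<Omega> \<and> (\<forall>x. \<psi> x \<ge> 0) \<and> (\<forall>x. \<psi> x > 0 \<longleftrightarrow> x \<in> b)"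
  proof
    fix b assume "b \<in> F"
    then obtain c r where b: "r > 0" "cball c r \<subseteq> U" "b = ball c r" unfolding F_def by blast
    have "bump c r \<in> test_functions \<Omega>"
    proof (rule test_functionI[of _ "cball c r"])
      show "x \<in> cball c r" if "bump c r x \<noteq> 0" for x
        using that bump_nonneg[of c r x] bump_pos_iff[OF b(1), of c x] by (auto simp: less_le)
    qed (use b assms smooth_bump in auto)
    then show "\<exists>\<psi>. \<psi> \<in> test_functions \<Omega> \<and> (\<forall>x. \<psi> x \<ge> 0) \<and> (\<forall>x. \<psi> x > 0 \<longleftrightarrow> x \<in> b)"
      using bump_nonneg bump_pos_iff[OF b(1)] b(3) by blast
  qed
  then obtain \<psi> where \<psi>: "\<And>b. b \<in> F \<Longrightarrow> \<psi> b \<in> test_functions \<Omega>" "\<And>b x. b \<in> F \<Longrightarrow> \<psi> b x \<ge> 0"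
    "\<And>b x. b \<in> F \<Longrightarrow> \<psi> b x > 0 \<longleftrightarrow> x \<in> b" by metis
  show ?thesis
  proof (cases "G = {}")
    case True
    then show ?thesis using that[of "\<lambda>n x. 0"] test_function_zero \<open>\<Union>F = U\<close> G by auto
  next
    case False
    define g where "g = from_nat_into G"
    have g: "g n \<in> F" for n using from_nat_into[OF False] G(1) unfolding g_def by blast
    have gU: "(\<Union>n. g n) = U"
      using range_from_nat_into[OF False G(2)] G(3) \<open>\<Union>F = U\<close> unfolding g_def by metis
    define s where "s n x = (\<Sum>k<n. \<psi> (g k) x)" for n x
    have s0: "s n x \<ge> 0" for n x unfolding s_def by (intro sum_nonneg \<psi> g)
    have st: "s n \<in> test_functions \<Omega>" for n
    proof (induction n)
      case 0 show ?case unfolding s_def using test_function_zero by simp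
    next
      case (Suc n)
      then show ?case using test_function_add[OF Suc \<psi>(1)[OF g[of n]]] unfolding s_def by (simp add: add.commute)
    qed
    define \<phi> where "\<phi> n x = 1 - exp (- real n * s n x)" for n x
    show ?thesis
    proof (rule that[of \<phi>])
      fix n
      show "\<phi> n \<in> test_functions \<Omega>"
      proof (rule test_function_subordinate[OF st[of n]])
        show "smooth (\<phi> n)" unfolding \<phi>_def
          by (intro smooth_diff smooth_const smooth_exp smooth_cmult test_function_smooth[OF st])
      qed (simp add: \<phi>_def)
      show "0 \<le> \<phi> n x \<and> \<phi> n x \<le> 1" for x using s0[of n x] by (simp add: \<phi>_def)
    next
      fix x
      show "(\<lambda>n. \<phi> n x) \<longlonglongrightarrow> indicator U x"
      proof (cases "x \<in> U")
        case True
        then obtain k where k: "x \<in> g k" using gU by blast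
        define t where "t = \<psi> (g k) x"
        have t: "t > 0" using \<psi>(3)[OF g] k unfolding t_def by blast
        have "(\<lambda>n. 1 - \<phi> n x) \<longlonglongrightarrow> 0"
        proof (rule tendsto_sandwich[OF _ _ tendsto_const exp_neg_n_tendsto_0[OF t]])
          show "\<forall>\<^sub>F n in sequentially. 1 - \<phi> n x \<le> exp (- (real n * t))"
            using eventually_gt_at_top[of k]
          proof eventually_elim
            case (elim n)
            have "t \<le> s n x" unfolding t_def s_def
              by (rule member_le_sum[of k]) (use elim \<psi>(2) g in auto)
            then show ?case by (simp add: \<phi>_def mult_left_mono)
          qed
        qed (use s0 in \<open>auto simp: \<phi>_def\<close>)
        then have "(\<lambda>n. 1 - (1 - \<phi> n x)) \<longlonglongrightarrow> 1 - 0" by (intro tendsto_intros)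
        then show ?thesis using True by simp
      next
        case False
        then have "\<psi> (g k) x = 0" for k using \<psi>(2,3)[OF g, of k x] gU by (auto simp: less_le)
        then show ?thesis using False by (simp add: \<phi>_def s_def)
      qed
    qed
  qed
qed

text \<open>Dominated convergence extends the orthogonality from test functions to indicators of
  open sets.\<close>

lemma integral_open_eq_0:
  fixes g :: "real ^ 'd \<Rightarrow> real"
  assumes g: "integrable (lebesgue_on \<Omega>) g"
    and z: "\<And>\<phi>. \<phi> \<in> test_functions \<Omega> \<Longrightarrow> (\<integral>x. g x * \<phi> x \<partial>lebesgue_on \<Omega>) = 0"
    and U: "open U" "U \<subseteq> \<Omega>"
  shows "(\<integral>x. g x * indicator U x \<partial>lebesgue_on \<Omega>) = 0"
proof -
  obtain \<phi> :: "nat \<Rightarrow> real ^ 'd \<Rightarrow> real" where \<phi>: "\<And>n. \<phi> n \<in> test_functions \<Omega>"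
    "\<And>n x. 0 \<le> \<phi> n x \<and> \<phi> n x \<le> 1" "\<And>x. (\<lambda>n. \<phi> n x) \<longlonglongrightarrow> indicator U x"
    using open_limit_of_test_functions[OF U] by blast
  have m: "\<phi> n \<in> borel_measurable (lebesgue_on \<Omega>)" for n
    using test_function_L2[OF \<phi>(1)] L2_measurable by blast
  have gm: "g \<in> borel_measurable (lebesgue_on \<Omega>)" using g by simp
  have "(\<lambda>n. \<integral>x. g x * \<phi> n x \<partial>lebesgue_on \<Omega>) \<longlonglongrightarrow> (\<integral>x. g x * indicator U x \<partial>lebesgue_on \<Omega>)"
  proof (rule integral_dominated_convergence[where w="\<lambda>x. norm (g x)"])
    show "(\<lambda>x. g x * indicator U x) \<in> borel_measurable (lebesgue_on \<Omega>)"
      by (rule borel_measurable_LIMSEQ_real[where u="\<lambda>n x. g x * \<phi> n x"])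
        (use gm m \<phi>(3) in \<open>auto intro: tendsto_intros\<close>)
    show "AE x in lebesgue_on \<Omega>. norm (g x * \<phi> n x) \<le> norm (g x)" for n
      using \<phi>(2) by (auto simp: abs_mult mult_left_le)
  qed (use g gm m \<phi>(3) in \<open>auto intro!: tendsto_intros\<close>)
  then show ?thesis using z[OF \<phi>(1)] by (simp add: LIMSEQ_const_iff)
qed

text \<open>Up to a null set, {g > 0} is a countable union of closed sets c. The integral of g over
  c is the difference of its integrals over the open sets \<open>\<Omega>\<close> and
  \<open>\<Omega> - c\<close>, hence zero; as g is positive on c, the set c is null.\<close>

lemma fundamental_lemma_nonpos:
  fixes g :: "real ^ 'd \<Rightarrow> real"
  assumes g: "integrable (lebesgue_on \<Omega>) g"
    and z: "\<And>\<phi>. \<phi> \<in> test_functions \<Omega> \<Longrightarrow> (\<integral>x. g x * \<phi> x \<partial>lebesgue_on \<Omega>) = 0"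
  shows "AE x in lebesgue_on \<Omega>. g x \<le> 0"
proof -
  define E where "E = {x \<in> \<Omega>. g x > 0}"
  have "{x \<in> space (lebesgue_on \<Omega>). g x > 0} \<in> sets (lebesgue_on \<Omega>)"
    using borel_measurable_integrable[OF g] by (simp add: borel_measurable_iff_greater)
  then have E: "E \<in> sets lebesgue"
    unfolding E_def using lebesgue_dom by (simp add: sets_restrict_space_iff)
  obtain C N where CN: "fsigma C" "N \<in> null_sets lebesgue" "C \<union> N = E" "disjnt C N"
    by (rule lebesgue_set_almost_fsigma[OF E])
  obtain F :: "nat \<Rightarrow> (real ^ 'd) set" where F: "\<And>n. closed (F n)" "(\<Union>n. F n) = C"
    using CN(1) by (auto elim: fsigma.cases)
  have cl: "negligible c" if c: "closed c" "c \<subseteq> E" for c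
  proof -
    have cO: "c \<subseteq> \<Omega>" using c E_def by auto
    have cm: "c \<in> sets (lebesgue_on \<Omega>)"
      using c cO lebesgue_dom by (simp add: sets_restrict_space_iff)
    have gi: "integrable (lebesgue_on \<Omega>) (\<lambda>x. g x * indicator c x)"
      using integrable_mult_indicator[OF cm g] by (simp add: mult.commute)
    have "(\<integral>x. g x * indicator \<Omega> x \<partial>lebesgue_on \<Omega>) = 0"
      by (rule integral_open_eq_0[OF g z]) (use open_dom in auto)
    moreover have "(\<integral>x. g x * indicator (\<Omega> - c) x \<partial>lebesgue_on \<Omega>) = 0"
      by (rule integral_open_eq_0[OF g z]) (use open_dom c in auto)
    moreover have "(\<integral>x. g x * indicator \<Omega> x \<partial>lebesgue_on \<Omega>) = (\<integral>x. g x \<partial>lebesgue_on \<Omega>)"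
      by (rule Bochner_Integration.integral_cong) auto
    moreover have "(\<integral>x. g x * indicator (\<Omega> - c) x \<partial>lebesgue_on \<Omega>) = (\<integral>x. g x - g x * indicator c x \<partial>lebesgue_on \<Omega>)"
      by (rule Bochner_Integration.integral_cong) (auto simp: indicator_def)
    ultimately have "(\<integral>x. g x * indicator c x \<partial>lebesgue_on \<Omega>) = 0"
      using g gi by simp
    moreover have "AE x in lebesgue_on \<Omega>. 0 \<le> g x * indicator c x"
      by (rule always_eventually) (use c in \<open>auto simp: E_def indicator_def\<close>)
    ultimately have "AE x in lebesgue_on \<Omega>. g x * indicator c x = 0"
      using integral_nonneg_eq_0_iff_AE[OF gi] by simp
    then have "AE x in lebesgue_on \<Omega>. x \<notin> c"
      by eventually_elim (use c in \<open>auto simp: E_def indicator_def split: if_splits\<close>)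
    then have "AE x in lebesgue. x \<in> \<Omega> \<longrightarrow> x \<notin> c"
      using lebesgue_dom by (simp add: AE_restrict_space_iff)
    then have "AE x in lebesgue. x \<notin> c" by eventually_elim (use cO in auto)
    then show ?thesis
      using c(1) by (simp add: negligible_iff_null_sets AE_iff_null_sets)
  qed
  have "negligible C"
    unfolding F(2)[symmetric] using F CN(3) by (intro negligible_countable_Union cl) auto
  then have "negligible E" using CN negligible_Un negligible_iff_null_sets by metis
  then have "AE x in lebesgue. x \<notin> E" by (simp add: negligible_iff_null_sets AE_not_in)
  then show ?thesis
    using lebesgue_dom by (subst AE_restrict_space_iff) (auto simp: E_def elim!: eventually_mono)
qed

lemma fundamental_lemma:
  fixes g :: "real ^ 'd \<Rightarrow> real"
  assumes g: "integrable (lebesgue_on \<Omega>) g"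
    and z: "\<And>\<phi>. \<phi> \<in> test_functions \<Omega> \<Longrightarrow> (\<integral>x. g x * \<phi> x \<partial>lebesgue_on \<Omega>) = 0"
  shows "AE x in lebesgue_on \<Omega>. g x = 0"
  using fundamental_lemma_nonpos[OF assms] fundamental_lemma_nonpos[of "\<lambda>x. - g x"] assms
  by (auto elim: eventually_elim2)

end

section \<open>Weak gradients and the space H10\<close>

definition grad :: "(real ^ 'd \<Rightarrow> real) \<Rightarrow> real ^ 'd \<Rightarrow> real ^ 'd" where
  "grad \<phi> x = (\<chi> i. partial i \<phi> x)"

context bounded_open
begin

lemma grad_L2: assumes "\<phi> \<in> test_functions \<Omega>" shows "grad \<phi> \<in> L2 \<Omega>"
proof -
  have eq: "grad \<phi> = (\<lambda>x. \<Sum>i\<in>UNIV. partial i \<phi> x *\<^sub>R axis i 1)"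
    by (auto simp: grad_def vec_eq_iff axis_def if_distrib cong: if_cong)
  have c: "(\<lambda>x. partial i \<phi> x *\<^sub>R axis i (1::real)) \<in> L2 \<Omega>" for i
    by (rule L2_bound[OF _ test_function_L2[OF test_function_partial[OF assms, of i]], of _ 1])
      (use L2_measurable[OF test_function_L2[OF test_function_partial[OF assms, of i]]] in auto)
  have "(\<lambda>x. \<Sum>i\<in>A. partial i \<phi> x *\<^sub>R axis i (1::real)) \<in> L2 \<Omega>" if "finite A" for A
    using that by (induction A rule: finite_induct) (auto intro: L2_zero L2_add c)
  then show ?thesis unfolding eq by simp
qed

text \<open>The product \<open>\<phi> * \<psi>\<close> is a test function, so its partial
  derivatives have integral zero; the product rule splits them.\<close>

lemma test_function_weak_grad:
  assumes "\<phi> \<in> test_functions \<Omega>" shows "is_weak_grad \<Omega> \<phi> (grad \<phi>)"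
  unfolding is_weak_grad_def
proof (intro conjI ballI allI)
  fix \<psi> i assume \<psi>: "\<psi> \<in> test_functions \<Omega>"
  have d: "\<phi> differentiable (at x)" "\<psi> differentiable (at x)" for x
    using assms \<psi> smooth_imp_differentiable test_function_smooth by blast+
  have "(\<lambda>x. \<phi> x * \<psi> x) \<in> test_functions \<Omega>"
    by (rule test_function_subordinate[OF \<psi>]) (use assms \<psi> in \<open>auto intro: smooth_mult test_function_smooth\<close>)
  from integral_partial_eq_0[OF lebesgue_dom this, of i]
  have "0 = (\<integral>x. \<phi> x * partial i \<psi> x + partial i \<phi> x * \<psi> x \<partial>lebesgue_on \<Omega>)"
    by (simp add: partial_mult[OF d])
  also have "\<dots> = (\<integral>x. \<phi> x * partial i \<psi> x \<partial>lebesgue_on \<Omega>) + (\<integral>x. partial i \<phi> x * \<psi> x \<partial>lebesgue_on \<Omega>)"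
    using assms \<psi> by (intro Bochner_Integration.integral_add integrable_mult_L2 test_function_L2 test_function_partial)
  finally show "(\<integral>x. \<phi> x * partial i \<psi> x \<partial>lebesgue_on \<Omega>) = - (\<integral>x. grad \<phi> x $ i * \<psi> x \<partial>lebesgue_on \<Omega>)"
    by (simp add: grad_def)
qed (rule grad_L2[OF assms])

lemma weak_grad_unique:
  assumes "is_weak_grad \<Omega> u g" "is_weak_grad \<Omega> u h"
  shows "AE x in lebesgue_on \<Omega>. g x = h x"
proof -
  have L: "g \<in> L2 \<Omega>" "h \<in> L2 \<Omega>" using assms by (auto simp: is_weak_grad_def)
  have "AE x in lebesgue_on \<Omega>. g x $ i - h x $ i = 0" for i
  proof (rule fundamental_lemma)
    show "integrable (lebesgue_on \<Omega>) (\<lambda>x. g x $ i - h x $ i)"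
      by (intro integrable_L2 L2_diff L2_component L)
    fix \<phi> assume \<phi>: "\<phi> \<in> test_functions \<Omega>"
    have "(\<integral>x. (g x $ i - h x $ i) * \<phi> x \<partial>lebesgue_on \<Omega>)
        = (\<integral>x. g x $ i * \<phi> x \<partial>lebesgue_on \<Omega>) - (\<integral>x. h x $ i * \<phi> x \<partial>lebesgue_on \<Omega>)"
      unfolding left_diff_distrib
      by (intro Bochner_Integration.integral_diff integrable_mult_L2 L2_component L test_function_L2 \<phi>)
    also have "\<dots> = 0"
    proof -
      have "(\<integral>x. u x * partial i \<phi> x \<partial>lebesgue_on \<Omega>) = - (\<integral>x. g x $ i * \<phi> x \<partial>lebesgue_on \<Omega>)"
        "(\<integral>x. u x * partial i \<phi> x \<partial>lebesgue_on \<Omega>) = - (\<integral>x. h x $ i * \<phi> x \<partial>lebesgue_on \<Omega>)"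
        using assms \<phi> by (simp_all add: is_weak_grad_def)
      then show ?thesis by linarith
    qed
    finally show "(\<integral>x. (g x $ i - h x $ i) * \<phi> x \<partial>lebesgue_on \<Omega>) = 0" .
  qed
  then have "AE x in lebesgue_on \<Omega>. \<forall>i. g x $ i - h x $ i = 0" by (simp add: AE_all_countable)
  then show ?thesis by eventually_elim (simp add: vec_eq_iff)
qed

lemma weak_grad_lincomb:
  assumes "u \<in> L2 \<Omega>" "v \<in> L2 \<Omega>" "is_weak_grad \<Omega> u g" "is_weak_grad \<Omega> v h"
  shows "is_weak_grad \<Omega> (\<lambda>x. u x + c * v x) (\<lambda>x. g x + c *\<^sub>R h x)"
  unfolding is_weak_grad_def
proof (intro conjI ballI allI)
  have L: "g \<in> L2 \<Omega>" "h \<in> L2 \<Omega>" using assms by (auto simp: is_weak_grad_def)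
  then show "(\<lambda>x. g x + c *\<^sub>R h x) \<in> L2 \<Omega>" by (intro L2_add L2_scaleR)
  fix \<phi> and i :: 'd assume \<phi>: "\<phi> \<in> test_functions \<Omega>"
  note P = test_function_L2[OF \<phi>] test_function_L2[OF test_function_partial[OF \<phi>, of i]]
  have "(\<integral>x. (u x + c * v x) * partial i \<phi> x \<partial>lebesgue_on \<Omega>)
      = (\<integral>x. u x * partial i \<phi> x \<partial>lebesgue_on \<Omega>) + c * (\<integral>x. v x * partial i \<phi> x \<partial>lebesgue_on \<Omega>)"
    using integrable_mult_L2[OF assms(1) P(2)] integrable_mult_L2[OF assms(2) P(2)]
    by (simp add: distrib_right mult.assoc)
  also have "\<dots> = - ((\<integral>x. g x $ i * \<phi> x \<partial>lebesgue_on \<Omega>) + c * (\<integral>x. h x $ i * \<phi> x \<partial>lebesgue_on \<Omega>))"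
    using assms(3,4) \<phi> unfolding is_weak_grad_def by simp
  also have "\<dots> = - (\<integral>x. (g x + c *\<^sub>R h x) $ i * \<phi> x \<partial>lebesgue_on \<Omega>)"
    using integrable_mult_L2[OF L2_component[OF L(1), of i] P(1)] integrable_mult_L2[OF L2_component[OF L(2), of i] P(1)]
    by (simp add: distrib_right mult.assoc)
  finally show "(\<integral>x. (u x + c * v x) * partial i \<phi> x \<partial>lebesgue_on \<Omega>)
      = - (\<integral>x. (g x + c *\<^sub>R h x) $ i * \<phi> x \<partial>lebesgue_on \<Omega>)" .
qed

text \<open>Both sides of the defining identity are L2 pairings with fixed functions, hence
  continuous: the weak gradient is a closed operator.\<close>

lemma weak_grad_limit:
  assumes u: "\<And>n. u n \<in> L2 \<Omega>" "v \<in> L2 \<Omega>" and g: "\<And>n. is_weak_grad \<Omega> (u n) (g n)" "h \<in> L2 \<Omega>"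
    and l: "(\<lambda>n. l2sq \<Omega> (\<lambda>x. u n x - v x)) \<longlonglongrightarrow> 0" "(\<lambda>n. l2sq \<Omega> (\<lambda>x. g n x - h x)) \<longlonglongrightarrow> 0"
  shows "is_weak_grad \<Omega> v h"
  unfolding is_weak_grad_def
proof (intro conjI ballI allI)
  fix \<phi> and i :: 'd assume \<phi>: "\<phi> \<in> test_functions \<Omega>"
  note P = test_function_L2[OF \<phi>] test_function_L2[OF test_function_partial[OF \<phi>, of i]]
  have gL: "g n \<in> L2 \<Omega>" for n using g(1) by (auto simp: is_weak_grad_def)
  have "(\<lambda>x. \<phi> x *\<^sub>R axis i (1::real)) \<in> L2 \<Omega>"
    by (rule L2_bound[OF _ P(1), of _ 1]) (use L2_measurable[OF P(1)] in auto)
  from l2_inner_tendsto[OF gL g(2) this l(2)]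
  have "(\<lambda>n. \<integral>x. g n x $ i * \<phi> x \<partial>lebesgue_on \<Omega>) \<longlonglongrightarrow> (\<integral>x. h x $ i * \<phi> x \<partial>lebesgue_on \<Omega>)"
    by (simp add: cart_eq_inner_axis mult.commute)
  moreover from l2_inner_tendsto[OF u P(2) l(1)]
  have "(\<lambda>n. \<integral>x. u n x * partial i \<phi> x \<partial>lebesgue_on \<Omega>) \<longlonglongrightarrow> (\<integral>x. v x * partial i \<phi> x \<partial>lebesgue_on \<Omega>)"
    by simp
  then have "(\<lambda>n. - (\<integral>x. g n x $ i * \<phi> x \<partial>lebesgue_on \<Omega>)) \<longlonglongrightarrow> (\<integral>x. v x * partial i \<phi> x \<partial>lebesgue_on \<Omega>)"
    using g(1) \<phi> unfolding is_weak_grad_def by simp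
  ultimately show "(\<integral>x. v x * partial i \<phi> x \<partial>lebesgue_on \<Omega>) = - (\<integral>x. h x $ i * \<phi> x \<partial>lebesgue_on \<Omega>)"
    using LIMSEQ_unique tendsto_minus by blast
qed (rule g)

section \<open>The chosen weak gradient, the H1 norm and H10\<close>

lemma wgrad_AE: "is_weak_grad \<Omega> u g \<Longrightarrow> AE x in lebesgue_on \<Omega>. wgrad \<Omega> u x = g x"
  unfolding wgrad_def by (metis someI weak_grad_unique)

lemma wgrad_weak_grad: "u \<in> H1 \<Omega> \<Longrightarrow> is_weak_grad \<Omega> u (wgrad \<Omega> u)"
  unfolding wgrad_def H1_def mem_Collect_eq by (metis someI_ex)

lemma wgrad_L2: "u \<in> H1 \<Omega> \<Longrightarrow> wgrad \<Omega> u \<in> L2 \<Omega>"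
  using wgrad_weak_grad by (auto simp: is_weak_grad_def)

lemma H1_L2: "u \<in> H1 \<Omega> \<Longrightarrow> u \<in> L2 \<Omega>"
  by (simp add: H1_def)

lemma H1_lincomb: "u \<in> H1 \<Omega> \<Longrightarrow> v \<in> H1 \<Omega> \<Longrightarrow> (\<lambda>x. u x + c * v x) \<in> H1 \<Omega>"
proof -
  assume uv: "u \<in> H1 \<Omega>" "v \<in> H1 \<Omega>"
  then have "is_weak_grad \<Omega> (\<lambda>x. u x + c * v x) (\<lambda>x. wgrad \<Omega> u x + c *\<^sub>R wgrad \<Omega> v x)"
    by (intro weak_grad_lincomb H1_L2 wgrad_weak_grad)
  moreover have "(\<lambda>x. u x + c * v x) \<in> L2 \<Omega>"
    using uv by (intro L2_add L2_mult H1_L2)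
  ultimately show ?thesis by (auto simp: H1_def)
qed

lemma wgrad_lincomb:
  assumes "u \<in> H1 \<Omega>" "v \<in> H1 \<Omega>"
  shows "AE x in lebesgue_on \<Omega>. wgrad \<Omega> (\<lambda>x. u x + c * v x) x = wgrad \<Omega> u x + c *\<^sub>R wgrad \<Omega> v x"
  by (intro wgrad_AE weak_grad_lincomb H1_L2 wgrad_weak_grad assms)

lemma test_function_H1: "\<phi> \<in> test_functions \<Omega> \<Longrightarrow> \<phi> \<in> H1 \<Omega>"
  using test_function_weak_grad test_function_L2 by (auto simp: H1_def)

lemma H1_norm_sq: "(H1_norm \<Omega> u)\<^sup>2 = l2sq \<Omega> u + l2sq \<Omega> (wgrad \<Omega> u)"
  using l2sq_nonneg[of \<Omega> u] l2sq_nonneg[of \<Omega> "wgrad \<Omega> u"]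
  unfolding H1_norm_def l2sq_def by simp

lemma H1_norm_nonneg: "H1_norm \<Omega> u \<ge> 0"
  by (simp add: H1_norm_def)

lemma H1_norm_diff_sq:
  assumes "u \<in> H1 \<Omega>" "v \<in> H1 \<Omega>" "is_weak_grad \<Omega> u g" "is_weak_grad \<Omega> v h"
  shows "(H1_norm \<Omega> (\<lambda>x. u x - v x))\<^sup>2 = l2sq \<Omega> (\<lambda>x. u x - v x) + l2sq \<Omega> (\<lambda>x. g x - h x)"
proof -
  have w: "is_weak_grad \<Omega> (\<lambda>x. u x - v x) (\<lambda>x. g x - h x)"
    using weak_grad_lincomb[OF H1_L2[OF assms(1)] H1_L2[OF assms(2)] assms(3,4), of "-1"] by simp
  have "(\<lambda>x. u x - v x) \<in> H1 \<Omega>" using H1_lincomb[OF assms(1,2), of "-1"] by simp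
  then have "l2sq \<Omega> (wgrad \<Omega> (\<lambda>x. u x - v x)) = l2sq \<Omega> (\<lambda>x. g x - h x)"
    using w by (intro l2sq_cong_AE wgrad_AE wgrad_L2) (auto simp: is_weak_grad_def)
  then show ?thesis by (simp add: H1_norm_sq)
qed

text \<open>A membership criterion in terms of two separate \<open>l2sq\<close> limits; the limit g
  of the gradients is arbitrary and turns out to be the weak gradient.\<close>

lemma H10_I:
  assumes \<phi>: "\<And>n. \<phi> n \<in> test_functions \<Omega>" and u: "u \<in> L2 \<Omega>" and g: "g \<in> L2 \<Omega>"
    and l: "(\<lambda>n. l2sq \<Omega> (\<lambda>x. \<phi> n x - u x)) \<longlonglongrightarrow> 0" "(\<lambda>n. l2sq \<Omega> (\<lambda>x. grad (\<phi> n) x - g x)) \<longlonglongrightarrow> 0"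
  shows "u \<in> H10 \<Omega>" "is_weak_grad \<Omega> u g"
proof -
  show w: "is_weak_grad \<Omega> u g"
    by (rule weak_grad_limit[OF test_function_L2[OF \<phi>] u test_function_weak_grad[OF \<phi>] g l])
  then have uH: "u \<in> H1 \<Omega>" using u by (auto simp: H1_def)
  have "(\<lambda>n. (H1_norm \<Omega> (\<lambda>x. \<phi> n x - u x))\<^sup>2) \<longlonglongrightarrow> 0"
    using tendsto_add[OF l]
    by (simp add: H1_norm_diff_sq[OF test_function_H1[OF \<phi>] uH test_function_weak_grad[OF \<phi>] w])
  then have "(\<lambda>n. H1_norm \<Omega> (\<lambda>x. \<phi> n x - u x)) \<longlonglongrightarrow> 0"
    using tendsto_real_sqrt H1_norm_nonneg by fastforce
  then show "u \<in> H10 \<Omega>" using \<phi> uH by (auto simp: H10_def)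
qed

lemma H10_H1: "u \<in> H10 \<Omega> \<Longrightarrow> u \<in> H1 \<Omega>"
  by (simp add: H10_def)

lemma H10_E:
  assumes "u \<in> H10 \<Omega>"
  obtains \<phi> where "\<And>n. \<phi> n \<in> test_functions \<Omega>" "(\<lambda>n. l2sq \<Omega> (\<lambda>x. \<phi> n x - u x)) \<longlonglongrightarrow> 0"
    "(\<lambda>n. l2sq \<Omega> (\<lambda>x. grad (\<phi> n) x - wgrad \<Omega> u x)) \<longlonglongrightarrow> 0"
proof -
  obtain \<phi> where \<phi>: "\<And>n. \<phi> n \<in> test_functions \<Omega>" and l: "(\<lambda>n. H1_norm \<Omega> (\<lambda>x. \<phi> n x - u x)) \<longlonglongrightarrow> 0"
    using assms by (auto simp: H10_def)
  have "(\<lambda>n. (H1_norm \<Omega> (\<lambda>x. \<phi> n x - u x))\<^sup>2) \<longlonglongrightarrow> 0"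
    using tendsto_power[OF l, of 2] by simp
  then have *: "(\<lambda>n. l2sq \<Omega> (\<lambda>x. \<phi> n x - u x) + l2sq \<Omega> (\<lambda>x. grad (\<phi> n) x - wgrad \<Omega> u x)) \<longlonglongrightarrow> 0"
    using H1_norm_diff_sq[OF test_function_H1[OF \<phi>] H10_H1[OF assms] test_function_weak_grad[OF \<phi>]
        wgrad_weak_grad[OF H10_H1[OF assms]]] by simp
  show ?thesis
  proof (rule that[OF \<phi>])
    show "(\<lambda>n. l2sq \<Omega> (\<lambda>x. \<phi> n x - u x)) \<longlonglongrightarrow> 0"
      by (rule tendsto_sandwich[OF _ _ tendsto_const *]) auto
    show "(\<lambda>n. l2sq \<Omega> (\<lambda>x. grad (\<phi> n) x - wgrad \<Omega> u x)) \<longlonglongrightarrow> 0"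
      by (rule tendsto_sandwich[OF _ _ tendsto_const *]) auto
  qed
qed

lemma H10_lincomb:
  assumes "u \<in> H10 \<Omega>" "v \<in> H10 \<Omega>" shows "(\<lambda>x. u x + c * v x) \<in> H10 \<Omega>"
proof -
  obtain \<phi> where \<phi>: "\<And>n. \<phi> n \<in> test_functions \<Omega>" "(\<lambda>n. l2sq \<Omega> (\<lambda>x. \<phi> n x - u x)) \<longlonglongrightarrow> 0"
    "(\<lambda>n. l2sq \<Omega> (\<lambda>x. grad (\<phi> n) x - wgrad \<Omega> u x)) \<longlonglongrightarrow> 0"
    using assms(1) by (rule H10_E) blast
  obtain \<psi> where \<psi>: "\<And>n. \<psi> n \<in> test_functions \<Omega>" "(\<lambda>n. l2sq \<Omega> (\<lambda>x. \<psi> n x - v x)) \<longlonglongrightarrow> 0"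
    "(\<lambda>n. l2sq \<Omega> (\<lambda>x. grad (\<psi> n) x - wgrad \<Omega> v x)) \<longlonglongrightarrow> 0"
    using assms(2) by (rule H10_E) blast
  note uv = H1_L2[OF H10_H1[OF assms(1)]] H1_L2[OF H10_H1[OF assms(2)]]
    wgrad_L2[OF H10_H1[OF assms(1)]] wgrad_L2[OF H10_H1[OF assms(2)]]
  \<comment> \<open>Values in an arbitrary Euclidean space are allowed, since the claim serves once
    for the functions and once for their gradients.\<close>
  have lim: "(\<lambda>n. l2sq \<Omega> (\<lambda>x. (a n x + c *\<^sub>R b n x) - (p x + c *\<^sub>R q x))) \<longlonglongrightarrow> 0"
    if "\<And>n. a n \<in> L2 \<Omega>" "\<And>n. b n \<in> L2 \<Omega>" "p \<in> L2 \<Omega>" "q \<in> L2 \<Omega>"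
      "(\<lambda>n. l2sq \<Omega> (\<lambda>x. a n x - p x)) \<longlonglongrightarrow> 0" "(\<lambda>n. l2sq \<Omega> (\<lambda>x. b n x - q x)) \<longlonglongrightarrow> 0"
    for a b :: "nat \<Rightarrow> real ^ 'd \<Rightarrow> 'e::euclidean_space" and p q
  proof (rule tendsto_sandwich[OF _ _ tendsto_const])
    have eq: "(a n x + c *\<^sub>R b n x) - (p x + c *\<^sub>R q x) = (a n x - p x) + c *\<^sub>R (b n x - q x)" for n x
      by (simp add: algebra_simps)
    show "\<forall>\<^sub>F n in sequentially. l2sq \<Omega> (\<lambda>x. (a n x + c *\<^sub>R b n x) - (p x + c *\<^sub>R q x))
        \<le> 2 * l2sq \<Omega> (\<lambda>x. a n x - p x) + 2 * (c\<^sup>2 * l2sq \<Omega> (\<lambda>x. b n x - q x))"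
      unfolding eq l2sq_scaleR[symmetric]
      by (intro always_eventually allI l2sq_add_le L2_diff L2_scaleR that)
    have "(\<lambda>n. 2 * l2sq \<Omega> (\<lambda>x. a n x - p x) + 2 * (c\<^sup>2 * l2sq \<Omega> (\<lambda>x. b n x - q x))) \<longlonglongrightarrow> 2 * 0 + 2 * (c\<^sup>2 * 0)"
      by (intro tendsto_intros that)
    then show "(\<lambda>n. 2 * l2sq \<Omega> (\<lambda>x. a n x - p x) + 2 * (c\<^sup>2 * l2sq \<Omega> (\<lambda>x. b n x - q x))) \<longlonglongrightarrow> 0" by simp
  qed auto
  have gr: "grad (\<lambda>x. \<phi> n x + c * \<psi> n x) x = grad (\<phi> n) x + c *\<^sub>R grad (\<psi> n) x" for n x
  proof -
    have d: "\<phi> n differentiable (at x)" "(\<lambda>x. c * \<psi> n x) differentiable (at x)" "\<psi> n differentiable (at x)"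
      using \<phi>(1)[of n] \<psi>(1)[of n] test_function_cmult[OF \<psi>(1)[of n], of c]
        smooth_imp_differentiable test_function_smooth by blast+
    have "partial i (\<lambda>x. c * \<psi> n x) x = c * partial i (\<psi> n) x" for i
      using partial_mult[of "\<lambda>x. c" x "\<psi> n" i] d(3) by (simp add: partial_const)
    then show ?thesis using partial_add[OF d(1,2)] by (simp add: grad_def vec_eq_iff)
  qed
  show ?thesis
  proof (rule H10_I(1)[of "\<lambda>n x. \<phi> n x + c * \<psi> n x" _ "\<lambda>x. wgrad \<Omega> u x + c *\<^sub>R wgrad \<Omega> v x"])
    show "(\<lambda>x. \<phi> n x + c * \<psi> n x) \<in> test_functions \<Omega>" for n
      by (intro test_function_add test_function_cmult \<phi> \<psi>)
    show "(\<lambda>x. u x + c * v x) \<in> L2 \<Omega>" by (intro L2_add L2_mult uv)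
    show "(\<lambda>x. wgrad \<Omega> u x + c *\<^sub>R wgrad \<Omega> v x) \<in> L2 \<Omega>" by (intro L2_add L2_scaleR uv)
    show "(\<lambda>n. l2sq \<Omega> (\<lambda>x. (\<phi> n x + c * \<psi> n x) - (u x + c * v x))) \<longlonglongrightarrow> 0"
      using lim[OF test_function_L2[OF \<phi>(1)] test_function_L2[OF \<psi>(1)] uv(1,2) \<phi>(2) \<psi>(2)] by simp
    show "(\<lambda>n. l2sq \<Omega> (\<lambda>x. grad (\<lambda>x. \<phi> n x + c * \<psi> n x) x - (wgrad \<Omega> u x + c *\<^sub>R wgrad \<Omega> v x))) \<longlonglongrightarrow> 0"
      unfolding gr by (intro lim grad_L2 \<phi> \<psi> uv)
  qed
qed

lemma H10_zero: "(\<lambda>x. 0) \<in> H10 \<Omega>"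
  by (rule H10_I(1)[of "\<lambda>n x. 0" _ "grad (\<lambda>x. 0)"])
    (auto intro: test_function_zero L2_zero grad_L2 simp: l2sq_def)

lemma H10_cmult: "u \<in> H10 \<Omega> \<Longrightarrow> (\<lambda>x. c * u x) \<in> H10 \<Omega>"
  using H10_lincomb[OF H10_zero, of u c] by simp

lemma H10_diff: "u \<in> H10 \<Omega> \<Longrightarrow> v \<in> H10 \<Omega> \<Longrightarrow> (\<lambda>x. u x - v x) \<in> H10 \<Omega>"
  using H10_lincomb[of u v "-1"] by simp

lemma wgrad_diff:
  assumes "u \<in> H1 \<Omega>" "v \<in> H1 \<Omega>"
  shows "AE x in lebesgue_on \<Omega>. wgrad \<Omega> (\<lambda>x. u x - v x) x = wgrad \<Omega> u x - wgrad \<Omega> v x"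
  using wgrad_lincomb[OF assms, of "-1"] by simp

end

section \<open>Elliptic coefficients and the Poincare inequality\<close>

lemma measurable_matrix_vector_mult:
  fixes A :: "'a \<Rightarrow> real ^ 'k ^ 'j" and g :: "'a \<Rightarrow> real ^ 'k"
  assumes "A \<in> borel_measurable N" "g \<in> borel_measurable N"
  shows "(\<lambda>x. A x *v g x) \<in> borel_measurable N"
  by (rule borel_measurable_continuous_Pair[OF assms])
    (unfold matrix_vector_mult_def, intro continuous_intros)

lemma symmetric_mat_inner:
  fixes A :: "real ^ 'd ^ 'd"
  assumes "symmetric_mat A" shows "(A *v x) \<bullet> y = x \<bullet> (A *v y)"
  using assms dot_lmul_matrix[of x A y] transpose_matrix_vector[of A x]
  by (simp add: symmetric_mat_def)

text \<open>The upper bound concerns the length of A v rather than the quadratic form, which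
  directly gives that A maps \<open>L2\<close> into itself. Symmetry is included because the energy
  method rests on it.\<close>

definition elliptic :: "(real ^ 'd) set \<Rightarrow> real \<Rightarrow> real \<Rightarrow> (real ^ 'd \<Rightarrow> real ^ 'd ^ 'd) \<Rightarrow> bool" where
  "elliptic \<Omega> a b A \<longleftrightarrow> a > 0 \<and> A \<in> borel_measurable (lebesgue_on \<Omega>) \<and>
     (AE x in lebesgue_on \<Omega>. symmetric_mat (A x) \<and>
        (\<forall>v. a * (norm v)\<^sup>2 \<le> v \<bullet> (A x *v v)) \<and> (\<forall>v. norm (A x *v v) \<le> b * norm v))"

definition energy :: "(real ^ 'd) set \<Rightarrow> (real ^ 'd \<Rightarrow> real ^ 'd ^ 'd)
    \<Rightarrow> (real ^ 'd \<Rightarrow> real ^ 'd) \<Rightarrow> (real ^ 'd \<Rightarrow> real ^ 'd) \<Rightarrow> real" where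
  "energy \<Omega> A g h = (\<integral>x. (A x *v g x) \<bullet> h x \<partial>lebesgue_on \<Omega>)"

section \<open>The energy form\<close>

lemma elliptic_L2:
  assumes "elliptic \<Omega> a b A" "g \<in> L2 \<Omega>" shows "(\<lambda>x. A x *v g x) \<in> L2 \<Omega>"
proof (rule L2_bound[OF _ assms(2)])
  show "(\<lambda>x. A x *v g x) \<in> borel_measurable (lebesgue_on \<Omega>)"
    using assms L2_measurable by (intro measurable_matrix_vector_mult) (auto simp: elliptic_def)
  show "AE x in lebesgue_on \<Omega>. norm (A x *v g x) \<le> b * norm (g x)"
    using assms(1) unfolding elliptic_def by (auto elim: eventually_mono)
qed

lemma energy_integrable:
  assumes "elliptic \<Omega> a b A" "g \<in> L2 \<Omega>" "h \<in> L2 \<Omega>"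
  shows "integrable (lebesgue_on \<Omega>) (\<lambda>x. (A x *v g x) \<bullet> h x)"
  by (intro integrable_inner_L2 elliptic_L2[OF assms(1)] assms)

lemma energy_commute:
  assumes A: "elliptic \<Omega> a b A" "g \<in> L2 \<Omega>" "h \<in> L2 \<Omega>"
  shows "energy \<Omega> A g h = energy \<Omega> A h g"
  unfolding energy_def
proof (rule integral_cong_AE)
  show "AE x in lebesgue_on \<Omega>. (A x *v g x) \<bullet> h x = (A x *v h x) \<bullet> g x"
  proof -
    have "AE x in lebesgue_on \<Omega>. symmetric_mat (A x)"
      using A(1) by (auto simp: elliptic_def)
    then show ?thesis by eventually_elim (metis symmetric_mat_inner inner_commute)
  qed
qed (use energy_integrable[OF A] energy_integrable[OF A(1,3,2)] in auto)

lemma energy_cong_AE: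
  assumes A: "elliptic \<Omega> a b A" and L: "g \<in> L2 \<Omega>" "g' \<in> L2 \<Omega>" "h \<in> L2 \<Omega>" "h' \<in> L2 \<Omega>"
    and "AE x in lebesgue_on \<Omega>. g x = g' x" "AE x in lebesgue_on \<Omega>. h x = h' x"
  shows "energy \<Omega> A g h = energy \<Omega> A g' h'"
  unfolding energy_def
proof (rule integral_cong_AE)
  show "AE x in lebesgue_on \<Omega>. (A x *v g x) \<bullet> h x = (A x *v g' x) \<bullet> h' x"
    using assms(6,7) by eventually_elim simp
qed (use energy_integrable[OF A L(1,3)] energy_integrable[OF A L(2,4)] in auto)

lemma energy_add_scaleR:
  assumes A: "elliptic \<Omega> a b A" "g \<in> L2 \<Omega>" "h \<in> L2 \<Omega>"
  shows "energy \<Omega> A (\<lambda>x. g x + t *\<^sub>R h x) (\<lambda>x. g x + t *\<^sub>R h x)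
    = energy \<Omega> A g g + 2 * t * energy \<Omega> A g h + t\<^sup>2 * energy \<Omega> A h h"
proof -
  have "(A x *v (g x + t *\<^sub>R h x)) \<bullet> (g x + t *\<^sub>R h x) = (A x *v g x) \<bullet> g x + t * ((A x *v g x) \<bullet> h x)
      + (t * ((A x *v h x) \<bullet> g x) + t\<^sup>2 * ((A x *v h x) \<bullet> h x))" for x
    by (simp add: matrix_vector_right_distrib matrix_vector_mult_scaleR inner_add_left inner_add_right
        power2_eq_square algebra_simps)
  then have "energy \<Omega> A (\<lambda>x. g x + t *\<^sub>R h x) (\<lambda>x. g x + t *\<^sub>R h x)
    = energy \<Omega> A g g + t * energy \<Omega> A g h + (t * energy \<Omega> A h g + t\<^sup>2 * energy \<Omega> A h h)"
    unfolding energy_def using energy_integrable[OF A] energy_integrable[OF A(1,3,2)]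
      energy_integrable[OF A(1,2,2)] energy_integrable[OF A(1,3,3)] by simp
  then show ?thesis using energy_commute[OF A] by simp
qed

lemma energy_ge:
  assumes A: "elliptic \<Omega> a b A" "g \<in> L2 \<Omega>"
  shows "a * l2sq \<Omega> g \<le> energy \<Omega> A g g"
proof -
  have "a * l2sq \<Omega> g = (\<integral>x. a * (norm (g x))\<^sup>2 \<partial>lebesgue_on \<Omega>)" by (simp add: l2sq_def)
  also have "\<dots> \<le> energy \<Omega> A g g"
    unfolding energy_def
  proof (rule integral_mono_AE)
    show "AE x in lebesgue_on \<Omega>. a * (norm (g x))\<^sup>2 \<le> (A x *v g x) \<bullet> g x"
    proof -
      have "AE x in lebesgue_on \<Omega>. \<forall>v. a * (norm v)\<^sup>2 \<le> v \<bullet> (A x *v v)"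
        using A(1) by (auto simp: elliptic_def)
      then show ?thesis by eventually_elim (metis inner_commute)
    qed
  qed (use L2_integrable[OF A(2)] energy_integrable[OF A(1,2,2)] in auto)
  finally show ?thesis .
qed

context bounded_open
begin

text \<open>The i-th derivative of x_i phi^2 has integral zero, so the squared norm of phi equals -2
  times the integral of x_i phi d_i phi. As |x_i| is at most R on the domain, half of the squared
  norm can be absorbed, which leaves the constant 4 R^2.\<close>

lemma poincare_test_function:
  obtains C where "C > 0" "\<And>\<phi>. \<phi> \<in> test_functions \<Omega> \<Longrightarrow> l2sq \<Omega> \<phi> \<le> C * l2sq \<Omega> (grad \<phi>)"
proof -
  obtain R where R: "R > 0" "\<And>x. x \<in> \<Omega> \<Longrightarrow> norm x \<le> R"
    using bounded_dom by (auto simp: bounded_pos)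
  fix i :: 'd
  have "l2sq \<Omega> \<phi> \<le> (4 * R\<^sup>2) * l2sq \<Omega> (grad \<phi>)" if \<phi>: "\<phi> \<in> test_functions \<Omega>" for \<phi>
  proof -
    have s: "smooth \<phi>" using test_function_smooth[OF \<phi>] .
    note p = test_function_partial[OF \<phi>, of i]
    have xs: "(\<lambda>x. x $ i * \<psi> x) \<in> test_functions \<Omega>" if "\<psi> \<in> test_functions \<Omega>" for \<psi>
      using that by (rule test_function_subordinate)
        (use that in \<open>auto intro: smooth_mult smooth_coord test_function_smooth\<close>)
    have "(\<lambda>x. \<phi> x * (x $ i * \<phi> x)) \<in> test_functions \<Omega>"
      by (rule test_function_subordinate[OF \<phi>]) (auto intro!: smooth_mult smooth_coord s)
    from integral_partial_eq_0[OF lebesgue_dom this, of i]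
    have 0: "0 = (\<integral>x. partial i (\<lambda>x. \<phi> x * (x $ i * \<phi> x)) x \<partial>lebesgue_on \<Omega>)" by simp
    have d: "\<phi> differentiable (at x)" "(\<lambda>x. x $ i) differentiable (at x)"
      "(\<lambda>x. x $ i * \<phi> x) differentiable (at x)" for x
      using s by (auto intro!: smooth_imp_differentiable smooth_mult smooth_coord)
    have "partial i (\<lambda>x. \<phi> x * (x $ i * \<phi> x)) x = \<phi> x * \<phi> x + 2 * ((x $ i * \<phi> x) * partial i \<phi> x)" for x
      unfolding partial_mult[OF d(1,3)] partial_mult[OF d(2,1)] partial_coord
      by (simp add: algebra_simps)
    then have eq: "partial i (\<lambda>x. \<phi> x * (x $ i * \<phi> x))
        = (\<lambda>x. \<phi> x * \<phi> x + 2 * ((x $ i * \<phi> x) * partial i \<phi> x))" by auto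
    have "0 = l2sq \<Omega> \<phi> + 2 * (\<integral>x. (x $ i * \<phi> x) * partial i \<phi> x \<partial>lebesgue_on \<Omega>)"
      using 0 unfolding eq l2sq_def
      using integrable_mult_L2[OF test_function_L2[OF \<phi>] test_function_L2[OF \<phi>]]
        integrable_mult_L2[OF test_function_L2[OF xs[OF \<phi>]] test_function_L2[OF p]]
      by (simp add: power2_eq_square)
    moreover have "(\<integral>x. (x $ i * \<phi> x) * partial i \<phi> x \<partial>lebesgue_on \<Omega>)
        \<ge> (\<integral>x. (- (1/4)) * (norm (\<phi> x))\<^sup>2 + (- R\<^sup>2) * (norm (grad \<phi> x))\<^sup>2 \<partial>lebesgue_on \<Omega>)"
    proof (rule integral_mono_AE)
      have "(- (1/4)) * (norm (\<phi> x))\<^sup>2 + (- R\<^sup>2) * (norm (grad \<phi> x))\<^sup>2 \<le> (x $ i * \<phi> x) * partial i \<phi> x"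
        if "x \<in> \<Omega>" for x
      proof -
        have "\<bar>x $ i\<bar> \<le> R" using component_le_norm_cart[of x i] R(2)[OF that] by linarith
        moreover have "\<bar>partial i \<phi> x\<bar> \<le> norm (grad \<phi> x)"
          using component_le_norm_cart[of "grad \<phi> x" i] by (simp add: grad_def)
        ultimately have "\<bar>x $ i * partial i \<phi> x\<bar> \<le> R * norm (grad \<phi> x)"
          by (simp add: abs_mult mult_mono)
        then have "(x $ i * partial i \<phi> x)\<^sup>2 \<le> (R * norm (grad \<phi> x))\<^sup>2"
          by (metis abs_ge_zero power2_abs power_mono)
        \<comment> \<open>The weight 1/2 produces the coefficient 1/4, which the outer factor 2
          turns into the absorbable half.\<close>
        moreover have "0 \<le> (\<phi> x / 2 + x $ i * partial i \<phi> x)\<^sup>2" by simp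
        ultimately show ?thesis by (simp add: power2_eq_square algebra_simps)
      qed
      then show "AE x in lebesgue_on \<Omega>. (- (1/4)) * (norm (\<phi> x))\<^sup>2 + (- R\<^sup>2) * (norm (grad \<phi> x))\<^sup>2
          \<le> (x $ i * \<phi> x) * partial i \<phi> x"
        by (intro AE_I2) simp
    qed (use integrable_mult_L2[OF test_function_L2[OF xs[OF \<phi>]] test_function_L2[OF p]]
        L2_integrable[OF test_function_L2[OF \<phi>]] L2_integrable[OF grad_L2[OF \<phi>]] in auto)
    moreover have "(\<integral>x. (- (1/4)) * (norm (\<phi> x))\<^sup>2 + (- R\<^sup>2) * (norm (grad \<phi> x))\<^sup>2 \<partial>lebesgue_on \<Omega>)
        = - (1/4) * l2sq \<Omega> \<phi> - R\<^sup>2 * l2sq \<Omega> (grad \<phi>)"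
      unfolding l2sq_def
      using L2_integrable[OF test_function_L2[OF \<phi>]] L2_integrable[OF grad_L2[OF \<phi>]] by simp
    ultimately show ?thesis by linarith
  qed
  then show ?thesis using R(1) by (intro that[of "4 * R\<^sup>2"]) auto
qed

text \<open>Density of the test functions. The constant grows to 4 C because the inequality |a+b|^2
  \<le> 2|a|^2 + 2|b|^2 is applied twice.\<close>

lemma poincare:
  obtains C where "C > 0" "\<And>u. u \<in> H10 \<Omega> \<Longrightarrow> l2sq \<Omega> u \<le> C * l2sq \<Omega> (wgrad \<Omega> u)"
proof -
  obtain C where C: "C > 0" "\<And>\<phi>. \<phi> \<in> test_functions \<Omega> \<Longrightarrow> l2sq \<Omega> \<phi> \<le> C * l2sq \<Omega> (grad \<phi>)"
    using poincare_test_function by blast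
  have "l2sq \<Omega> u \<le> (4 * C) * l2sq \<Omega> (wgrad \<Omega> u)" if u: "u \<in> H10 \<Omega>" for u
  proof -
    obtain \<phi> where \<phi>: "\<And>n. \<phi> n \<in> test_functions \<Omega>" "(\<lambda>n. l2sq \<Omega> (\<lambda>x. \<phi> n x - u x)) \<longlonglongrightarrow> 0"
      "(\<lambda>n. l2sq \<Omega> (\<lambda>x. grad (\<phi> n) x - wgrad \<Omega> u x)) \<longlonglongrightarrow> 0"
      using u by (rule H10_E) blast
    note L = H1_L2[OF H10_H1[OF u]] wgrad_L2[OF H10_H1[OF u]]
    have "l2sq \<Omega> u \<le> 2 * l2sq \<Omega> (\<lambda>x. \<phi> n x - u x)
        + 2 * (C * (2 * l2sq \<Omega> (\<lambda>x. grad (\<phi> n) x - wgrad \<Omega> u x) + 2 * l2sq \<Omega> (wgrad \<Omega> u)))" for n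
    proof -
      have "l2sq \<Omega> u \<le> 2 * l2sq \<Omega> (\<lambda>x. \<phi> n x - u x) + 2 * l2sq \<Omega> (\<phi> n)"
        using l2sq_diff_le[OF L(1) L2_zero test_function_L2[OF \<phi>(1)[of n]]]
        by (simp add: l2sq_minus_commute)
      moreover have "l2sq \<Omega> (grad (\<phi> n))
          \<le> 2 * l2sq \<Omega> (\<lambda>x. grad (\<phi> n) x - wgrad \<Omega> u x) + 2 * l2sq \<Omega> (wgrad \<Omega> u)"
        using l2sq_diff_le[OF grad_L2[OF \<phi>(1)[of n]] L2_zero L(2)] by simp
      ultimately show ?thesis
        using C(2)[OF \<phi>(1)[of n]] C(1) mult_left_mono[of _ _ C] by (smt (verit, best))
    qed
    moreover have "(\<lambda>n. 2 * l2sq \<Omega> (\<lambda>x. \<phi> n x - u x)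
        + 2 * (C * (2 * l2sq \<Omega> (\<lambda>x. grad (\<phi> n) x - wgrad \<Omega> u x) + 2 * l2sq \<Omega> (wgrad \<Omega> u))))
        \<longlonglongrightarrow> 2 * 0 + 2 * (C * (2 * 0 + 2 * l2sq \<Omega> (wgrad \<Omega> u)))"
      by (intro tendsto_intros \<phi>)
    ultimately have "l2sq \<Omega> u \<le> 2 * 0 + 2 * (C * (2 * 0 + 2 * l2sq \<Omega> (wgrad \<Omega> u)))"
      by (intro LIMSEQ_le_const) auto
    then show ?thesis by simp
  qed
  with C(1) show ?thesis by (intro that[of "4 * C"]) auto
qed

end

section \<open>Solvability of the Dirichlet problem\<close>

text \<open>First-order condition at a minimum. For t = -p/(q+1) the quadratic equals -t^2 (q+2);
  the summand 1 keeps the denominator positive when q = 0.\<close>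

lemma quadratic_nonneg_imp_linear_0:
  fixes p q :: real assumes "\<And>t. 0 \<le> 2 * t * p + t\<^sup>2 * q" "q \<ge> 0" shows "p = 0"
proof -
  define t where "t = - p / (q + 1)"
  have p: "p = - t * (q + 1)" using assms(2) by (simp add: t_def)
  have "0 \<le> - (t\<^sup>2 * (q + 2))"
    using assms(1)[of t] unfolding p by (simp add: power2_eq_square algebra_simps)
  then have "t = 0"
    using assms(2) by (simp add: mult_le_0_iff)
  then show ?thesis using p by simp
qed

context bounded_open
begin

text \<open>A diagonal choice: each \<open>u n\<close> is replaced by a test function within 1/(n+1)
  of it, in value and in gradient.\<close>

lemma H10_closed:
  assumes u: "\<And>n. u n \<in> H10 \<Omega>" and v: "v \<in> L2 \<Omega>" and g: "g \<in> L2 \<Omega>"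
    and l: "(\<lambda>n. l2sq \<Omega> (\<lambda>x. u n x - v x)) \<longlonglongrightarrow> 0" "(\<lambda>n. l2sq \<Omega> (\<lambda>x. wgrad \<Omega> (u n) x - g x)) \<longlonglongrightarrow> 0"
  shows "v \<in> H10 \<Omega>" "is_weak_grad \<Omega> v g"
proof -
  have ex: "\<exists>\<phi>. \<phi> \<in> test_functions \<Omega> \<and> l2sq \<Omega> (\<lambda>x. \<phi> x - u n x) < 1 / Suc n
      \<and> l2sq \<Omega> (\<lambda>x. grad \<phi> x - wgrad \<Omega> (u n) x) < 1 / Suc n" for n
  proof -
    obtain \<phi> where \<phi>: "\<And>k. \<phi> k \<in> test_functions \<Omega>" "(\<lambda>k. l2sq \<Omega> (\<lambda>x. \<phi> k x - u n x)) \<longlonglongrightarrow> 0"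
      "(\<lambda>k. l2sq \<Omega> (\<lambda>x. grad (\<phi> k) x - wgrad \<Omega> (u n) x)) \<longlonglongrightarrow> 0"
      using u[of n] by (rule H10_E) blast
    have "\<forall>\<^sub>F k in sequentially. l2sq \<Omega> (\<lambda>x. \<phi> k x - u n x) < 1 / Suc n"
      "\<forall>\<^sub>F k in sequentially. l2sq \<Omega> (\<lambda>x. grad (\<phi> k) x - wgrad \<Omega> (u n) x) < 1 / Suc n"
      using order_tendstoD(2)[OF \<phi>(2)] order_tendstoD(2)[OF \<phi>(3)] by simp_all
    then have "\<forall>\<^sub>F k in sequentially. l2sq \<Omega> (\<lambda>x. \<phi> k x - u n x) < 1 / Suc n
        \<and> l2sq \<Omega> (\<lambda>x. grad (\<phi> k) x - wgrad \<Omega> (u n) x) < 1 / Suc n" by (rule eventually_conj)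
    then obtain k where "l2sq \<Omega> (\<lambda>x. \<phi> k x - u n x) < 1 / Suc n
        \<and> l2sq \<Omega> (\<lambda>x. grad (\<phi> k) x - wgrad \<Omega> (u n) x) < 1 / Suc n"
      using eventually_happens'[OF sequentially_bot] by blast
    with \<phi>(1) show ?thesis by blast
  qed
  obtain \<phi> where "\<forall>n. \<phi> n \<in> test_functions \<Omega> \<and> l2sq \<Omega> (\<lambda>x. \<phi> n x - u n x) < 1 / Suc n
      \<and> l2sq \<Omega> (\<lambda>x. grad (\<phi> n) x - wgrad \<Omega> (u n) x) < 1 / Suc n"
    using choice[OF allI[OF ex]] by (rule exE)
  then have \<phi>: "\<And>n. \<phi> n \<in> test_functions \<Omega>"
    "\<And>n. l2sq \<Omega> (\<lambda>x. \<phi> n x - u n x) < 1 / Suc n"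
    "\<And>n. l2sq \<Omega> (\<lambda>x. grad (\<phi> n) x - wgrad \<Omega> (u n) x) < 1 / Suc n" by simp_all
  have lim: "(\<lambda>n. l2sq \<Omega> (\<lambda>x. a n x - p x)) \<longlonglongrightarrow> 0"
    if L: "\<And>n. a n \<in> L2 \<Omega>" "\<And>n. b n \<in> L2 \<Omega>" "p \<in> L2 \<Omega>"
      and s: "\<And>n. l2sq \<Omega> (\<lambda>x. a n x - b n x) < 1 / Suc n"
      and t: "(\<lambda>n. l2sq \<Omega> (\<lambda>x. b n x - p x)) \<longlonglongrightarrow> 0"
    for a b :: "nat \<Rightarrow> real ^ 'd \<Rightarrow> 'e::euclidean_space" and p
  proof (rule tendsto_sandwich[OF _ _ tendsto_const])
    show "\<forall>\<^sub>F n in sequentially. l2sq \<Omega> (\<lambda>x. a n x - p x) \<le> 2 * (1 / Suc n) + 2 * l2sq \<Omega> (\<lambda>x. b n x - p x)"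
    proof (rule always_eventually, rule allI)
      show "l2sq \<Omega> (\<lambda>x. a n x - p x) \<le> 2 * (1 / Suc n) + 2 * l2sq \<Omega> (\<lambda>x. b n x - p x)" for n
        using l2sq_diff_le[OF L(1)[of n] L(3) L(2)[of n]] s[of n] by linarith
    qed
    have "(\<lambda>n. 2 * (1 / Suc n) + 2 * l2sq \<Omega> (\<lambda>x. b n x - p x)) \<longlonglongrightarrow> 2 * 0 + 2 * 0"
      by (intro tendsto_intros t LIMSEQ_Suc[OF lim_1_over_n])
    then show "(\<lambda>n. 2 * (1 / Suc n) + 2 * l2sq \<Omega> (\<lambda>x. b n x - p x)) \<longlonglongrightarrow> 0" by simp
  qed auto
  note L = H1_L2[OF H10_H1[OF u]] wgrad_L2[OF H10_H1[OF u]]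
  note * = lim[OF test_function_L2[OF \<phi>(1)] L(1) v \<phi>(2) l(1)] lim[OF grad_L2[OF \<phi>(1)] L(2) g \<phi>(3) l(2)]
  show "v \<in> H10 \<Omega>" "is_weak_grad \<Omega> v g" by (rule H10_I[OF \<phi>(1) v g *])+
qed

text \<open>The Poincare inequality transfers the Cauchy property from the gradients to the
  functions, so gradients alone control the sequence.\<close>

lemma H10_complete:
  assumes u: "\<And>n. u n \<in> H10 \<Omega>"
    and c: "\<And>e. e > 0 \<Longrightarrow> \<exists>N. \<forall>m\<ge>N. \<forall>n\<ge>N. l2sq \<Omega> (\<lambda>x. wgrad \<Omega> (u m) x - wgrad \<Omega> (u n) x) < e"
  obtains v where "v \<in> H10 \<Omega>" "(\<lambda>n. l2sq \<Omega> (\<lambda>x. wgrad \<Omega> (u n) x - wgrad \<Omega> v x)) \<longlonglongrightarrow> 0"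
proof -
  note L = H1_L2[OF H10_H1[OF u]] wgrad_L2[OF H10_H1[OF u]]
  obtain C where C: "C > 0" "\<And>u. u \<in> H10 \<Omega> \<Longrightarrow> l2sq \<Omega> u \<le> C * l2sq \<Omega> (wgrad \<Omega> u)"
    using poincare by blast
  have le: "l2sq \<Omega> (\<lambda>x. u m x - u n x) \<le> C * l2sq \<Omega> (\<lambda>x. wgrad \<Omega> (u m) x - wgrad \<Omega> (u n) x)" for m n
  proof -
    have d: "(\<lambda>x. u m x - u n x) \<in> H10 \<Omega>" using H10_diff[OF u u] .
    have "l2sq \<Omega> (wgrad \<Omega> (\<lambda>x. u m x - u n x)) = l2sq \<Omega> (\<lambda>x. wgrad \<Omega> (u m) x - wgrad \<Omega> (u n) x)"
      by (intro l2sq_cong_AE wgrad_diff L2_diff L wgrad_L2 H10_H1 d u)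
    then show ?thesis using C(2)[OF d] by simp
  qed
  have c': "\<exists>N. \<forall>m\<ge>N. \<forall>n\<ge>N. l2sq \<Omega> (\<lambda>x. u m x - u n x) < e" if "e > 0" for e
  proof -
    have eC: "0 < e / C" using that C(1) by simp
    obtain N where "\<forall>m\<ge>N. \<forall>n\<ge>N. l2sq \<Omega> (\<lambda>x. wgrad \<Omega> (u m) x - wgrad \<Omega> (u n) x) < e / C"
      using c[OF eC] by blast
    then have N: "C * l2sq \<Omega> (\<lambda>x. wgrad \<Omega> (u m) x - wgrad \<Omega> (u n) x) < e" if "m \<ge> N" "n \<ge> N" for m n
      using C(1) that by (simp add: pos_less_divide_eq mult.commute)
    have "\<forall>m\<ge>N. \<forall>n\<ge>N. l2sq \<Omega> (\<lambda>x. u m x - u n x) < e"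
      using le_less_trans[OF le N] by blast
    then show ?thesis by blast
  qed
  obtain v r where v: "v \<in> L2 \<Omega>" "(\<lambda>n. l2sq \<Omega> (\<lambda>x. u n x - v x)) \<longlonglongrightarrow> 0"
    by (rule L2_complete[OF L(1) c'])
  obtain g r where g: "g \<in> L2 \<Omega>" "(\<lambda>n. l2sq \<Omega> (\<lambda>x. wgrad \<Omega> (u n) x - g x)) \<longlonglongrightarrow> 0"
    by (rule L2_complete[OF L(2) c])
  note vH = H10_closed[OF u v(1) g(1) v(2) g(2)]
  have "l2sq \<Omega> (\<lambda>x. wgrad \<Omega> (u n) x - wgrad \<Omega> v x) = l2sq \<Omega> (\<lambda>x. wgrad \<Omega> (u n) x - g x)" for n
  proof (rule l2sq_cong_AE)
    show "AE x in lebesgue_on \<Omega>. wgrad \<Omega> (u n) x - wgrad \<Omega> v x = wgrad \<Omega> (u n) x - g x"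
      using wgrad_AE[OF vH(2)] by eventually_elim simp
  qed (intro L2_diff L g wgrad_L2 H10_H1 vH)+
  then show ?thesis using that[OF vH(1)] g(2) by simp
qed

lemma Hm1_lincomb:
  "f \<in> Hm1 \<Omega> \<Longrightarrow> u \<in> H10 \<Omega> \<Longrightarrow> v \<in> H10 \<Omega> \<Longrightarrow> f (\<lambda>x. u x + c * v x) = f u + c * f v"
  using H10_cmult[of v c] unfolding Hm1_def by simp

text \<open>The Poincare inequality turns the bound by the full H1 norm into one by the gradient.
  The added 1 in the constant keeps it positive even for c = 0.\<close>

lemma Hm1_bound:
  assumes "f \<in> Hm1 \<Omega>"
  obtains C where "C > 0" "\<And>u. u \<in> H10 \<Omega> \<Longrightarrow> (f u)\<^sup>2 \<le> C * l2sq \<Omega> (wgrad \<Omega> u)"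
proof -
  obtain c where c: "\<And>u. u \<in> H10 \<Omega> \<Longrightarrow> \<bar>f u\<bar> \<le> c * H1_norm \<Omega> u"
    using assms unfolding Hm1_def by blast
  obtain C where C: "C > 0" "\<And>u. u \<in> H10 \<Omega> \<Longrightarrow> l2sq \<Omega> u \<le> C * l2sq \<Omega> (wgrad \<Omega> u)"
    using poincare by blast
  have "(f u)\<^sup>2 \<le> (c\<^sup>2 * (C + 1) + 1) * l2sq \<Omega> (wgrad \<Omega> u)" if "u \<in> H10 \<Omega>" for u
  proof -
    have "(f u)\<^sup>2 \<le> (c * H1_norm \<Omega> u)\<^sup>2" using c[OF that] by (metis abs_ge_zero power2_abs power_mono)
    also have "\<dots> = c\<^sup>2 * (l2sq \<Omega> u + l2sq \<Omega> (wgrad \<Omega> u))" by (simp add: power_mult_distrib H1_norm_sq)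
    also have "\<dots> \<le> c\<^sup>2 * (C * l2sq \<Omega> (wgrad \<Omega> u) + l2sq \<Omega> (wgrad \<Omega> u))"
      using C(2)[OF that] by (intro mult_left_mono) auto
    also have "\<dots> \<le> (c\<^sup>2 * (C + 1) + 1) * l2sq \<Omega> (wgrad \<Omega> u)"
      by (simp add: algebra_simps)
    finally show ?thesis .
  qed
  then show ?thesis using C(1) that[of "c\<^sup>2 * (C + 1) + 1"] by (simp add: add_nonneg_pos)
qed

lemma energy_wgrad_lincomb:
  assumes A: "elliptic \<Omega> a b A" and u: "u \<in> H10 \<Omega>" "v \<in> H10 \<Omega>"
  shows "energy \<Omega> A (wgrad \<Omega> (\<lambda>x. u x + t * v x)) (wgrad \<Omega> (\<lambda>x. u x + t * v x))
    = energy \<Omega> A (wgrad \<Omega> u) (wgrad \<Omega> u) + 2 * t * energy \<Omega> A (wgrad \<Omega> u) (wgrad \<Omega> v)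
      + t\<^sup>2 * energy \<Omega> A (wgrad \<Omega> v) (wgrad \<Omega> v)"
proof -
  note L = wgrad_L2[OF H10_H1[OF u(1)]] wgrad_L2[OF H10_H1[OF u(2)]]
  have "energy \<Omega> A (wgrad \<Omega> (\<lambda>x. u x + t * v x)) (wgrad \<Omega> (\<lambda>x. u x + t * v x))
      = energy \<Omega> A (\<lambda>x. wgrad \<Omega> u x + t *\<^sub>R wgrad \<Omega> v x) (\<lambda>x. wgrad \<Omega> u x + t *\<^sub>R wgrad \<Omega> v x)"
    by (intro energy_cong_AE[OF A] wgrad_lincomb H10_H1 u L2_add L2_scaleR L wgrad_L2 H10_lincomb)
  then show ?thesis using energy_add_scaleR[OF A L] by simp
qed

text \<open>Ritz method: a sequence minimising the energy minus 2 f converges in H10, and the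
  first-order condition at its limit is the weak equation.\<close>

lemma dirichlet_exists:
  assumes A: "elliptic \<Omega> a b A" and f: "f \<in> Hm1 \<Omega>"
  obtains u where "u \<in> H10 \<Omega>" "neg_div_eq \<Omega> (\<lambda>x. A x *v wgrad \<Omega> u x) f"
proof -
  define G where "G u = energy \<Omega> A (wgrad \<Omega> u) (wgrad \<Omega> u) - 2 * f u" for u
  have a: "a > 0" using A by (simp add: elliptic_def)
  obtain C where C: "C > 0" "\<And>u. u \<in> H10 \<Omega> \<Longrightarrow> (f u)\<^sup>2 \<le> C * l2sq \<Omega> (wgrad \<Omega> u)"
    using Hm1_bound[OF f] by blast
  have lb: "- C / a \<le> G u" if "u \<in> H10 \<Omega>" for u
  proof -
    define s where "s = l2sq \<Omega> (wgrad \<Omega> u)"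
    \<comment> \<open>The arithmetic-geometric mean inequality for a s and C/a, whose product is C
      s; the lower bound -C/a of \<open>G\<close> comes from here.\<close>
    have "(2 * \<bar>f u\<bar>)\<^sup>2 \<le> 4 * (C * s)" using C(2)[OF that] by (simp add: s_def power_mult_distrib)
    also have "\<dots> = (a * s + C / a)\<^sup>2 - (a * s - C / a)\<^sup>2"
      using a by (simp add: power2_eq_square field_simps)
    also have "\<dots> \<le> (a * s + C / a)\<^sup>2" by simp
    finally have "2 * \<bar>f u\<bar> \<le> a * s + C / a"
      by (rule power2_le_imp_le) (use a C(1) in \<open>auto simp: s_def\<close>)
    moreover have "a * s \<le> energy \<Omega> A (wgrad \<Omega> u) (wgrad \<Omega> u)"
      unfolding s_def by (rule energy_ge[OF A wgrad_L2[OF H10_H1[OF that]]])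
    ultimately show ?thesis unfolding G_def by linarith
  qed
  define m where "m = Inf (G ` H10 \<Omega>)"
  have bdd: "bdd_below (G ` H10 \<Omega>)" using lb by (auto intro!: bdd_belowI2)
  have mG: "m \<le> G u" if "u \<in> H10 \<Omega>" for u
    unfolding m_def using bdd that by (intro cInf_lower) auto
  have "\<exists>u\<in>H10 \<Omega>. G u < m + 1 / Suc n" for n
    using cInf_lessD[of "G ` H10 \<Omega>" "m + 1 / Suc n"] H10_zero unfolding m_def by auto
  then obtain u where u: "\<And>n. u n \<in> H10 \<Omega>" "\<And>n. G (u n) < m + 1 / Suc n" by metis
  note L = wgrad_L2[OF H10_H1[OF u(1)]]
  have inv0: "(\<lambda>n. 1 / real (Suc n)) \<longlonglongrightarrow> 0" by (rule LIMSEQ_Suc[OF lim_1_over_n])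
  \<comment> \<open>The midpoint is admissible, so \<open>G\<close> is at least m there. The
    parallelogram identity then bounds the left side by 2 (G(u_k) - m) + 2 (G(u_n) - m).\<close>
  have par: "a * l2sq \<Omega> (\<lambda>x. wgrad \<Omega> (u k) x - wgrad \<Omega> (u n) x) \<le> 2 / Suc k + 2 / Suc n" for k n
  proof -
    let ?e = "\<lambda>i j. energy \<Omega> A (wgrad \<Omega> (u i)) (wgrad \<Omega> (u j))"
    have mid: "(\<lambda>x. (1/2) * (u k x + 1 * u n x)) \<in> H10 \<Omega>"
      by (intro H10_cmult H10_lincomb u)
    have half: "energy \<Omega> A (wgrad \<Omega> (\<lambda>x. (1/2) * v x)) (wgrad \<Omega> (\<lambda>x. (1/2) * v x))
        = (1/4) * energy \<Omega> A (wgrad \<Omega> v) (wgrad \<Omega> v)" if "v \<in> H10 \<Omega>" for v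
    proof -
      \<comment> \<open>Half of v is written as v - v/2 to fit
        \<open>energy_wgrad_lincomb\<close>.\<close>
      have "energy \<Omega> A (wgrad \<Omega> (\<lambda>x. v x + (- (1/2)) * v x)) (wgrad \<Omega> (\<lambda>x. v x + (- (1/2)) * v x))
        = (1/4) * energy \<Omega> A (wgrad \<Omega> v) (wgrad \<Omega> v)"
        unfolding energy_wgrad_lincomb[OF A that that] by (simp add: power2_eq_square)
      then show ?thesis by (simp add: algebra_simps)
    qed
    have "m \<le> G (\<lambda>x. (1/2) * (u k x + 1 * u n x))" using mG[OF mid] .
    also have "\<dots> = (1/4) * (?e k k + 2 * ?e k n + ?e n n) - (f (u k) + f (u n))"
      unfolding G_def half[OF H10_lincomb[OF u(1) u(1)]] energy_wgrad_lincomb[OF A u(1) u(1)]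
      using Hm1_lincomb[OF f H10_zero H10_lincomb[OF u(1)[of k] u(1)[of n], of 1], of "1/2"]
        Hm1_lincomb[OF f u(1)[of k] u(1)[of n], of 1] Hm1_lincomb[OF f H10_zero H10_zero, of 1]
      by simp
    finally have 1: "4 * m \<le> ?e k k + 2 * ?e k n + ?e n n - 4 * (f (u k) + f (u n))" by argo
    have "a * l2sq \<Omega> (\<lambda>x. wgrad \<Omega> (u k) x + (-1) *\<^sub>R wgrad \<Omega> (u n) x) \<le> ?e k k - 2 * ?e k n + ?e n n"
      using energy_ge[OF A L2_add[OF L[of k] L2_scaleR[OF L[of n], of "-1"]]]
        energy_add_scaleR[OF A L[of k] L[of n], of "-1"] by simp
    with 1 u(2)[of k] u(2)[of n] show ?thesis unfolding G_def by simp
  qed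
  have "\<exists>N. \<forall>k\<ge>N. \<forall>n\<ge>N. l2sq \<Omega> (\<lambda>x. wgrad \<Omega> (u k) x - wgrad \<Omega> (u n) x) < e" if "e > 0" for e
  proof -
    have "0 < a * e / 4" using a that by simp
    then obtain N where N: "1 / Suc N < a * e / 4" using nat_approx_posE by blast
    have "l2sq \<Omega> (\<lambda>x. wgrad \<Omega> (u k) x - wgrad \<Omega> (u n) x) < e" if "k \<ge> N" "n \<ge> N" for k n
    proof -
      have "1 / Suc k \<le> 1 / Suc N" "1 / Suc n \<le> 1 / Suc N"
        using that by (auto intro!: divide_left_mono)
      then have "a * l2sq \<Omega> (\<lambda>x. wgrad \<Omega> (u k) x - wgrad \<Omega> (u n) x) < a * e"
        using par[of k n] N by simp
      then show ?thesis using a by simp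
    qed
    then show ?thesis by blast
  qed
  from H10_complete[OF u(1) this]
  obtain v where v: "v \<in> H10 \<Omega>" "(\<lambda>n. l2sq \<Omega> (\<lambda>x. wgrad \<Omega> (u n) x - wgrad \<Omega> v x)) \<longlonglongrightarrow> 0"
    by blast
  have "neg_div_eq \<Omega> (\<lambda>x. A x *v wgrad \<Omega> v x) f"
    unfolding neg_div_eq_def
  proof
    fix z assume z: "z \<in> H10 \<Omega>"
    note zL = wgrad_L2[OF H10_H1[OF z]] and vL = wgrad_L2[OF H10_H1[OF v(1)]]
    have comm: "energy \<Omega> A g (wgrad \<Omega> z) = (\<integral>x. g x \<bullet> (A x *v wgrad \<Omega> z x) \<partial>lebesgue_on \<Omega>)" if "g \<in> L2 \<Omega>" for g
      using energy_commute[OF A that zL] by (simp add: energy_def inner_commute)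
    have e: "(\<lambda>n. energy \<Omega> A (wgrad \<Omega> (u n)) (wgrad \<Omega> z)) \<longlonglongrightarrow> energy \<Omega> A (wgrad \<Omega> v) (wgrad \<Omega> z)"
      unfolding comm[OF L] comm[OF vL]
      by (rule l2_inner_tendsto[OF L vL elliptic_L2[OF A zL] v(2)])
    let ?p = "energy \<Omega> A (wgrad \<Omega> v) (wgrad \<Omega> z) - f z" and ?q = "energy \<Omega> A (wgrad \<Omega> z) (wgrad \<Omega> z)"
    \<comment> \<open>Each \<open>u n\<close> is optimal up to 1/(n+1), so the expansion of
      \<open>G\<close> along z is nonnegative up to that error, and only the term linear in the
      gradient of \<open>u n\<close> has to pass to the limit.\<close>
    have "0 \<le> 2 * t * ?p + t\<^sup>2 * ?q" for t
    proof -
      have "0 \<le> 2 * t * (energy \<Omega> A (wgrad \<Omega> (u n)) (wgrad \<Omega> z) - f z) + t\<^sup>2 * ?q + 1 / Suc n" for n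
        using mG[OF H10_lincomb[OF u(1)[of n] z, of t]] u(2)[of n]
        unfolding G_def energy_wgrad_lincomb[OF A u(1)[of n] z] Hm1_lincomb[OF f u(1)[of n] z]
        by (simp add: algebra_simps)
      moreover have "(\<lambda>n. 2 * t * (energy \<Omega> A (wgrad \<Omega> (u n)) (wgrad \<Omega> z) - f z) + t\<^sup>2 * ?q + 1 / Suc n)
          \<longlonglongrightarrow> 2 * t * ?p + t\<^sup>2 * ?q + 0"
        by (intro tendsto_intros e inv0)
      ultimately have "0 \<le> 2 * t * ?p + t\<^sup>2 * ?q + 0"
        by (intro LIMSEQ_le_const) auto
      then show ?thesis by simp
    qed
    moreover have "?q \<ge> 0"
      using order_trans[OF mult_nonneg_nonneg[OF less_imp_le[OF a] l2sq_nonneg] energy_ge[OF A zL]] .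
    ultimately have "?p = 0" by (rule quadratic_nonneg_imp_linear_0)
    then show "(\<integral>x. (A x *v wgrad \<Omega> v x) \<bullet> wgrad \<Omega> z x \<partial>lebesgue_on \<Omega>) = f z"
      by (simp add: energy_def)
  qed
  with v(1) show ?thesis by (rule that)
qed

lemma dirichlet_solution:
  assumes "elliptic \<Omega> a b A" "f \<in> Hm1 \<Omega>"
  shows "dirichlet_solution \<Omega> A f \<in> H10 \<Omega>"
    "neg_div_eq \<Omega> (\<lambda>x. A x *v wgrad \<Omega> (dirichlet_solution \<Omega> A f) x) f"
proof -
  have "\<exists>u. u \<in> H10 \<Omega> \<and> neg_div_eq \<Omega> (\<lambda>x. A x *v wgrad \<Omega> u x) f"
    using dirichlet_exists[OF assms] by blast
  from someI_ex[OF this] show "dirichlet_solution \<Omega> A f \<in> H10 \<Omega>"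
    "neg_div_eq \<Omega> (\<lambda>x. A x *v wgrad \<Omega> (dirichlet_solution \<Omega> A f) x) f"
    by (simp_all add: dirichlet_solution_def)
qed

text \<open>Symmetry of the energy: f v = E(u,v) = E(v,u) = f u. Hence any explicit solution
  evaluates the chosen one under f.\<close>

lemma dirichlet_solution_value:
  assumes A: "elliptic \<Omega> a b A" and f: "f \<in> Hm1 \<Omega>"
    and u: "u \<in> H10 \<Omega>" "neg_div_eq \<Omega> (\<lambda>x. A x *v wgrad \<Omega> u x) f"
  shows "f (dirichlet_solution \<Omega> A f) = f u"
proof -
  let ?v = "dirichlet_solution \<Omega> A f"
  note v = dirichlet_solution[OF A f]
  have "f ?v = energy \<Omega> A (wgrad \<Omega> u) (wgrad \<Omega> ?v)"
    using u(2) v(1) by (simp add: neg_div_eq_def energy_def)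
  also have "\<dots> = energy \<Omega> A (wgrad \<Omega> ?v) (wgrad \<Omega> u)"
    by (intro energy_commute[OF A] wgrad_L2 H10_H1 u v)
  also have "\<dots> = f u" using v(2) u(1) by (simp add: neg_div_eq_def energy_def)
  finally show ?thesis .
qed

end

section \<open>Symmetric matrices\<close>

text \<open>A zero of a nonnegative quadratic form is a minimum; the first-order condition in the
  direction N v says that N v has length zero.\<close>

lemma psd_kernel:
  fixes N :: "real ^ 'd ^ 'd"
  assumes "symmetric_mat N" "\<And>v. 0 \<le> v \<bullet> (N *v v)" "v \<bullet> (N *v v) = 0"
  shows "N *v v = 0"
proof -
  let ?y = "N *v v"
  have "0 \<le> 2 * t * (?y \<bullet> ?y) + t\<^sup>2 * (?y \<bullet> (N *v ?y))" for t
  proof -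
    have "0 \<le> (v + t *\<^sub>R ?y) \<bullet> (N *v (v + t *\<^sub>R ?y))" by (rule assms)
    also have "\<dots> = v \<bullet> ?y + t * (v \<bullet> (N *v ?y)) + t * (?y \<bullet> ?y) + t\<^sup>2 * (?y \<bullet> (N *v ?y))"
      by (simp add: matrix_vector_right_distrib matrix_vector_mult_scaleR inner_add_left inner_add_right
          power2_eq_square algebra_simps)
    also have "v \<bullet> (N *v ?y) = ?y \<bullet> ?y" using symmetric_mat_inner[OF assms(1), of v ?y] by simp
    finally show ?thesis using assms(3) by (simp add: algebra_simps)
  qed
  then have "?y \<bullet> ?y = 0"
    by (rule quadratic_nonneg_imp_linear_0) (rule assms)
  then show ?thesis by simp
qed

text \<open>Eigenvectors of distinct eigenvalues are orthogonal, and a pairwise orthogonal set is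
  finite. Together with non-emptiness this gives \<open>Min\<close> and \<open>Max\<close> of the
  spectrum their meaning.\<close>

lemma eigenvalues_finite:
  fixes N :: "real ^ 'd ^ 'd" assumes "symmetric_mat N" shows "finite (eigenvalues N)"
proof -
  have "\<forall>c\<in>eigenvalues N. \<exists>v. v \<noteq> 0 \<and> N *v v = c *\<^sub>R v" by (auto simp: eigenvalues_def)
  then obtain v where v: "\<And>c. c \<in> eigenvalues N \<Longrightarrow> v c \<noteq> 0" "\<And>c. c \<in> eigenvalues N \<Longrightarrow> N *v v c = c *\<^sub>R v c"
    by metis
  have orth: "orthogonal (v b) (v c)" if "b \<in> eigenvalues N" "c \<in> eigenvalues N" "b \<noteq> c" for b c
  proof -
    have "b * (v b \<bullet> v c) = c * (v b \<bullet> v c)"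
      using symmetric_mat_inner[OF assms, of "v b" "v c"] v(2) that by simp
    then show ?thesis using that by (simp add: orthogonal_def)
  qed
  then have "pairwise orthogonal (v ` eigenvalues N)"
    by (auto simp: pairwise_def)
  then have "finite (v ` eigenvalues N)" by (rule pairwise_orthogonal_imp_finite)
  moreover have "inj_on v (eigenvalues N)"
    using orth v(1) by (metis inj_onI orthogonal_self)
  ultimately show ?thesis by (rule finite_imageD)
qed

text \<open>The quadratic form attains a maximum c on the unit sphere. Then c I - N is positive
  semidefinite and its form vanishes at the maximiser, which \<open>psd_kernel\<close> makes an
  eigenvector.\<close>

lemma eigenvalues_nonempty:
  fixes N :: "real ^ 'd ^ 'd" assumes "symmetric_mat N" shows "eigenvalues N \<noteq> {}"
proof -
  let ?h = "\<lambda>v. v \<bullet> (N *v v)"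
  have "continuous_on (sphere 0 1) ?h"
    by (intro continuous_intros linear_continuous_on matrix_vector_mul_bounded_linear)
  moreover have "sphere (0 :: real ^ 'd) 1 \<noteq> {}" by (simp add: sphere_eq_empty)
  ultimately obtain v where v: "v \<in> sphere 0 1" "\<And>y. y \<in> sphere 0 1 \<Longrightarrow> ?h y \<le> ?h v"
    using continuous_attains_sup[of "sphere 0 1" ?h] by (auto simp: compact_sphere)
  define c where "c = ?h v"
  define P where "P = c *\<^sub>R mat 1 - N"
  have P: "P *v y = c *\<^sub>R y - N *v y" for y
    by (simp add: P_def matrix_vector_mult_diff_rdistrib scaleR_matrix_vector_assoc[symmetric])
  have "symmetric_mat P"
    using assms by (auto simp: symmetric_mat_def P_def transpose_def vec_eq_iff mat_def)
  moreover have "0 \<le> y \<bullet> (P *v y)" for y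
  proof (cases "y = 0")
    case False
    have "?h (y /\<^sub>R norm y) \<le> c" unfolding c_def by (rule v(2)) (use False in simp)
    then have "?h y \<le> c * (norm y)\<^sup>2"
      using False by (simp add: matrix_vector_mult_scaleR field_simps power2_eq_square)
    then show ?thesis by (simp add: P inner_diff_right power2_norm_eq_inner)
  qed simp
  moreover have "v \<bullet> (P *v v) = 0"
    using v(1) by (simp add: P inner_diff_right c_def flip: power2_norm_eq_inner)
  ultimately have "P *v v = 0" by (rule psd_kernel)
  then have "N *v v = c *\<^sub>R v" by (simp add: P)
  moreover have "v \<noteq> 0" using v(1) by auto
  ultimately show ?thesis by (auto simp: eigenvalues_def)
qed

lemma spd_mat_lambda:
  assumes "spd_mat N" shows "0 < lambda_min N" "lambda_min N \<le> lambda_max N"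
proof -
  have s: "symmetric_mat N" using assms by (simp add: spd_mat_def)
  note fin = eigenvalues_finite[OF s] eigenvalues_nonempty[OF s]
  have "c > 0" if "c \<in> eigenvalues N" for c
  proof -
    obtain v where "v \<noteq> 0" "N *v v = c *\<^sub>R v" using \<open>c \<in> eigenvalues N\<close> by (auto simp: eigenvalues_def)
    moreover from this have "v \<bullet> (c *\<^sub>R v) > 0" using assms by (metis spd_mat_def)
    ultimately show ?thesis using inner_ge_zero[of v] by (auto simp: zero_less_mult_iff simp del: inner_ge_zero)
  qed
  then show "0 < lambda_min N" using fin Min_in unfolding lambda_min_def by blast
  show "lambda_min N \<le> lambda_max N"
    unfolding lambda_min_def lambda_max_def using fin by (meson Max_in Min_le)
qed

lemma norm_matrix_vector_le:
  fixes A :: "real ^ 'k ^ 'j"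
  shows "norm (A *v v) \<le> (real CARD('j) * norm A) * norm v"
proof -
  have "norm (A *v v) \<le> (\<Sum>i\<in>UNIV. \<bar>(A *v v) $ i\<bar>)" by (rule norm_le_l1_cart)
  also have "\<dots> \<le> (\<Sum>i\<in>(UNIV :: 'j set). norm A * norm v)"
  proof (rule sum_mono)
    fix i
    have "(A *v v) $ i = A $ i \<bullet> v" by (simp add: matrix_vector_mul_component)
    then have "\<bar>(A *v v) $ i\<bar> \<le> norm (A $ i) * norm v" by (simp add: Cauchy_Schwarz_ineq2)
    also have "\<dots> \<le> norm A * norm v"
      by (intro mult_right_mono Finite_Cartesian_Product.norm_nth_le) auto
    finally show "\<bar>(A *v v) $ i\<bar> \<le> norm A * norm v" .
  qed
  finally show ?thesis by simp
qed

text \<open>Completing the square splits the gap into the deviation of s from c g and the excess of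
  A over c I in the direction g.\<close>

lemma flux_gap_eq:
  fixes A :: "real ^ 'd ^ 'd" and s g :: "real ^ 'd"
  assumes "c > 0"
  shows "(norm s)\<^sup>2 / c - 2 * (s \<bullet> g) + (A *v g) \<bullet> g
    = (norm (s - c *\<^sub>R g))\<^sup>2 / c + ((A *v g) \<bullet> g - c * (norm g)\<^sup>2)"
  using assms unfolding power2_norm_eq_inner
  by (simp add: inner_diff_left inner_diff_right inner_commute field_simps)

text \<open>For A \<ge> c I both parts of the gap are nonnegative, so equality kills each of them; a
  vanishing excess puts g into the kernel of A - c I.\<close>

lemma flux_gap:
  fixes A :: "real ^ 'd ^ 'd" and s g :: "real ^ 'd"
  assumes c: "c > 0" and A: "symmetric_mat A" "\<And>v. c * (norm v)\<^sup>2 \<le> v \<bullet> (A *v v)"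
  shows "0 \<le> (norm s)\<^sup>2 / c - 2 * (s \<bullet> g) + (A *v g) \<bullet> g"
    and "(norm s)\<^sup>2 / c - 2 * (s \<bullet> g) + (A *v g) \<bullet> g = 0 \<longleftrightarrow> s = c *\<^sub>R g \<and> A *v g = c *\<^sub>R g"
proof -
  have n: "0 \<le> (norm (s - c *\<^sub>R g))\<^sup>2 / c" "0 \<le> (A *v g) \<bullet> g - c * (norm g)\<^sup>2"
    using c A(2)[of g] by (auto simp: inner_commute)
  then show "0 \<le> (norm s)\<^sup>2 / c - 2 * (s \<bullet> g) + (A *v g) \<bullet> g"
    unfolding flux_gap_eq[OF c] by linarith
  have "A *v g = c *\<^sub>R g" if "(A *v g) \<bullet> g - c * (norm g)\<^sup>2 = 0"
  proof -
    define P where "P = A - c *\<^sub>R mat 1"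
    have P: "P *v y = A *v y - c *\<^sub>R y" for y
      by (simp add: P_def matrix_vector_mult_diff_rdistrib scaleR_matrix_vector_assoc[symmetric])
    have "symmetric_mat P"
      using A(1) by (auto simp: symmetric_mat_def P_def transpose_def vec_eq_iff mat_def)
    moreover have "0 \<le> y \<bullet> (P *v y)" for y
      using A(2)[of y] by (simp add: P inner_diff_right power2_norm_eq_inner)
    moreover have "g \<bullet> (P *v g) = 0"
      using that by (simp add: P inner_diff_right power2_norm_eq_inner inner_commute)
    ultimately have "P *v g = 0" by (rule psd_kernel)
    then show ?thesis by (simp add: P)
  qed
  moreover have "(A *v g) \<bullet> g - c * (norm g)\<^sup>2 = 0" if "A *v g = c *\<^sub>R g"
    using that by (simp add: power2_norm_eq_inner)
  ultimately show "(norm s)\<^sup>2 / c - 2 * (s \<bullet> g) + (A *v g) \<bullet> g = 0 \<longleftrightarrow> s = c *\<^sub>R g \<and> A *v g = c *\<^sub>R g"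
    unfolding flux_gap_eq[OF c] using n c by (auto simp: add_nonneg_eq_0_iff)
qed

text \<open>Coercivity makes the kernel trivial, so the choice behind \<open>matrix_inv\<close>
  picks a true inverse.\<close>

lemma matrix_inv_left_mult:
  fixes A :: "real ^ 'd ^ 'd"
  assumes "c > 0" "\<And>v. c * (norm v)\<^sup>2 \<le> v \<bullet> (A *v v)"
  shows "matrix_inv A *v (A *v g) = g" "A *v (matrix_inv A *v g) = g"
proof -
  have "v = 0" if "A *v v = 0" for v
  proof -
    have "c * (norm v)\<^sup>2 \<le> 0" using assms(2)[of v] that by simp
    then show ?thesis using assms(1) by (simp add: mult_le_0_iff)
  qed
  then have "invertible A"
    by (simp add: invertible_left_inverse matrix_left_invertible_ker)
  then have "A ** matrix_inv A = mat 1 \<and> matrix_inv A ** A = mat 1"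
    unfolding invertible_def matrix_inv_def by (rule someI_ex)
  then show "matrix_inv A *v (A *v g) = g" "A *v (matrix_inv A *v g) = g"
    by (simp_all add: matrix_vector_mul_assoc)
qed

section \<open>Coefficients in B\<close>

text \<open>The reciprocal of \<open>lam_minus\<close>, singled out because it is linear in
  \<open>\<theta>\<close>.\<close>

definition inv_lam :: "('n \<Rightarrow> real ^ 'd ^ 'd) \<Rightarrow> real ^ 'n \<Rightarrow> real" where
  "inv_lam M \<theta> = (\<Sum>i\<in>UNIV. \<theta> $ i / lambda_min (M i))"

lemma lam_minus_eq: "lam_minus M \<theta> = 1 / inv_lam M \<theta>"
  by (simp add: lam_minus_def inv_lam_def)

lemma inv_lam_lincomb: "inv_lam M (s *\<^sub>R \<theta> + t *\<^sub>R \<eta>) = s * inv_lam M \<theta> + t * inv_lam M \<eta>"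
  by (simp add: inv_lam_def sum.distrib sum_distrib_left add_divide_distrib)

lemma inv_lam_measurable:
  "\<theta> \<in> borel_measurable N \<Longrightarrow> (\<lambda>x. inv_lam M (\<theta> x)) \<in> borel_measurable N"
  unfolding inv_lam_def cart_eq_inner_axis
  by (intro borel_measurable_sum borel_measurable_divide borel_measurable_inner borel_measurable_const)

locale mixture = bounded_open \<Omega> for \<Omega> :: "(real ^ 'd) set" +
  fixes M :: "'n::finite \<Rightarrow> real ^ 'd ^ 'd" and q :: "'n \<Rightarrow> real"
  assumes spd: "\<And>i. spd_mat (M i)"
begin

text \<open>\<open>cmin\<close> and \<open>cmax\<close> are crude bounds of \<open>inv_lam\<close>
  on \<open>K\<close>: sums over all phases in place of a maximum of the eigenvalues and of their
  reciprocals.\<close>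

definition cmin :: real where "cmin = 1 / (\<Sum>i\<in>UNIV. lambda_min (M i))"
definition cmax :: real where "cmax = (\<Sum>i\<in>UNIV. 1 / lambda_min (M i))"

lemma lmin_pos: "0 < lambda_min (M i)"
  by (rule spd_mat_lambda(1)[OF spd])

lemma cmin_pos: "cmin > 0"
  unfolding cmin_def using lmin_pos by (intro divide_pos_pos sum_pos) auto

lemma inv_lam_bounds:
  assumes "\<theta> \<in> K" shows "cmin \<le> inv_lam M \<theta>" "inv_lam M \<theta> \<le> cmax"
proof -
  have \<theta>: "0 \<le> \<theta> $ i" "\<theta> $ i \<le> 1" "(\<Sum>i\<in>UNIV. \<theta> $ i) = 1" for i using assms by (auto simp: K_def)
  show "inv_lam M \<theta> \<le> cmax" unfolding inv_lam_def cmax_def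
    by (intro sum_mono divide_right_mono) (use \<theta> lmin_pos in \<open>auto simp: less_imp_le\<close>)
  have "cmin = (\<Sum>i\<in>UNIV. \<theta> $ i) * cmin" using \<theta> by simp
  also have "\<dots> \<le> inv_lam M \<theta>" unfolding inv_lam_def sum_distrib_right
  proof (rule sum_mono)
    fix i :: 'n
    have "lambda_min (M i) \<le> (\<Sum>i\<in>UNIV. lambda_min (M i))"
      by (rule member_le_sum) (use lmin_pos in \<open>auto simp: less_imp_le\<close>)
    then have "cmin \<le> 1 / lambda_min (M i)" unfolding cmin_def
      using lmin_pos[of i] by (intro divide_left_mono mult_pos_pos) auto
    then show "\<theta> $ i * cmin \<le> \<theta> $ i / lambda_min (M i)"
      using mult_left_mono[OF _ \<theta>(1)[of i]] by fastforce
  qed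
  finally show "cmin \<le> inv_lam M \<theta>" .
qed

lemma cmax_pos: "cmax > 0"
  unfolding cmax_def using lmin_pos by (intro sum_pos) auto

lemma inv_lam_pos: "\<theta> \<in> K \<Longrightarrow> inv_lam M \<theta> > 0"
  using inv_lam_bounds(1) cmin_pos by (meson less_le_trans)

lemma lam_minus_pos: "\<theta> \<in> K \<Longrightarrow> lam_minus M \<theta> > 0"
  by (simp add: lam_minus_eq inv_lam_pos)

lemma lam_minus_bounds:
  assumes "\<theta> \<in> K" shows "1 / cmax \<le> lam_minus M \<theta>" "lam_minus M \<theta> \<le> 1 / cmin"
  using inv_lam_bounds[OF assms] inv_lam_pos[OF assms] cmin_pos cmax_pos
  by (auto simp: lam_minus_eq intro!: divide_left_mono)

text \<open>Harmonic mean below arithmetic mean: with y =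
  \<open>lambda_min (M i) * inv_lam M \<theta>\<close>, averaging y + 1/y \<ge> 2 with the weights
  \<open>\<theta> $ i\<close> gives the claim.\<close>

lemma lam_minus_le_lam_plus:
  assumes "\<theta> \<in> K" shows "lam_minus M \<theta> \<le> lam_plus M \<theta>"
proof -
  have \<theta>: "0 \<le> \<theta> $ i" "(\<Sum>i\<in>UNIV. \<theta> $ i) = 1" for i using assms by (auto simp: K_def)
  let ?c = "inv_lam M \<theta>"
  have c: "?c > 0" using inv_lam_pos[OF assms] .
  have "2 * (\<Sum>i\<in>UNIV. \<theta> $ i) \<le> (\<Sum>i\<in>UNIV. \<theta> $ i * lambda_max (M i) * ?c + \<theta> $ i / lambda_min (M i) / ?c)"
    unfolding sum_distrib_left
  proof (rule sum_mono)
    fix i :: 'n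
    let ?l = "lambda_min (M i)"
    have l: "?l > 0" "?l \<le> lambda_max (M i)" using spd_mat_lambda[OF spd[of i]] by auto
    define y where "y = ?l * ?c"
    have y: "y > 0" using l c by (simp add: y_def)
    have "0 \<le> (y - 1)\<^sup>2 / y" using y by simp
    also have "\<dots> = y + 1 / y - 2" using y by (simp add: field_simps power2_eq_square)
    finally have "2 \<le> y + 1 / y" by simp
    moreover have "y \<le> lambda_max (M i) * ?c" unfolding y_def using l c by (simp add: mult_right_mono)
    ultimately have "2 \<le> lambda_max (M i) * ?c + 1 / y" by linarith
    from mult_left_mono[OF this \<theta>(1)[of i]]
    show "2 * \<theta> $ i \<le> \<theta> $ i * lambda_max (M i) * ?c + \<theta> $ i / ?l / ?c"
      by (simp add: y_def algebra_simps)
  qed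
  also have "\<dots> = lam_plus M \<theta> * ?c + ?c / ?c"
    unfolding sum.distrib lam_plus_def sum_distrib_right[symmetric] sum_divide_distrib[symmetric]
    by (simp add: inv_lam_def)
  finally have "1 \<le> lam_plus M \<theta> * ?c" using \<theta>(2) c by simp
  then show ?thesis using c by (simp add: lam_minus_eq field_simps)
qed

section \<open>Relaxed designs and their coefficients\<close>

lemma T_AE: "\<theta> \<in> T \<Omega> q \<Longrightarrow> AE x in lebesgue_on \<Omega>. \<theta> x \<in> K"
  and T_measurable: "\<theta> \<in> T \<Omega> q \<Longrightarrow> \<theta> \<in> borel_measurable (lebesgue_on \<Omega>)"
  by (auto simp: T_def Linf_def)

lemma T_L2: "\<theta> \<in> T \<Omega> q \<Longrightarrow> \<theta> \<in> L2 \<Omega>"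
  using Linf_imp_L2 by (auto simp: T_def)

lemma norm_K_le: "\<theta> \<in> K \<Longrightarrow> norm \<theta> \<le> 1" for \<theta> :: "real ^ 'n"
proof -
  assume "\<theta> \<in> K"
  then show ?thesis using norm_le_l1_cart[of \<theta>] by (simp add: K_def)
qed

lemma T_I:
  assumes "\<theta> \<in> borel_measurable (lebesgue_on \<Omega>)" "AE x in lebesgue_on \<Omega>. \<theta> x \<in> K"
    "\<And>i. (\<integral>x. \<theta> x $ i \<partial>lebesgue_on \<Omega>) = q i"
  shows "\<theta> \<in> T \<Omega> q"
proof -
  have "AE x in lebesgue_on \<Omega>. norm (\<theta> x) \<le> 1"
    using assms(2) by eventually_elim (rule norm_K_le)
  then show ?thesis using assms by (auto simp: T_def Linf_def)
qed

lemma scalar_in_B: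
  assumes "\<theta> \<in> T \<Omega> q" shows "(\<theta>, \<lambda>x. lam_minus M (\<theta> x) *\<^sub>R mat 1) \<in> B \<Omega> M q"
proof -
  let ?A = "\<lambda>x. lam_minus M (\<theta> x) *\<^sub>R mat 1 :: real ^ 'd ^ 'd"
  have m: "?A \<in> borel_measurable (lebesgue_on \<Omega>)"
    unfolding lam_minus_eq using inv_lam_measurable[OF T_measurable[OF assms]]
    by (intro borel_measurable_scaleR borel_measurable_divide borel_measurable_const)
  have "AE x in lebesgue_on \<Omega>. norm (?A x) \<le> 1 / cmin * norm (mat 1 :: real ^ 'd ^ 'd)"
    using T_AE[OF assms]
  proof eventually_elim
    case (elim x)
    then show ?case using lam_minus_bounds(2)[OF elim] lam_minus_pos[OF elim]
      by (simp only: norm_scaleR) (intro mult_right_mono; simp)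
  qed
  with m have "?A \<in> Linf \<Omega>" by (auto simp: Linf_def)
  moreover have "AE x in lebesgue_on \<Omega>. symmetric_mat (?A x) \<and>
        loewner_le (lam_minus M (\<theta> x) *\<^sub>R mat 1) (?A x) \<and>
        loewner_le (?A x) (lam_plus M (\<theta> x) *\<^sub>R mat 1)"
    using T_AE[OF assms]
  proof eventually_elim
    case (elim x)
    then show ?case using lam_minus_le_lam_plus[OF elim]
      by (auto simp: symmetric_mat_def transpose_scalar transpose_mat loewner_le_def mult_right_mono
          scaleR_matrix_vector_assoc[symmetric])
  qed
  ultimately show ?thesis using assms by (simp add: B_def)
qed

lemma B_T: "(\<theta>, A) \<in> B \<Omega> M q \<Longrightarrow> \<theta> \<in> T \<Omega> q"
  by (simp add: B_def)

lemma B_AE: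
  assumes "(\<theta>, A) \<in> B \<Omega> M q"
  shows "AE x in lebesgue_on \<Omega>. \<theta> x \<in> K \<and> symmetric_mat (A x) \<and>
    (\<forall>v. lam_minus M (\<theta> x) * (norm v)\<^sup>2 \<le> v \<bullet> (A x *v v))"
proof -
  have "AE x in lebesgue_on \<Omega>. symmetric_mat (A x) \<and> loewner_le (lam_minus M (\<theta> x) *\<^sub>R mat 1) (A x)"
    using assms by (auto simp: B_def)
  with T_AE[OF B_T[OF assms]] show ?thesis
    by eventually_elim
      (auto simp: loewner_le_def scaleR_matrix_vector_assoc[symmetric] power2_norm_eq_inner)
qed

text \<open>The lower constant comes from the pointwise bound by \<open>lam_minus\<close>, the upper
  one from the essential bound that \<open>Linf\<close> contains.\<close>

lemma B_elliptic:
  assumes "(\<theta>, A) \<in> B \<Omega> M q" obtains a b where "elliptic \<Omega> a b A"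
proof -
  obtain C where C: "A \<in> borel_measurable (lebesgue_on \<Omega>)" "AE x in lebesgue_on \<Omega>. norm (A x) \<le> C"
    using assms by (auto simp: B_def Linf_def)
  have "AE x in lebesgue_on \<Omega>. symmetric_mat (A x) \<and>
      (\<forall>v. 1 / cmax * (norm v)\<^sup>2 \<le> v \<bullet> (A x *v v)) \<and> (\<forall>v. norm (A x *v v) \<le> (real CARD('d) * C) * norm v)"
    using C(2) B_AE[OF assms]
  proof eventually_elim
    case (elim x)
    have "1 / cmax * (norm v)\<^sup>2 \<le> v \<bullet> (A x *v v)" for v
      using mult_right_mono[OF lam_minus_bounds(1), of "\<theta> x" "(norm v)\<^sup>2"] elim(2)
      by (meson order_trans zero_le_power2)
    moreover have "norm (A x *v v) \<le> (real CARD('d) * C) * norm v" for v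
      using norm_matrix_vector_le[of "A x" v] mult_right_mono[OF mult_left_mono[OF elim(1)], of "real CARD('d)" "norm v"]
      by (meson order_trans norm_ge_zero of_nat_0_le_iff)
    ultimately show ?case using elim(2) by blast
  qed
  then show ?thesis using C(1) cmax_pos that[of "1 / cmax" "real CARD('d) * C"] by (simp add: elliptic_def)
qed

lemma weighted_integrable:
  assumes "\<theta> \<in> T \<Omega> q" "s \<in> L2 \<Omega>"
  shows "integrable (lebesgue_on \<Omega>) (\<lambda>x. (norm (s x))\<^sup>2 * inv_lam M (\<theta> x))"
proof (rule Bochner_Integration.integrable_bound)
  show "integrable (lebesgue_on \<Omega>) (\<lambda>x. (norm (s x))\<^sup>2 * cmax)" using L2_integrable[OF assms(2)] by simp
  show "(\<lambda>x. (norm (s x))\<^sup>2 * inv_lam M (\<theta> x)) \<in> borel_measurable (lebesgue_on \<Omega>)"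
    using inv_lam_measurable[OF T_measurable[OF assms(1)]] L2_measurable[OF assms(2)]
    by (intro borel_measurable_times borel_measurable_power measurable_compose[OF _ borel_measurable_norm]) auto
  show "AE x in lebesgue_on \<Omega>. norm ((norm (s x))\<^sup>2 * inv_lam M (\<theta> x)) \<le> norm ((norm (s x))\<^sup>2 * cmax)"
    using T_AE[OF assms(1)]
  proof eventually_elim
    case (elim x)
    show ?case using inv_lam_bounds[OF elim] inv_lam_pos[OF elim] cmax_pos
      by (simp add: abs_mult mult_left_mono)
  qed
qed

end

section \<open>The dual estimate\<close>

text \<open>The squared norm of a flux with weight 1 / \<open>lam_minus\<close>; \<open>H\<close> is
  the sum of these with the weights w.\<close>

definition wq :: "(real ^ 'd) set \<Rightarrow> ('n::finite \<Rightarrow> real ^ 'd ^ 'd) \<Rightarrow> (real ^ 'd \<Rightarrow> real ^ 'n)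
    \<Rightarrow> (real ^ 'd \<Rightarrow> real ^ 'd) \<Rightarrow> real" where
  "wq \<Omega> M \<theta> s = (\<integral>x. (norm (s x))\<^sup>2 * inv_lam M (\<theta> x) \<partial>lebesgue_on \<Omega>)"

lemma H_eq: "H \<Omega> M w (\<theta>, \<sigma>) = (\<Sum>i\<in>UNIV. w i * wq \<Omega> M \<theta> (\<sigma> i))"
  by (simp add: H_def wq_def lam_minus_eq)

definition flux :: "(real ^ 'd) set \<Rightarrow> ('n::finite \<Rightarrow> real ^ 'd ^ 'd) \<Rightarrow> (real ^ 'd \<Rightarrow> real ^ 'n)
    \<Rightarrow> ((real ^ 'd \<Rightarrow> real) \<Rightarrow> real) \<Rightarrow> real ^ 'd \<Rightarrow> real ^ 'd" where
  "flux \<Omega> M \<theta> f x = lam_minus M (\<theta> x) *\<^sub>R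
     wgrad \<Omega> (dirichlet_solution \<Omega> (\<lambda>x. lam_minus M (\<theta> x) *\<^sub>R mat 1) f) x"

context mixture
begin

section \<open>The weighted flux norm as a function of the design\<close>

lemma wq_nonneg: "\<theta> \<in> T \<Omega> q \<Longrightarrow> 0 \<le> wq \<Omega> M \<theta> s"
  unfolding wq_def
  by (rule integral_nonneg_AE, drule T_AE) (auto elim!: eventually_mono dest: inv_lam_pos)

lemma wq_le: assumes "\<theta> \<in> T \<Omega> q" "s \<in> L2 \<Omega>" shows "wq \<Omega> M \<theta> s \<le> cmax * l2sq \<Omega> s"
proof -
  have "wq \<Omega> M \<theta> s \<le> (\<integral>x. (norm (s x))\<^sup>2 * cmax \<partial>lebesgue_on \<Omega>)"
    unfolding wq_def
  proof (rule integral_mono_AE[OF weighted_integrable[OF assms]])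
    show "AE x in lebesgue_on \<Omega>. (norm (s x))\<^sup>2 * inv_lam M (\<theta> x) \<le> (norm (s x))\<^sup>2 * cmax"
      using T_AE[OF assms(1)] by eventually_elim (simp add: inv_lam_bounds mult_left_mono)
  qed (use L2_integrable[OF assms(2)] in simp)
  then show ?thesis by (simp add: l2sq_def mult.commute)
qed

lemma wq_ge: assumes "\<theta> \<in> T \<Omega> q" "s \<in> L2 \<Omega>" shows "cmin * l2sq \<Omega> s \<le> wq \<Omega> M \<theta> s"
proof -
  have "(\<integral>x. (norm (s x))\<^sup>2 * cmin \<partial>lebesgue_on \<Omega>) \<le> wq \<Omega> M \<theta> s"
    unfolding wq_def
  proof (rule integral_mono_AE[OF _ weighted_integrable[OF assms]])
    show "AE x in lebesgue_on \<Omega>. (norm (s x))\<^sup>2 * cmin \<le> (norm (s x))\<^sup>2 * inv_lam M (\<theta> x)"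
      using T_AE[OF assms(1)] by eventually_elim (simp add: inv_lam_bounds mult_left_mono)
  qed (use L2_integrable[OF assms(2)] in simp)
  then show ?thesis by (simp add: l2sq_def mult.commute)
qed

lemma wq_comparable:
  assumes "\<theta> \<in> T \<Omega> q" "\<eta> \<in> T \<Omega> q" "s \<in> L2 \<Omega>"
  shows "wq \<Omega> M \<eta> s \<le> (cmax / cmin) * wq \<Omega> M \<theta> s"
proof -
  have "wq \<Omega> M \<eta> s \<le> cmax / cmin * (cmin * l2sq \<Omega> s)"
    using wq_le[OF assms(2,3)] cmin_pos by simp
  also have "\<dots> \<le> cmax / cmin * wq \<Omega> M \<theta> s"
    using wq_ge[OF assms(1,3)] cmin_pos cmax_pos by (intro mult_left_mono) auto
  finally show ?thesis .
qed

lemma T_convex: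
  assumes "\<theta> \<in> T \<Omega> q" "\<eta> \<in> T \<Omega> q" "0 \<le> t" "t \<le> 1"
  shows "(\<lambda>x. (1 - t) *\<^sub>R \<theta> x + t *\<^sub>R \<eta> x) \<in> T \<Omega> q"
proof (rule T_I)
  note L = T_L2[OF assms(1)] T_L2[OF assms(2)]
  show "(\<lambda>x. (1 - t) *\<^sub>R \<theta> x + t *\<^sub>R \<eta> x) \<in> borel_measurable (lebesgue_on \<Omega>)"
    by (intro L2_measurable L2_add L2_scaleR L)
  show "AE x in lebesgue_on \<Omega>. (1 - t) *\<^sub>R \<theta> x + t *\<^sub>R \<eta> x \<in> K"
    using T_AE[OF assms(1)] T_AE[OF assms(2)]
  proof eventually_elim
    case (elim x)
    have "0 \<le> (1 - t) * \<theta> x $ i + t * \<eta> x $ i \<and> (1 - t) * \<theta> x $ i + t * \<eta> x $ i \<le> 1" for i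
      using elim assms(3,4) convex_bound_le[of "\<theta> x $ i" 1 "\<eta> x $ i" "1 - t" t] by (auto simp: K_def)
    then show ?case using elim
      by (simp add: K_def sum.distrib sum_distrib_left[symmetric])
  qed
  show "(\<integral>x. ((1 - t) *\<^sub>R \<theta> x + t *\<^sub>R \<eta> x) $ i \<partial>lebesgue_on \<Omega>) = q i" for i
  proof -
    have "(\<integral>x. ((1 - t) *\<^sub>R \<theta> x + t *\<^sub>R \<eta> x) $ i \<partial>lebesgue_on \<Omega>)
        = (1 - t) * (\<integral>x. \<theta> x $ i \<partial>lebesgue_on \<Omega>) + t * (\<integral>x. \<eta> x $ i \<partial>lebesgue_on \<Omega>)"
      using integrable_L2[OF L2_component[OF L(1), of i]] integrable_L2[OF L2_component[OF L(2), of i]] by simp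
    also have "\<dots> = q i" using assms by (simp add: T_def algebra_simps)
    finally show ?thesis .
  qed
qed

lemma wq_affine:
  assumes "\<theta> \<in> T \<Omega> q" "\<eta> \<in> T \<Omega> q" "s \<in> L2 \<Omega>"
  shows "wq \<Omega> M (\<lambda>x. (1 - t) *\<^sub>R \<theta> x + t *\<^sub>R \<eta> x) s = (1 - t) * wq \<Omega> M \<theta> s + t * wq \<Omega> M \<eta> s"
  unfolding wq_def inv_lam_lincomb distrib_left mult.left_commute[of "(norm (s _))\<^sup>2"]
  using weighted_integrable[OF assms(1,3)] weighted_integrable[OF assms(2,3)] by simp

lemma wq_tendsto:
  assumes \<theta>: "\<And>n. \<theta> n \<in> T \<Omega> q" and \<eta>: "\<eta> \<in> T \<Omega> q" and s: "s \<in> L2 \<Omega>"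
    and l: "AE x in lebesgue_on \<Omega>. (\<lambda>n. \<theta> n x) \<longlonglongrightarrow> \<eta> x"
  shows "(\<lambda>n. wq \<Omega> M (\<theta> n) s) \<longlonglongrightarrow> wq \<Omega> M \<eta> s"
  unfolding wq_def
proof (rule integral_dominated_convergence[where w="\<lambda>x. (norm (s x))\<^sup>2 * cmax"])
  show "AE x in lebesgue_on \<Omega>. (\<lambda>n. (norm (s x))\<^sup>2 * inv_lam M (\<theta> n x)) \<longlonglongrightarrow> (norm (s x))\<^sup>2 * inv_lam M (\<eta> x)"
    using l
  proof eventually_elim
    case (elim x)
    have "lambda_min (M i) \<noteq> 0" for i using lmin_pos[of i] by simp
    then show ?case unfolding inv_lam_def by (intro tendsto_intros elim)
  qed
  show "AE x in lebesgue_on \<Omega>. norm ((norm (s x))\<^sup>2 * inv_lam M (\<theta> n x)) \<le> (norm (s x))\<^sup>2 * cmax" for n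
    using T_AE[OF \<theta>[of n]]
  proof eventually_elim
    case (elim x)
    show ?case using inv_lam_bounds[OF elim] inv_lam_pos[OF elim] by (simp add: abs_mult mult_left_mono)
  qed
qed (use L2_integrable[OF s] borel_measurable_integrable[OF weighted_integrable[OF \<theta> s]]
      borel_measurable_integrable[OF weighted_integrable[OF \<eta> s]] in auto)

text \<open>Here r = s - (s - r). For small e the factor of s stays close to 1, at the price of a
  large factor in front of the difference.\<close>

lemma wq_young:
  assumes \<theta>: "\<theta> \<in> T \<Omega> q" and s: "s \<in> L2 \<Omega>" "r \<in> L2 \<Omega>" and e: "e > 0"
  shows "wq \<Omega> M \<theta> r \<le> (1 + e) * wq \<Omega> M \<theta> s + (1 + 1 / e) * wq \<Omega> M \<theta> (\<lambda>x. s x - r x)"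
proof -
  note i = weighted_integrable[OF \<theta>] 
  have "wq \<Omega> M \<theta> r \<le> (\<integral>x. (1 + e) * ((norm (s x))\<^sup>2 * inv_lam M (\<theta> x))
      + (1 + 1 / e) * ((norm (s x - r x))\<^sup>2 * inv_lam M (\<theta> x)) \<partial>lebesgue_on \<Omega>)"
    unfolding wq_def
  proof (rule integral_mono_AE[OF i[OF s(2)]])
    show "AE x in lebesgue_on \<Omega>. (norm (r x))\<^sup>2 * inv_lam M (\<theta> x) \<le> (1 + e) * ((norm (s x))\<^sup>2 * inv_lam M (\<theta> x))
      + (1 + 1 / e) * ((norm (s x - r x))\<^sup>2 * inv_lam M (\<theta> x))"
      using T_AE[OF \<theta>]
    proof eventually_elim
      case (elim x)
      define y where "y = s x - r x"
      \<comment> \<open>Expanding this square bounds the cross term -2 s.y by e |s|^2 + |y|^2 /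
        e.\<close>
      have "0 \<le> (norm (sqrt e *\<^sub>R s x + (1 / sqrt e) *\<^sub>R y))\<^sup>2" by simp
      also have "\<dots> = e * (norm (s x))\<^sup>2 + 2 * (s x \<bullet> y) + (1 / e) * (norm y)\<^sup>2"
        using e unfolding power2_norm_eq_inner
        by (simp add: inner_add_left inner_add_right inner_commute field_simps)
      moreover have "(norm (r x))\<^sup>2 = (norm (s x))\<^sup>2 - 2 * (s x \<bullet> y) + (norm y)\<^sup>2"
        unfolding y_def power2_norm_eq_inner by (simp add: inner_diff_left inner_diff_right inner_commute)
      ultimately have "(norm (r x))\<^sup>2 \<le> (1 + e) * (norm (s x))\<^sup>2 + (1 + 1 / e) * (norm y)\<^sup>2"
        by (simp add: algebra_simps)
      from mult_right_mono[OF this less_imp_le[OF inv_lam_pos[OF elim]]]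
      show ?case by (simp add: y_def algebra_simps)
    qed
  qed (use i[OF s(1)] i[OF L2_diff[OF s]] in auto)
  also have "\<dots> = (1 + e) * wq \<Omega> M \<theta> s + (1 + 1 / e) * wq \<Omega> M \<theta> (\<lambda>x. s x - r x)"
    unfolding wq_def using i[OF s(1)] i[OF L2_diff[OF s]] by simp
  finally show ?thesis .
qed

text \<open>The defect \<open>wq \<Omega> M \<theta> \<sigma> - f u\<close> is the integral of the
  pointwise gap of \<open>flux_gap\<close>, so it is nonnegative and vanishes exactly when the gap
  does almost everywhere.\<close>

lemma dual_estimate:
  assumes B: "(\<theta>, A) \<in> B \<Omega> M q" and f: "f \<in> Hm1 \<Omega>" and \<sigma>: "\<sigma> \<in> L2 \<Omega>" "neg_div_eq \<Omega> \<sigma> f"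
    and u: "u = dirichlet_solution \<Omega> A f"
  shows "f u \<le> wq \<Omega> M \<theta> \<sigma>"
    and "f u = wq \<Omega> M \<theta> \<sigma> \<longleftrightarrow> (AE x in lebesgue_on \<Omega>.
      \<sigma> x = lam_minus M (\<theta> x) *\<^sub>R wgrad \<Omega> u x \<and> A x *v wgrad \<Omega> u x = lam_minus M (\<theta> x) *\<^sub>R wgrad \<Omega> u x)"
proof -
  obtain a b where A: "elliptic \<Omega> a b A" using B_elliptic[OF B] by blast
  note uH = dirichlet_solution[OF A f, folded u]
  have g: "wgrad \<Omega> u \<in> L2 \<Omega>" by (intro wgrad_L2 H10_H1 uH)
  define d where "d x = (norm (\<sigma> x))\<^sup>2 * inv_lam M (\<theta> x) - 2 * (\<sigma> x \<bullet> wgrad \<Omega> u x)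
      + (A x *v wgrad \<Omega> u x) \<bullet> wgrad \<Omega> u x" for x
  note int = weighted_integrable[OF B_T[OF B] \<sigma>(1)] integrable_inner_L2[OF \<sigma>(1) g] energy_integrable[OF A g g]
  have di: "integrable (lebesgue_on \<Omega>) d" unfolding d_def using int by simp
  \<comment> \<open>Tested with u, both \<open>\<sigma>\<close> and the flux of u pair with the
    gradient of u to give f u.\<close>
  have "(\<integral>x. d x \<partial>lebesgue_on \<Omega>) = wq \<Omega> M \<theta> \<sigma> - 2 * f u + f u"
    unfolding d_def wq_def using int \<sigma>(2) uH by (simp add: neg_div_eq_def)
  then have eq: "wq \<Omega> M \<theta> \<sigma> = f u + (\<integral>x. d x \<partial>lebesgue_on \<Omega>)" by simp
  have dd: "AE x in lebesgue_on \<Omega>. 0 \<le> d x \<and> (d x = 0 \<longleftrightarrow> \<sigma> x = lam_minus M (\<theta> x) *\<^sub>R wgrad \<Omega> u x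
      \<and> A x *v wgrad \<Omega> u x = lam_minus M (\<theta> x) *\<^sub>R wgrad \<Omega> u x)"
    using B_AE[OF B]
  proof eventually_elim
    case (elim x)
    have "d x = (norm (\<sigma> x))\<^sup>2 / lam_minus M (\<theta> x) - 2 * (\<sigma> x \<bullet> wgrad \<Omega> u x)
      + (A x *v wgrad \<Omega> u x) \<bullet> wgrad \<Omega> u x" by (simp add: d_def lam_minus_eq)
    then show ?case using flux_gap[OF lam_minus_pos, of "\<theta> x" "A x" "\<sigma> x" "wgrad \<Omega> u x"] elim by simp
  qed
  then have d0: "AE x in lebesgue_on \<Omega>. 0 \<le> d x" by eventually_elim simp
  then show "f u \<le> wq \<Omega> M \<theta> \<sigma>" using eq integral_nonneg_AE by fastforce
  have "f u = wq \<Omega> M \<theta> \<sigma> \<longleftrightarrow> (AE x in lebesgue_on \<Omega>. d x = 0)"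
    using eq integral_nonneg_eq_0_iff_AE[OF di d0] by auto
  also have "\<dots> \<longleftrightarrow> (AE x in lebesgue_on \<Omega>.
      \<sigma> x = lam_minus M (\<theta> x) *\<^sub>R wgrad \<Omega> u x \<and> A x *v wgrad \<Omega> u x = lam_minus M (\<theta> x) *\<^sub>R wgrad \<Omega> u x)"
    by (rule eventually_cong[OF dd]) simp
  finally show "f u = wq \<Omega> M \<theta> \<sigma> \<longleftrightarrow> (AE x in lebesgue_on \<Omega>.
      \<sigma> x = lam_minus M (\<theta> x) *\<^sub>R wgrad \<Omega> u x \<and> A x *v wgrad \<Omega> u x = lam_minus M (\<theta> x) *\<^sub>R wgrad \<Omega> u x)" .
qed

text \<open>For the scalar coefficient this flux meets the equality condition of
  \<open>dual_estimate\<close> by construction, which gives its weighted norm.\<close>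

lemma flux:
  assumes \<theta>: "\<theta> \<in> T \<Omega> q" and f: "f \<in> Hm1 \<Omega>"
  shows "flux \<Omega> M \<theta> f \<in> L2 \<Omega>" "neg_div_eq \<Omega> (flux \<Omega> M \<theta> f) f"
    "wq \<Omega> M \<theta> (flux \<Omega> M \<theta> f) = f (dirichlet_solution \<Omega> (\<lambda>x. lam_minus M (\<theta> x) *\<^sub>R mat 1) f)"
proof -
  let ?A = "\<lambda>x. lam_minus M (\<theta> x) *\<^sub>R mat 1 :: real ^ 'd ^ 'd"
  note B = scalar_in_B[OF \<theta>]
  obtain a b where A: "elliptic \<Omega> a b ?A" using B_elliptic[OF B] by blast
  note uH = dirichlet_solution[OF A f]
  have eq: "flux \<Omega> M \<theta> f = (\<lambda>x. ?A x *v wgrad \<Omega> (dirichlet_solution \<Omega> ?A f) x)"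
    by (auto simp: flux_def scaleR_matrix_vector_assoc[symmetric])
  show L: "flux \<Omega> M \<theta> f \<in> L2 \<Omega>" and nd: "neg_div_eq \<Omega> (flux \<Omega> M \<theta> f) f"
    unfolding eq by (intro elliptic_L2[OF A] wgrad_L2 H10_H1 uH)+
  show "wq \<Omega> M \<theta> (flux \<Omega> M \<theta> f) = f (dirichlet_solution \<Omega> ?A f)"
    using dual_estimate(2)[OF B f L nd refl]
    by (simp add: flux_def scaleR_matrix_vector_assoc[symmetric])
qed

text \<open>The flux divided by \<open>lam_minus\<close> is a gradient, and the difference of two
  fluxes with the same divergence is orthogonal to gradients of H10. So the optimal flux is an
  orthogonal projection in the weighted norm.\<close>

lemma flux_pythagoras:
  assumes \<theta>: "\<theta> \<in> T \<Omega> q" and f: "f \<in> Hm1 \<Omega>" and \<tau>: "\<tau> \<in> L2 \<Omega>" "neg_div_eq \<Omega> \<tau> f"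
  shows "wq \<Omega> M \<theta> \<tau> = wq \<Omega> M \<theta> (flux \<Omega> M \<theta> f) + wq \<Omega> M \<theta> (\<lambda>x. \<tau> x - flux \<Omega> M \<theta> f x)"
proof -
  let ?u = "dirichlet_solution \<Omega> (\<lambda>x. lam_minus M (\<theta> x) *\<^sub>R mat 1) f" and ?s = "flux \<Omega> M \<theta> f"
  obtain a b where A: "elliptic \<Omega> a b (\<lambda>x. lam_minus M (\<theta> x) *\<^sub>R mat 1)"
    using B_elliptic[OF scalar_in_B[OF \<theta>]] by blast
  note uH = dirichlet_solution(1)[OF A f]
  note s = flux[OF \<theta> f]
  have g: "wgrad \<Omega> ?u \<in> L2 \<Omega>" by (intro wgrad_L2 H10_H1 uH)
  note i = weighted_integrable[OF \<theta>]
  have "(\<integral>x. (norm (\<tau> x))\<^sup>2 * inv_lam M (\<theta> x) \<partial>lebesgue_on \<Omega>)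
    = (\<integral>x. (norm (?s x))\<^sup>2 * inv_lam M (\<theta> x) + (norm (\<tau> x - ?s x))\<^sup>2 * inv_lam M (\<theta> x)
        + 2 * (\<tau> x \<bullet> wgrad \<Omega> ?u x - ?s x \<bullet> wgrad \<Omega> ?u x) \<partial>lebesgue_on \<Omega>)"
  proof (rule integral_cong_AE)
    show "AE x in lebesgue_on \<Omega>. (norm (\<tau> x))\<^sup>2 * inv_lam M (\<theta> x)
      = (norm (?s x))\<^sup>2 * inv_lam M (\<theta> x) + (norm (\<tau> x - ?s x))\<^sup>2 * inv_lam M (\<theta> x)
        + 2 * (\<tau> x \<bullet> wgrad \<Omega> ?u x - ?s x \<bullet> wgrad \<Omega> ?u x)"
      using T_AE[OF \<theta>]
    proof eventually_elim
      case (elim x)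
      have g: "wgrad \<Omega> ?u x = inv_lam M (\<theta> x) *\<^sub>R ?s x"
        using inv_lam_pos[OF elim] by (simp add: flux_def lam_minus_eq)
      show ?case unfolding g power2_norm_eq_inner
        by (simp add: inner_diff_left inner_diff_right inner_commute algebra_simps)
    qed
  qed (use i[OF \<tau>(1)] i[OF s(1)] i[OF L2_diff[OF \<tau>(1) s(1)]] integrable_inner_L2[OF \<tau>(1) g]
      integrable_inner_L2[OF s(1) g] in auto)
  also have "\<dots> = wq \<Omega> M \<theta> ?s + wq \<Omega> M \<theta> (\<lambda>x. \<tau> x - ?s x) + 2 * (f ?u - f ?u)"
    unfolding wq_def using i[OF s(1)] i[OF L2_diff[OF \<tau>(1) s(1)]] integrable_inner_L2[OF \<tau>(1) g]
      integrable_inner_L2[OF s(1) g] \<tau>(2) s(2) uH by (simp add: neg_div_eq_def)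
  finally show ?thesis by (simp add: wq_def)
qed

end

section \<open>Maximisers of I\<close>

locale design = mixture \<Omega> M q for \<Omega> :: "(real ^ 'd) set" and M :: "'n::finite \<Rightarrow> real ^ 'd ^ 'd" and q +
  fixes f :: "'m::finite \<Rightarrow> (real ^ 'd \<Rightarrow> real) \<Rightarrow> real" and w :: "'m \<Rightarrow> real"
  assumes q_nonneg: "\<And>i. q i \<ge> 0" and q_sum: "(\<Sum>i\<in>UNIV. q i) = measure lebesgue \<Omega>"
    and f_Hm1: "\<And>i. f i \<in> Hm1 \<Omega>" and w_pos: "\<And>i. w i > 0"
begin

abbreviation "HH \<theta> \<sigma> \<equiv> H \<Omega> M w (\<theta>, \<sigma>)"
abbreviation "opt_flux \<theta> \<equiv> \<lambda>i. flux \<Omega> M \<theta> (f i)"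
abbreviation "scalar \<theta> \<equiv> \<lambda>x. lam_minus M (\<theta> x) *\<^sub>R (mat 1 :: real ^ 'd ^ 'd)"

text \<open>The constant design with the prescribed fractions \<open>q i / m\<close>. If the domain
  has measure zero, these quotients are meaningless, but then every \<open>q i\<close> is 0 and any
  vertex of \<open>K\<close> serves.\<close>

lemma T_nonempty: "T \<Omega> q \<noteq> {}"
proof -
  have int: "measure (lebesgue_on \<Omega>) \<Omega> = measure lebesgue \<Omega>"
    using lebesgue_dom by (simp add: measure_restrict_space)
  show ?thesis
  proof (cases "measure lebesgue \<Omega> = 0")
    case True
    then have "q i = 0" for i
      using q_sum q_nonneg by (simp add: sum_nonneg_eq_0_iff)
    moreover have "axis k 1 \<in> K" for k :: 'n
      by (simp add: K_def axis_def)
    ultimately have "(\<lambda>x. axis k 1) \<in> T \<Omega> q" for k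
      using True by (intro T_I) (auto simp: int)
    then show ?thesis by blast
  next
    case False
    define m where "m = measure lebesgue \<Omega>"
    have m: "m > 0" using False by (simp add: m_def less_le)
    have "q i \<le> m" for i
      unfolding m_def q_sum[symmetric] by (rule member_le_sum) (use q_nonneg in auto)
    then have "(\<chi> i. q i / m) \<in> K"
      using q_nonneg q_sum m by (simp add: K_def m_def[symmetric] sum_divide_distrib[symmetric])
    then have "(\<lambda>x. \<chi> i. q i / m) \<in> T \<Omega> q"
      using m by (intro T_I) (auto simp: int m_def[symmetric])
    then show ?thesis by blast
  qed
qed

section \<open>The minimal energy as a function of the design\<close>

lemma opt_flux_S: "\<theta> \<in> T \<Omega> q \<Longrightarrow> opt_flux \<theta> \<in> S \<Omega> f"
  using flux[OF _ f_Hm1] by (auto simp: S_def)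

lemma S_L2: "\<sigma> \<in> S \<Omega> f \<Longrightarrow> \<sigma> i \<in> L2 \<Omega>" and S_eq: "\<sigma> \<in> S \<Omega> f \<Longrightarrow> neg_div_eq \<Omega> (\<sigma> i) (f i)"
  by (auto simp: S_def)

lemma HH_nonneg: "\<theta> \<in> T \<Omega> q \<Longrightarrow> 0 \<le> HH \<theta> \<sigma>"
  unfolding H_eq by (intro sum_nonneg mult_nonneg_nonneg wq_nonneg) (auto simp: less_imp_le w_pos)

lemma HH_pythagoras:
  assumes "\<theta> \<in> T \<Omega> q" "\<tau> \<in> S \<Omega> f"
  shows "HH \<theta> \<tau> = HH \<theta> (opt_flux \<theta>) + HH \<theta> (\<lambda>i x. \<tau> i x - opt_flux \<theta> i x)"
  unfolding H_eq using flux_pythagoras[OF assms(1) f_Hm1 S_L2[OF assms(2)] S_eq[OF assms(2)]]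
  by (simp add: sum.distrib[symmetric] distrib_left[symmetric])

lemma HH_opt_le: "\<theta> \<in> T \<Omega> q \<Longrightarrow> \<tau> \<in> S \<Omega> f \<Longrightarrow> HH \<theta> (opt_flux \<theta>) \<le> HH \<theta> \<tau>"
  using HH_pythagoras[of \<theta> \<tau>] HH_nonneg[of \<theta> "\<lambda>i x. \<tau> i x - opt_flux \<theta> i x"] by simp

lemma HH_affine:
  assumes "\<theta> \<in> T \<Omega> q" "\<eta> \<in> T \<Omega> q" "\<And>i. \<tau> i \<in> L2 \<Omega>"
  shows "HH (\<lambda>x. (1 - t) *\<^sub>R \<theta> x + t *\<^sub>R \<eta> x) \<tau> = (1 - t) * HH \<theta> \<tau> + t * HH \<eta> \<tau>"
  unfolding H_eq sum_distrib_left sum.distrib[symmetric] wq_affine[OF assms(1,2,3)]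
  by (simp add: algebra_simps)

text \<open>Superlevel sets of a minimum of affine functions are convex: the optimal flux of the
  combination is a competitor at both endpoints.\<close>

lemma opt_le_affine:
  assumes "\<theta> \<in> T \<Omega> q" "\<eta> \<in> T \<Omega> q" "0 \<le> t" "t \<le> 1"
    and "c \<le> HH \<theta> (opt_flux \<theta>)" "c \<le> HH \<eta> (opt_flux \<eta>)"
  shows "c \<le> HH (\<lambda>x. (1 - t) *\<^sub>R \<theta> x + t *\<^sub>R \<eta> x) (opt_flux (\<lambda>x. (1 - t) *\<^sub>R \<theta> x + t *\<^sub>R \<eta> x))"
proof -
  let ?z = "\<lambda>x. (1 - t) *\<^sub>R \<theta> x + t *\<^sub>R \<eta> x"
  note z = opt_flux_S[OF T_convex[OF assms(1-4)]]
  have "c = (1 - t) * c + t * c" by (simp add: algebra_simps)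
  also have "\<dots> \<le> (1 - t) * HH \<theta> (opt_flux ?z) + t * HH \<eta> (opt_flux ?z)"
    using HH_opt_le[OF assms(1) z] HH_opt_le[OF assms(2) z] assms
    by (intro add_mono mult_left_mono) auto
  also have "\<dots> = HH ?z (opt_flux ?z)"
    using HH_affine[OF assms(1,2) S_L2[OF z], of t] by simp
  finally show ?thesis .
qed

lemma l2sq_T_le: "\<theta> \<in> T \<Omega> q \<Longrightarrow> l2sq \<Omega> \<theta> \<le> (\<integral>x. 1 \<partial>lebesgue_on \<Omega>)"
  unfolding l2sq_def
proof (rule integral_mono_AE)
  assume "\<theta> \<in> T \<Omega> q"
  from T_AE[OF this] show "AE x in lebesgue_on \<Omega>. (norm (\<theta> x))\<^sup>2 \<le> 1"
    by eventually_elim (simp add: power_le_one norm_K_le)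
qed (use L2_integrable T_L2 integrable_const_dom in auto)

text \<open>The pointwise constraint \<open>K\<close> passes to the limit along the almost
  everywhere convergent subsequence, the prescribed integrals by L2 convergence.\<close>

lemma T_closed:
  assumes \<theta>: "\<And>n. \<theta> n \<in> T \<Omega> q" and \<eta>: "\<eta> \<in> L2 \<Omega>"
    and l: "(\<lambda>n. l2sq \<Omega> (\<lambda>x. \<theta> n x - \<eta> x)) \<longlonglongrightarrow> 0"
    and r: "AE x in lebesgue_on \<Omega>. (\<lambda>n. \<theta> (r n) x) \<longlonglongrightarrow> \<eta> x"
  shows "\<eta> \<in> T \<Omega> q"
proof (rule T_I)
  show "\<eta> \<in> borel_measurable (lebesgue_on \<Omega>)" by (rule L2_measurable[OF \<eta>])
  have "AE x in lebesgue_on \<Omega>. \<forall>n. \<theta> n x \<in> K" using T_AE[OF \<theta>] by (simp add: AE_all_countable)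
  with r show "AE x in lebesgue_on \<Omega>. \<eta> x \<in> K"
  proof eventually_elim
    case (elim x)
    have c: "(\<lambda>n. \<theta> (r n) x $ i) \<longlonglongrightarrow> \<eta> x $ i" for i using elim(1) by (rule tendsto_vec_nth)
    have "0 \<le> \<eta> x $ i" "\<eta> x $ i \<le> 1" for i
      using LIMSEQ_le_const[OF c[of i], of 0] LIMSEQ_le_const2[OF c[of i], of 1] elim(2)
      by (auto simp: K_def)
    moreover have "(\<lambda>n. \<Sum>i\<in>UNIV. \<theta> (r n) x $ i) \<longlonglongrightarrow> (\<Sum>i\<in>UNIV. \<eta> x $ i)" by (intro tendsto_sum c)
    then have "(\<Sum>i\<in>UNIV. \<eta> x $ i) = 1"
      using elim(2) by (simp add: K_def LIMSEQ_const_iff)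
    ultimately show ?case by (simp add: K_def)
  qed
  fix i
  have "(\<lambda>n. \<integral>x. \<theta> n x \<bullet> axis i 1 \<partial>lebesgue_on \<Omega>) \<longlonglongrightarrow> (\<integral>x. \<eta> x \<bullet> axis i 1 \<partial>lebesgue_on \<Omega>)"
    by (rule l2_inner_tendsto[OF T_L2[OF \<theta>] \<eta> L2_const l])
  then show "(\<integral>x. \<eta> x $ i \<partial>lebesgue_on \<Omega>) = q i"
    using \<theta> by (simp add: T_def LIMSEQ_const_iff flip: cart_eq_inner_axis)
qed

text \<open>Elements of almost minimal norm in the nested convex superlevel sets form a Cauchy sequence,
  so strong convergence is available and no weak compactness is needed.\<close>

lemma maximizer_exists:
  obtains \<theta> where "\<theta> \<in> T \<Omega> q" "\<And>\<eta>. \<eta> \<in> T \<Omega> q \<Longrightarrow> HH \<eta> (opt_flux \<eta>) \<le> HH \<theta> (opt_flux \<theta>)"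
proof -
  define g where "g \<theta> = HH \<theta> (opt_flux \<theta>)" for \<theta>
  obtain \<theta>0 where \<theta>0: "\<theta>0 \<in> T \<Omega> q" using T_nonempty by blast
  \<comment> \<open>A single fixed flux bounds the minimal energies of all designs at once.\<close>
  have "g \<theta> \<le> (\<Sum>i\<in>UNIV. w i * (cmax * l2sq \<Omega> (opt_flux \<theta>0 i)))" if "\<theta> \<in> T \<Omega> q" for \<theta>
  proof -
    have "g \<theta> \<le> HH \<theta> (opt_flux \<theta>0)" unfolding g_def by (rule HH_opt_le[OF that opt_flux_S[OF \<theta>0]])
    also have "\<dots> \<le> (\<Sum>i\<in>UNIV. w i * (cmax * l2sq \<Omega> (opt_flux \<theta>0 i)))"
      unfolding H_eq
      by (intro sum_mono mult_left_mono wq_le that flux[OF \<theta>0 f_Hm1]) (simp add: w_pos less_imp_le)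
    finally show ?thesis .
  qed
  then have bdd: "bdd_above (g ` T \<Omega> q)" by (auto intro!: bdd_aboveI2)
  define m where "m = Sup (g ` T \<Omega> q)"
  have gm: "g \<theta> \<le> m" if "\<theta> \<in> T \<Omega> q" for \<theta>
    unfolding m_def using bdd that by (intro cSup_upper) auto
  define L where "L n = {\<theta> \<in> T \<Omega> q. m - 1 / Suc n \<le> g \<theta>}" for n
  have Lne: "L n \<noteq> {}" for n
  proof -
    have "m - 1 / Suc n < m" by simp
    then obtain y where "y \<in> g ` T \<Omega> q" "m - 1 / Suc n < y"
      using less_cSupE[of "m - 1 / Suc n" "g ` T \<Omega> q"] T_nonempty unfolding m_def by blast
    then show ?thesis by (auto simp: L_def less_imp_le)
  qed
  have Lmono: "L k \<subseteq> L n" if "n \<le> k" for n k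
  proof -
    have "1 / real (Suc k) \<le> 1 / Suc n" using that by (intro divide_left_mono) auto
    then show ?thesis by (auto simp: L_def)
  qed
  \<comment> \<open>The least squared norm over each superlevel set. It increases as the sets shrink
    and is bounded, hence Cauchy, which makes up for the lack of strict concavity.\<close>
  define d where "d n = Inf (l2sq \<Omega> ` L n)" for n
  have bb: "bdd_below (l2sq \<Omega> ` L n)" for n by (rule bdd_belowI2[of _ 0]) simp
  have dle: "d n \<le> l2sq \<Omega> \<theta>" if "\<theta> \<in> L n" for n \<theta>
    unfolding d_def using that bb by (intro cInf_lower) auto
  have dmono: "d n \<le> d k" if "n \<le> k" for n k
    unfolding d_def by (rule cInf_superset_mono) (use Lne Lmono[OF that] bb in auto)
  have dbd: "d n \<le> (\<integral>x. 1 \<partial>lebesgue_on \<Omega>)" for n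
  proof -
    obtain \<theta> where "\<theta> \<in> L n" using Lne by blast
    then show ?thesis using dle[of \<theta> n] l2sq_T_le[of \<theta>] by (auto simp: L_def)
  qed
  have "incseq d" using dmono by (simp add: incseq_def)
  then obtain l where "d \<longlonglongrightarrow> l" using incseq_convergent dbd by blast
  then have dC: "Cauchy d" by (rule LIMSEQ_imp_Cauchy)
  have ex: "\<exists>\<theta>. \<theta> \<in> L n \<and> l2sq \<Omega> \<theta> < d n + 1 / Suc n" for n
    using cInf_lessD[of "l2sq \<Omega> ` L n" "d n + 1 / Suc n"] Lne unfolding d_def by auto
  obtain \<theta> where "\<forall>n. \<theta> n \<in> L n \<and> l2sq \<Omega> (\<theta> n) < d n + 1 / Suc n"
    using choice[OF allI[OF ex]] by (rule exE)
  then have \<theta>: "\<And>n. \<theta> n \<in> L n" "\<And>n. l2sq \<Omega> (\<theta> n) < d n + 1 / Suc n" by auto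
  have \<theta>T: "\<theta> n \<in> T \<Omega> q" for n using \<theta>(1)[of n] by (simp add: L_def)
  \<comment> \<open>The midpoint stays in the larger set \<open>L n\<close>, so its squared norm is
    at least \<open>d n\<close>; the parallelogram identity converts this into a bound on the
    distance.\<close>
  have par: "l2sq \<Omega> (\<lambda>x. \<theta> n x - \<theta> k x) \<le> 2 * (d k - d n) + 4 / Suc n" if nk: "n \<le> k" for n k
  proof -
    let ?z = "\<lambda>x. (1 - 1/2) *\<^sub>R \<theta> n x + (1/2) *\<^sub>R \<theta> k x"
    have kn: "\<theta> k \<in> L n" using \<theta>(1)[of k] Lmono[OF nk] by blast
    have "?z \<in> L n"
      using opt_le_affine[OF \<theta>T[of n] \<theta>T[of k], of "1/2" "m - 1 / Suc n"] T_convex[OF \<theta>T[of n] \<theta>T[of k], of "1/2"]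
        \<theta>(1)[of n] kn by (simp add: L_def g_def)
    then have z: "d n \<le> l2sq \<Omega> ?z" by (rule dle)
    note i = L2_integrable[OF T_L2[OF \<theta>T]] L2_integrable[OF L2_diff[OF T_L2[OF \<theta>T] T_L2[OF \<theta>T]]]
    have "(norm ((1 - 1/2) *\<^sub>R \<theta> n x + (1/2) *\<^sub>R \<theta> k x))\<^sup>2
        = (1/2) * (norm (\<theta> n x))\<^sup>2 + (1/2) * (norm (\<theta> k x))\<^sup>2 - (1/4) * (norm (\<theta> n x - \<theta> k x))\<^sup>2" for x
      unfolding power2_norm_eq_inner
      by (simp add: inner_diff_left inner_diff_right inner_add_left inner_add_right inner_commute field_simps)
    then have "l2sq \<Omega> ?z = (1/2) * l2sq \<Omega> (\<theta> n) + (1/2) * l2sq \<Omega> (\<theta> k)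
        - (1/4) * l2sq \<Omega> (\<lambda>x. \<theta> n x - \<theta> k x)"
      unfolding l2sq_def using i(1)[of n] i(1)[of k] i(2)[of n k] by simp
    moreover have "1 / real (Suc k) \<le> 1 / Suc n" using nk by (intro divide_left_mono) auto
    ultimately show ?thesis using z \<theta>(2)[of n] \<theta>(2)[of k] by argo
  qed
  have cau: "\<exists>N. \<forall>k\<ge>N. \<forall>n\<ge>N. l2sq \<Omega> (\<lambda>x. \<theta> k x - \<theta> n x) < e" if e: "e > 0" for e
  proof -
    obtain N1 where N1: "\<And>k n. k \<ge> N1 \<Longrightarrow> n \<ge> N1 \<Longrightarrow> \<bar>d k - d n\<bar> < e / 4"
      using CauchyD[OF dC, of "e / 4"] e by auto
    have "0 < e / 8" using e by simp
    then obtain N2 where N2: "1 / real (Suc N2) < e / 8" using nat_approx_posE by blast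
    have *: "l2sq \<Omega> (\<lambda>x. \<theta> n x - \<theta> k x) < e" if "max N1 N2 \<le> n" "n \<le> k" for k n
    proof -
      have "1 / real (Suc n) \<le> 1 / Suc N2" using that by (intro divide_left_mono) auto
      moreover have "\<bar>d k - d n\<bar> < e / 4" by (rule N1) (use that in auto)
      then have "d k - d n < e / 4" by (rule le_less_trans[OF abs_ge_self])
      moreover have "4 / real (Suc n) = 4 * (1 / Suc n)" by simp
      ultimately show ?thesis using par[OF that(2)] N2 by argo
    qed
    have "l2sq \<Omega> (\<lambda>x. \<theta> k x - \<theta> n x) < e" if "k \<ge> max N1 N2" "n \<ge> max N1 N2" for k n
    proof (cases "n \<le> k")
      case True
      then show ?thesis using *[OF that(2) True] l2sq_minus_commute[of \<Omega> "\<theta> n" "\<theta> k"] by simp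
    next
      case False
      then show ?thesis using *[OF that(1)] by simp
    qed
    then show ?thesis by blast
  qed
  obtain \<theta>s r where l: "\<theta>s \<in> L2 \<Omega>" "(\<lambda>n. l2sq \<Omega> (\<lambda>x. \<theta> n x - \<theta>s x)) \<longlonglongrightarrow> 0"
    "strict_mono r" "AE x in lebesgue_on \<Omega>. (\<lambda>n. \<theta> (r n) x) \<longlonglongrightarrow> \<theta>s x"
    by (rule L2_complete[OF T_L2[OF \<theta>T] cau])
  have \<theta>s: "\<theta>s \<in> T \<Omega> q" by (rule T_closed[OF \<theta>T l(1,2,4)])
  \<comment> \<open>The optimal flux of the limit is a competitor for every
    \<open>\<theta> (r n)\<close>. Upper semicontinuity of the minimal energy thus reduces to
    continuity of \<open>H\<close> in the design at one fixed flux.\<close>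
  have "m \<le> g \<theta>s"
  proof -
    let ?\<tau> = "opt_flux \<theta>s"
    have "(\<lambda>n. HH (\<theta> (r n)) ?\<tau>) \<longlonglongrightarrow> HH \<theta>s ?\<tau>"
      unfolding H_eq by (intro tendsto_intros wq_tendsto[OF \<theta>T \<theta>s _ l(4)] flux[OF \<theta>s f_Hm1])
    then have "(\<lambda>n. HH (\<theta> (r n)) ?\<tau> + 1 / Suc n) \<longlonglongrightarrow> HH \<theta>s ?\<tau> + 0"
      by (intro tendsto_add LIMSEQ_Suc[OF lim_1_over_n])
    moreover have "m \<le> HH (\<theta> (r n)) ?\<tau> + 1 / Suc n" for n
    proof -
      have "\<theta> (r n) \<in> L n" using \<theta>(1)[of "r n"] Lmono[OF seq_suble[OF l(3), of n]] by blast
      then have "m - 1 / Suc n \<le> g (\<theta> (r n))" by (simp add: L_def)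
      also have "\<dots> \<le> HH (\<theta> (r n)) ?\<tau>" unfolding g_def by (rule HH_opt_le[OF \<theta>T opt_flux_S[OF \<theta>s]])
      finally show ?thesis by simp
    qed
    ultimately have "m \<le> HH \<theta>s ?\<tau> + 0" by (intro LIMSEQ_le_const) auto
    then show ?thesis by (simp add: g_def)
  qed
  then show ?thesis using that[OF \<theta>s] gm unfolding g_def by (meson order_trans)
qed

end

section \<open>Saddle points\<close>

context design
begin

lemma HH_young:
  assumes "\<theta> \<in> T \<Omega> q" "\<sigma> \<in> S \<Omega> f" "\<tau> \<in> S \<Omega> f" "e > 0"
  shows "HH \<theta> \<tau> \<le> (1 + e) * HH \<theta> \<sigma> + (1 + 1 / e) * HH \<theta> (\<lambda>i x. \<sigma> i x - \<tau> i x)"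
  unfolding H_eq sum_distrib_left sum.distrib[symmetric]
proof (rule sum_mono)
  fix i
  show "w i * wq \<Omega> M \<theta> (\<tau> i) \<le> (1 + e) * (w i * wq \<Omega> M \<theta> (\<sigma> i))
      + (1 + 1 / e) * (w i * wq \<Omega> M \<theta> (\<lambda>x. \<sigma> i x - \<tau> i x))"
    using mult_left_mono[OF wq_young[OF assms(1) S_L2[OF assms(2)] S_L2[OF assms(3)] assms(4)] less_imp_le[OF w_pos[of i]]]
    by (simp add: algebra_simps)
qed

lemma HH_comparable:
  assumes "\<theta> \<in> T \<Omega> q" "\<eta> \<in> T \<Omega> q" "\<And>i. \<sigma> i \<in> L2 \<Omega>"
  shows "HH \<eta> \<sigma> \<le> (cmax / cmin) * HH \<theta> \<sigma>"
  unfolding H_eq sum_distrib_left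
proof (rule sum_mono)
  fix i
  show "w i * wq \<Omega> M \<eta> (\<sigma> i) \<le> cmax / cmin * (w i * wq \<Omega> M \<theta> (\<sigma> i))"
    using mult_left_mono[OF wq_comparable[OF assms(1,2,3)] less_imp_le[OF w_pos[of i]]]
    by (simp add: mult.left_commute)
qed

text \<open>Only the inequality in the design direction is at stake. Maximality along the segment
  controls the energy of eta at the optimal flux of the perturbed design z, and also the distance of
  that flux from the optimal flux of theta; Young's inequality then exchanges the two
  fluxes.\<close>

lemma maximizer_saddle:
  assumes \<theta>: "\<theta> \<in> T \<Omega> q" and max: "\<And>\<eta>. \<eta> \<in> T \<Omega> q \<Longrightarrow> HH \<eta> (opt_flux \<eta>) \<le> HH \<theta> (opt_flux \<theta>)"
  shows "(\<theta>, opt_flux \<theta>) \<in> saddle_points \<Omega> M q f w"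
proof -
  let ?h = "HH \<theta> (opt_flux \<theta>)" and ?\<kappa> = "cmax / cmin"
  have "HH \<eta> (opt_flux \<theta>) \<le> ?h" if \<eta>: "\<eta> \<in> T \<Omega> q" for \<eta>
  proof -
    have le: "HH \<eta> (opt_flux \<theta>) \<le> (1 + e) * ?h + (1 + 1 / e) * (?\<kappa> * (e\<^sup>2 * ?h))" if e: "e > 0" for e
    proof -
      \<comment> \<open>Chosen so that t / (1 - t) = e^2, which is the factor in the bound on the
        flux displacement.\<close>
      define t where "t = e\<^sup>2 / (1 + e\<^sup>2)"
      have e2: "0 < 1 + e\<^sup>2" by (simp add: add_pos_nonneg)
      have t: "0 < t" "t < 1" "t = e\<^sup>2 * (1 - t)" using e e2 by (auto simp: t_def field_simps)
      let ?z = "\<lambda>x. (1 - t) *\<^sub>R \<theta> x + t *\<^sub>R \<eta> x"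
      have z: "?z \<in> T \<Omega> q" using T_convex[OF \<theta> \<eta>] t by simp
      note s = opt_flux_S[OF z] and s\<theta> = opt_flux_S[OF \<theta>]
      let ?D = "\<lambda>i x. opt_flux ?z i x - opt_flux \<theta> i x"
      have D: "?D i \<in> L2 \<Omega>" for i using L2_diff[OF S_L2[OF s] S_L2[OF s\<theta>]] .
      have "(1 - t) * HH \<theta> (opt_flux ?z) + t * HH \<eta> (opt_flux ?z) \<le> ?h"
        using max[OF z] HH_affine[OF \<theta> \<eta> S_L2[OF s], of t] by simp
      \<comment> \<open>By Pythagoras, subtracting (1 - t) times the maximum leaves two nonnegative
        terms with sum at most t times the maximum; each of them is therefore bounded
        separately.\<close>
      then have *: "(1 - t) * HH \<theta> ?D + t * HH \<eta> (opt_flux ?z) \<le> t * ?h"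
        using HH_pythagoras[OF \<theta> s] by (simp add: algebra_simps)
      have D0: "0 \<le> (1 - t) * HH \<theta> ?D" "0 \<le> t * HH \<eta> (opt_flux ?z)"
        using HH_nonneg[OF \<theta>] HH_nonneg[OF \<eta>] t by auto
      have 1: "HH \<eta> (opt_flux ?z) \<le> ?h" using * D0(1) t(1) by (smt (verit) mult_less_cancel_left_pos)
      have "(1 - t) * HH \<theta> ?D \<le> (1 - t) * (e\<^sup>2 * ?h)"
        using * D0(2) t(3) by (smt (verit) mult.assoc mult.commute)
      then have 2: "HH \<theta> ?D \<le> e\<^sup>2 * ?h" using t(2) by simp
      have "HH \<eta> (opt_flux \<theta>) \<le> (1 + e) * HH \<eta> (opt_flux ?z) + (1 + 1 / e) * HH \<eta> ?D"
        by (rule HH_young[OF \<eta> s s\<theta> e])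
      also have "\<dots> \<le> (1 + e) * ?h + (1 + 1 / e) * (?\<kappa> * HH \<theta> ?D)"
        using 1 HH_comparable[OF \<theta> \<eta> D] e by (intro add_mono mult_left_mono) auto
      also have "\<dots> \<le> (1 + e) * ?h + (1 + 1 / e) * (?\<kappa> * (e\<^sup>2 * ?h))"
        using 2 e cmax_pos cmin_pos by (intro add_mono mult_left_mono) auto
      finally show ?thesis .
    qed
    \<comment> \<open>For e = 1/(n+1) the displacement term carries (1 + 1/e) e^2 = e^2 + e, so the
      large factor of Young's inequality disappears in the limit.\<close>
    have le': "HH \<eta> (opt_flux \<theta>) \<le> (1 + 1 / Suc n) * ?h + ?\<kappa> * ?h * (1 / Suc n * (1 / Suc n) + 1 / Suc n)" for n
    proof -
      define e where "e = 1 / real (Suc n)"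
      have e: "e > 0" by (simp add: e_def)
      have eq: "(1 + 1 / e) * (?\<kappa> * (e\<^sup>2 * ?h)) = ?\<kappa> * ?h * (e * e + e)"
        using e cmin_pos by (simp add: field_simps power2_eq_square)
      have "HH \<eta> (opt_flux \<theta>) \<le> (1 + e) * ?h + ?\<kappa> * ?h * (e * e + e)"
        using le[OF e] unfolding eq .
      then show ?thesis unfolding e_def .
    qed
    have "(\<lambda>n. (1 + 1 / Suc n) * ?h + ?\<kappa> * ?h * (1 / Suc n * (1 / Suc n) + 1 / Suc n)) \<longlonglongrightarrow> (1 + 0) * ?h + ?\<kappa> * ?h * (0 * 0 + 0)"
      by (intro tendsto_intros LIMSEQ_Suc[OF lim_1_over_n])
    then have "HH \<eta> (opt_flux \<theta>) \<le> (1 + 0) * ?h + ?\<kappa> * ?h * (0 * 0 + 0)"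
      by (rule LIMSEQ_le_const) (use le' in blast)
    then show ?thesis by simp
  qed
  then show ?thesis
    using \<theta> opt_flux_S[OF \<theta>] HH_opt_le[OF \<theta>] by (simp add: saddle_points_def)
qed

lemma saddle_points_nonempty: "saddle_points \<Omega> M q f w \<noteq> {}"
proof -
  obtain \<theta> where "\<theta> \<in> T \<Omega> q" "\<And>\<eta>. \<eta> \<in> T \<Omega> q \<Longrightarrow> HH \<eta> (opt_flux \<eta>) \<le> HH \<theta> (opt_flux \<theta>)"
    by (rule maximizer_exists) blast
  then show ?thesis using maximizer_saddle by blast
qed

text \<open>The chain H(1,1) \<le> H(1,2) \<le> H(2,2) \<le> H(2,1) \<le> H(1,1) collapses to
  equalities. So every optimal design pairs with every optimal flux, and there is only one saddle
  value.\<close>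

lemma saddle_interchange:
  assumes "(\<theta>1, \<sigma>1) \<in> saddle_points \<Omega> M q f w" "(\<theta>2, \<sigma>2) \<in> saddle_points \<Omega> M q f w"
  shows "(\<theta>1, \<sigma>2) \<in> saddle_points \<Omega> M q f w" "HH \<theta>1 \<sigma>2 = HH \<theta>2 \<sigma>2" "HH \<theta>1 \<sigma>1 = HH \<theta>2 \<sigma>2"
proof -
  have T: "\<theta>1 \<in> T \<Omega> q" "\<theta>2 \<in> T \<Omega> q" "\<sigma>1 \<in> S \<Omega> f" "\<sigma>2 \<in> S \<Omega> f"
    using assms by (auto simp: saddle_points_def)
  have m1: "\<And>\<theta>. \<theta> \<in> T \<Omega> q \<Longrightarrow> HH \<theta> \<sigma>1 \<le> HH \<theta>1 \<sigma>1" "\<And>\<sigma>. \<sigma> \<in> S \<Omega> f \<Longrightarrow> HH \<theta>1 \<sigma>1 \<le> HH \<theta>1 \<sigma>"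
    and m2: "\<And>\<theta>. \<theta> \<in> T \<Omega> q \<Longrightarrow> HH \<theta> \<sigma>2 \<le> HH \<theta>2 \<sigma>2" "\<And>\<sigma>. \<sigma> \<in> S \<Omega> f \<Longrightarrow> HH \<theta>2 \<sigma>2 \<le> HH \<theta>2 \<sigma>"
    using assms by (auto simp: saddle_points_def)
  show e: "HH \<theta>1 \<sigma>2 = HH \<theta>2 \<sigma>2" and e1: "HH \<theta>1 \<sigma>1 = HH \<theta>2 \<sigma>2"
    using m1(1)[OF T(2)] m1(2)[OF T(4)] m2(1)[OF T(1)] m2(2)[OF T(3)] by linarith+
  show "(\<theta>1, \<sigma>2) \<in> saddle_points \<Omega> M q f w"
    using T m1(2) m2(1) e e1 by (auto simp: saddle_points_def)
qed

section \<open>Comparison of J with H\<close>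

lemma J_eq: "J \<Omega> f w (\<theta>, A) = (\<Sum>i\<in>UNIV. w i * f i (dirichlet_solution \<Omega> A (f i)))"
  by (simp add: J_def)

lemma J_le: "(\<theta>, A) \<in> B \<Omega> M q \<Longrightarrow> \<sigma> \<in> S \<Omega> f \<Longrightarrow> J \<Omega> f w (\<theta>, A) \<le> HH \<theta> \<sigma>"
  unfolding J_eq H_eq
  by (intro sum_mono mult_left_mono dual_estimate(1)[OF _ f_Hm1 S_L2 S_eq refl]) (auto simp: less_imp_le w_pos)

text \<open>The weights are positive and every defect is nonnegative, so the sums agree only if each
  load case is in the equality case of \<open>dual_estimate\<close>.\<close>

lemma J_eq_iff:
  assumes B: "(\<theta>, A) \<in> B \<Omega> M q" and S: "\<sigma> \<in> S \<Omega> f"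
  shows "J \<Omega> f w (\<theta>, A) = HH \<theta> \<sigma> \<longleftrightarrow> (\<forall>i. AE x in lebesgue_on \<Omega>.
    \<sigma> i x = lam_minus M (\<theta> x) *\<^sub>R wgrad \<Omega> (dirichlet_solution \<Omega> A (f i)) x \<and>
    A x *v wgrad \<Omega> (dirichlet_solution \<Omega> A (f i)) x
      = lam_minus M (\<theta> x) *\<^sub>R wgrad \<Omega> (dirichlet_solution \<Omega> A (f i)) x)"
proof -
  let ?a = "\<lambda>i. w i * f i (dirichlet_solution \<Omega> A (f i))" and ?b = "\<lambda>i. w i * wq \<Omega> M \<theta> (\<sigma> i)"
  have le: "?a i \<le> ?b i" for i
    by (intro mult_left_mono dual_estimate(1)[OF B f_Hm1 S_L2[OF S] S_eq[OF S] refl]) (simp add: less_imp_le w_pos)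
  have "J \<Omega> f w (\<theta>, A) = HH \<theta> \<sigma> \<longleftrightarrow> (\<Sum>i\<in>UNIV. ?b i - ?a i) = 0"
    unfolding J_eq H_eq by (auto simp: sum_subtractf)
  also have "\<dots> \<longleftrightarrow> (\<forall>i. ?b i - ?a i = 0)"
    using le by (subst sum_nonneg_eq_0_iff) auto
  also have "\<dots> \<longleftrightarrow> (\<forall>i. f i (dirichlet_solution \<Omega> A (f i)) = wq \<Omega> M \<theta> (\<sigma> i))"
    using w_pos by (auto simp: less_imp_neq[symmetric] algebra_simps)
  finally show ?thesis
    using dual_estimate(2)[OF B f_Hm1 S_L2[OF S] S_eq[OF S] refl] by simp
qed

lemma J_scalar: "\<theta> \<in> T \<Omega> q \<Longrightarrow> J \<Omega> f w (\<theta>, scalar \<theta>) = HH \<theta> (opt_flux \<theta>)"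
  unfolding J_eq H_eq by (simp add: flux(3)[OF _ f_Hm1])

text \<open>In the equality case \<open>\<sigma> i\<close> is both A times the gradient and
  \<open>lam_minus\<close> times the gradient; applying the inverse of A to the first form and
  dividing the second give the same vector.\<close>

lemma flux_imp_matrix_inv:
  assumes B: "(\<theta>, A) \<in> B \<Omega> M q" and S: "\<sigma> \<in> S \<Omega> f" and eq: "J \<Omega> f w (\<theta>, A) = HH \<theta> \<sigma>"
  shows "AE x in lebesgue_on \<Omega>. matrix_inv (A x) *v \<sigma> i x = (1 / lam_minus M (\<theta> x)) *\<^sub>R \<sigma> i x"
proof -
  have "AE x in lebesgue_on \<Omega>.
    \<sigma> i x = lam_minus M (\<theta> x) *\<^sub>R wgrad \<Omega> (dirichlet_solution \<Omega> A (f i)) x \<and>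
    A x *v wgrad \<Omega> (dirichlet_solution \<Omega> A (f i)) x
      = lam_minus M (\<theta> x) *\<^sub>R wgrad \<Omega> (dirichlet_solution \<Omega> A (f i)) x"
    using eq J_eq_iff[OF B S] by blast
  with B_AE[OF B] show ?thesis
  proof eventually_elim
    case (elim x)
    let ?g = "wgrad \<Omega> (dirichlet_solution \<Omega> A (f i)) x"
    have c: "lam_minus M (\<theta> x) > 0" using elim lam_minus_pos by blast
    have "matrix_inv (A x) *v \<sigma> i x = matrix_inv (A x) *v (A x *v ?g)" using elim by simp
    also have "\<dots> = ?g" by (rule matrix_inv_left_mult[OF c]) (use elim in blast)
    also have "\<dots> = (1 / lam_minus M (\<theta> x)) *\<^sub>R \<sigma> i x" using elim c by simp
    finally show ?case .
  qed
qed

text \<open>If the two coefficients agree on the gradients of the solutions for A, these solutions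
  also solve the problems for A'. This allows the passage between a general coefficient and the
  scalar one in both directions.\<close>

lemma J_value_of_flux:
  assumes B: "(\<theta>, A) \<in> B \<Omega> M q" "(\<theta>, A') \<in> B \<Omega> M q"
    and eq: "\<And>i. AE x in lebesgue_on \<Omega>. A' x *v wgrad \<Omega> (dirichlet_solution \<Omega> A (f i)) x
      = A x *v wgrad \<Omega> (dirichlet_solution \<Omega> A (f i)) x"
  shows "J \<Omega> f w (\<theta>, A') = J \<Omega> f w (\<theta>, A)"
proof -
  obtain a b where A: "elliptic \<Omega> a b A" using B_elliptic[OF B(1)] by blast
  obtain a' b' where A': "elliptic \<Omega> a' b' A'" using B_elliptic[OF B(2)] by blast
  have "f i (dirichlet_solution \<Omega> A' (f i)) = f i (dirichlet_solution \<Omega> A (f i))" for i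
  proof (rule dirichlet_solution_value[OF A' f_Hm1])
    let ?u = "dirichlet_solution \<Omega> A (f i)"
    note u = dirichlet_solution[OF A f_Hm1[of i]]
    show "?u \<in> H10 \<Omega>" by (rule u)
    have g: "wgrad \<Omega> ?u \<in> L2 \<Omega>" by (intro wgrad_L2 H10_H1 u)
    show "neg_div_eq \<Omega> (\<lambda>x. A' x *v wgrad \<Omega> ?u x) (f i)"
      unfolding neg_div_eq_def
    proof
      fix v assume v: "v \<in> H10 \<Omega>"
      have "(\<integral>x. (A' x *v wgrad \<Omega> ?u x) \<bullet> wgrad \<Omega> v x \<partial>lebesgue_on \<Omega>)
          = (\<integral>x. (A x *v wgrad \<Omega> ?u x) \<bullet> wgrad \<Omega> v x \<partial>lebesgue_on \<Omega>)"
      proof (rule integral_cong_AE)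
        show "AE x in lebesgue_on \<Omega>. (A' x *v wgrad \<Omega> ?u x) \<bullet> wgrad \<Omega> v x = (A x *v wgrad \<Omega> ?u x) \<bullet> wgrad \<Omega> v x"
          using eq[of i] by eventually_elim simp
      qed (use energy_integrable[OF A g wgrad_L2[OF H10_H1[OF v]]]
          energy_integrable[OF A' g wgrad_L2[OF H10_H1[OF v]]] in auto)
      then show "(\<integral>x. (A' x *v wgrad \<Omega> ?u x) \<bullet> wgrad \<Omega> v x \<partial>lebesgue_on \<Omega>) = f i v"
        using u(2) v by (simp add: neg_div_eq_def)
    qed
  qed
  then show ?thesis by (simp add: J_eq)
qed

end

section \<open>Maximisers of J\<close>

text \<open>The claims range over every flux component and every value of \<open>H\<close> at saddle
  points; the separate non-emptiness conjunct ensures that they are not vacuous.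
  \<open>is_arg_max\<close> includes membership in the feasible set.\<close>

theorem mainTheorem3:
  fixes \<Omega> :: "(real ^ 'd) set"
    and M :: "'n::finite \<Rightarrow> real ^ 'd ^ 'd"
    and q :: "'n \<Rightarrow> real"
    and f :: "'m::finite \<Rightarrow> (real ^ 'd \<Rightarrow> real) \<Rightarrow> real"
    and w :: "'m \<Rightarrow> real"
  assumes "open \<Omega>" and "bounded \<Omega>"
    and "\<forall>i. spd_mat (M i)"
    and "\<forall>i. q i \<ge> 0" and "(\<Sum>i\<in>UNIV. q i) = measure lebesgue \<Omega>"
    and "\<forall>i. f i \<in> Hm1 \<Omega>"
    and "\<forall>i. w i > 0"
  shows "saddle_points \<Omega> M q f w \<noteq> {} \<and>
    (\<forall>\<sigma>s \<in> snd ` saddle_points \<Omega> M q f w. \<forall>Hs \<in> H \<Omega> M w ` saddle_points \<Omega> M q f w.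
      (\<forall>p \<in> B \<Omega> M q. J \<Omega> f w p \<le> Hs) \<and>
      (\<forall>\<theta>s \<in> Tstar \<Omega> M q f w.
         is_arg_max (J \<Omega> f w) (\<lambda>p. p \<in> B \<Omega> M q) (\<theta>s, \<lambda>x. lam_minus M (\<theta>s x) *\<^sub>R mat 1) \<and>
         J \<Omega> f w (\<theta>s, \<lambda>x. lam_minus M (\<theta>s x) *\<^sub>R mat 1) = Hs) \<and>
      (\<forall>\<theta>s \<in> Tstar \<Omega> M q f w. \<forall>A. (\<theta>s, A) \<in> B \<Omega> M q \<longrightarrow>
         (is_arg_max (J \<Omega> f w) (\<lambda>p. p \<in> B \<Omega> M q) (\<theta>s, A) \<longleftrightarrow>
          (\<forall>i. AE x in lebesgue_on \<Omega>.
             matrix_inv (A x) *v \<sigma>s i x = (1 / lam_minus M (\<theta>s x)) *\<^sub>R \<sigma>s i x))) \<and>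
      (\<forall>\<theta> A. is_arg_max (J \<Omega> f w) (\<lambda>p. p \<in> B \<Omega> M q) (\<theta>, A) \<longrightarrow>
         is_arg_max (I \<Omega> M f w) (\<lambda>\<theta>. \<theta> \<in> T \<Omega> q) \<theta> \<and>
         (\<forall>i. AE x in lebesgue_on \<Omega>.
            matrix_inv (A x) *v \<sigma>s i x = (1 / lam_minus M (\<theta> x)) *\<^sub>R \<sigma>s i x)))"
proof -
  interpret design \<Omega> M q f w
    using assms by unfold_locales auto
  have main: "(\<forall>p \<in> B \<Omega> M q. J \<Omega> f w p \<le> Hs) \<and>
      (\<forall>\<theta>s \<in> Tstar \<Omega> M q f w.
         is_arg_max (J \<Omega> f w) (\<lambda>p. p \<in> B \<Omega> M q) (\<theta>s, \<lambda>x. lam_minus M (\<theta>s x) *\<^sub>R mat 1) \<and>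
         J \<Omega> f w (\<theta>s, \<lambda>x. lam_minus M (\<theta>s x) *\<^sub>R mat 1) = Hs) \<and>
      (\<forall>\<theta>s \<in> Tstar \<Omega> M q f w. \<forall>A. (\<theta>s, A) \<in> B \<Omega> M q \<longrightarrow>
         (is_arg_max (J \<Omega> f w) (\<lambda>p. p \<in> B \<Omega> M q) (\<theta>s, A) \<longleftrightarrow>
          (\<forall>i. AE x in lebesgue_on \<Omega>.
             matrix_inv (A x) *v \<sigma>s i x = (1 / lam_minus M (\<theta>s x)) *\<^sub>R \<sigma>s i x))) \<and>
      (\<forall>\<theta> A. is_arg_max (J \<Omega> f w) (\<lambda>p. p \<in> B \<Omega> M q) (\<theta>, A) \<longrightarrow>
         is_arg_max (I \<Omega> M f w) (\<lambda>\<theta>. \<theta> \<in> T \<Omega> q) \<theta> \<and>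
         (\<forall>i. AE x in lebesgue_on \<Omega>.
            matrix_inv (A x) *v \<sigma>s i x = (1 / lam_minus M (\<theta> x)) *\<^sub>R \<sigma>s i x))"
    if \<sigma>s: "\<sigma>s \<in> snd ` saddle_points \<Omega> M q f w" and Hs: "Hs \<in> H \<Omega> M w ` saddle_points \<Omega> M q f w" for \<sigma>s Hs
  proof -
    obtain \<theta>0 where s0: "(\<theta>0, \<sigma>s) \<in> saddle_points \<Omega> M q f w" using \<sigma>s by auto
    obtain \<theta>1 \<sigma>1 where s1: "(\<theta>1, \<sigma>1) \<in> saddle_points \<Omega> M q f w" "Hs = HH \<theta>1 \<sigma>1"
      using Hs by auto
    have h0: "HH \<theta>0 \<sigma>s = Hs" using saddle_interchange(3)[OF s0 s1(1)] s1(2) by simp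
    have \<sigma>S: "\<sigma>s \<in> S \<Omega> f" and \<theta>0T: "\<theta>0 \<in> T \<Omega> q"
      and le0: "\<And>\<theta>. \<theta> \<in> T \<Omega> q \<Longrightarrow> HH \<theta> \<sigma>s \<le> Hs"
      using s0 h0 by (auto simp: saddle_points_def)
    \<comment> \<open>Interchange pairs the design with the given flux. The minimal energy of the
      design, which is \<open>J\<close> at the scalar coefficient, is then squeezed between
      \<open>Hs\<close> and \<open>HH \<theta> \<sigma>s\<close>.\<close>
    have star: "\<theta> \<in> T \<Omega> q" "HH \<theta> \<sigma>s = Hs" "J \<Omega> f w (\<theta>, scalar \<theta>) = Hs"
      if "\<theta> \<in> Tstar \<Omega> M q f w" for \<theta>
    proof -
      obtain \<sigma> where s: "(\<theta>, \<sigma>) \<in> saddle_points \<Omega> M q f w" using \<open>\<theta> \<in> Tstar \<Omega> M q f w\<close> by (auto simp: Tstar_def)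
      have s': "(\<theta>, \<sigma>s) \<in> saddle_points \<Omega> M q f w" by (rule saddle_interchange(1)[OF s s0])
      show T: "\<theta> \<in> T \<Omega> q" and h: "HH \<theta> \<sigma>s = Hs"
        using s' h0 saddle_interchange(2)[OF s s0] by (auto simp: saddle_points_def)
      have "Hs \<le> HH \<theta> (opt_flux \<theta>)" using s' h opt_flux_S[OF T] by (auto simp: saddle_points_def)
      moreover have "HH \<theta> (opt_flux \<theta>) \<le> HH \<theta> \<sigma>s" by (rule HH_opt_le[OF T \<sigma>S])
      ultimately show "J \<Omega> f w (\<theta>, scalar \<theta>) = Hs" using J_scalar[OF T] h by simp
    qed
    have a: "J \<Omega> f w p \<le> Hs" if "p \<in> B \<Omega> M q" for p
    proof -
      obtain \<theta> A where p: "p = (\<theta>, A)" by fastforce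
      show ?thesis using J_le[OF _ \<sigma>S, of \<theta> A] le0[OF B_T, of \<theta> A] that by (simp add: p)
    qed
    have \<theta>0s: "\<theta>0 \<in> Tstar \<Omega> M q f w" using s0 by (force simp: Tstar_def)
    \<comment> \<open>The upper bound \<open>Hs\<close> is attained at
      \<open>scalar \<theta>0\<close>, so maximality amounts to the value \<open>Hs\<close>.\<close>
    have max_iff: "is_arg_max (J \<Omega> f w) (\<lambda>p. p \<in> B \<Omega> M q) p \<longleftrightarrow> p \<in> B \<Omega> M q \<and> J \<Omega> f w p = Hs" for p
    proof
      assume "is_arg_max (J \<Omega> f w) (\<lambda>p. p \<in> B \<Omega> M q) p"
      then have "p \<in> B \<Omega> M q" "\<not> J \<Omega> f w p < J \<Omega> f w (\<theta>0, scalar \<theta>0)"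
        using scalar_in_B[OF \<theta>0T] by (auto simp: is_arg_max_def)
      then show "p \<in> B \<Omega> M q \<and> J \<Omega> f w p = Hs" using a[of p] star(3)[OF \<theta>0s] by simp
    next
      assume "p \<in> B \<Omega> M q \<and> J \<Omega> f w p = Hs"
      then show "is_arg_max (J \<Omega> f w) (\<lambda>p. p \<in> B \<Omega> M q) p"
        using a by (force simp: is_arg_max_def not_less)
    qed
    have c: "J \<Omega> f w (\<theta>, A) = Hs \<longleftrightarrow> (\<forall>i. AE x in lebesgue_on \<Omega>.
        matrix_inv (A x) *v \<sigma>s i x = (1 / lam_minus M (\<theta> x)) *\<^sub>R \<sigma>s i x)"
      if \<theta>: "\<theta> \<in> Tstar \<Omega> M q f w" and B: "(\<theta>, A) \<in> B \<Omega> M q" for \<theta> A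
    proof
      assume "J \<Omega> f w (\<theta>, A) = Hs"
      then show "\<forall>i. AE x in lebesgue_on \<Omega>. matrix_inv (A x) *v \<sigma>s i x = (1 / lam_minus M (\<theta> x)) *\<^sub>R \<sigma>s i x"
        using flux_imp_matrix_inv[OF B \<sigma>S] star(2)[OF \<theta>] by simp
    next
      assume inv: "\<forall>i. AE x in lebesgue_on \<Omega>. matrix_inv (A x) *v \<sigma>s i x = (1 / lam_minus M (\<theta> x)) *\<^sub>R \<sigma>s i x"
      note Bs = scalar_in_B[OF star(1)[OF \<theta>]]
      \<comment> \<open>The scalar coefficient attains the dual bound, so the equality case
        identifies \<open>\<sigma>s i\<close> as the flux of the scalar solution.\<close>
      have fl: "\<forall>i. AE x in lebesgue_on \<Omega>.
          \<sigma>s i x = lam_minus M (\<theta> x) *\<^sub>R wgrad \<Omega> (dirichlet_solution \<Omega> (scalar \<theta>) (f i)) x \<and>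
          scalar \<theta> x *v wgrad \<Omega> (dirichlet_solution \<Omega> (scalar \<theta>) (f i)) x
            = lam_minus M (\<theta> x) *\<^sub>R wgrad \<Omega> (dirichlet_solution \<Omega> (scalar \<theta>) (f i)) x"
        using J_eq_iff[OF Bs \<sigma>S] star[OF \<theta>] by simp
      \<comment> \<open>Undoing the inverse shows that A sends the scalar gradients to
        \<open>\<sigma>s i\<close>, exactly as the scalar coefficient does.\<close>
      have "J \<Omega> f w (\<theta>, A) = J \<Omega> f w (\<theta>, scalar \<theta>)"
      proof (rule J_value_of_flux[OF Bs B])
        fix i
        show "AE x in lebesgue_on \<Omega>. A x *v wgrad \<Omega> (dirichlet_solution \<Omega> (scalar \<theta>) (f i)) x
            = scalar \<theta> x *v wgrad \<Omega> (dirichlet_solution \<Omega> (scalar \<theta>) (f i)) x"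
          using fl[rule_format, of i] inv[rule_format, of i] B_AE[OF B]
        proof eventually_elim
          case (elim x)
          let ?g = "wgrad \<Omega> (dirichlet_solution \<Omega> (scalar \<theta>) (f i)) x"
          have l: "lam_minus M (\<theta> x) > 0" using elim(3) lam_minus_pos by blast
          have "A x *v ?g = A x *v (matrix_inv (A x) *v \<sigma>s i x)" using elim(1,2) l by simp
          also have "\<dots> = \<sigma>s i x" by (rule matrix_inv_left_mult(2)[OF l]) (use elim(3) in blast)
          finally show ?case using elim(1) by simp
        qed
      qed
      then show "J \<Omega> f w (\<theta>, A) = Hs" using star(3)[OF \<theta>] by simp
    qed
    have d: "is_arg_max (I \<Omega> M f w) (\<lambda>\<theta>. \<theta> \<in> T \<Omega> q) \<theta> \<and> (\<forall>i. AE x in lebesgue_on \<Omega>.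
        matrix_inv (A x) *v \<sigma>s i x = (1 / lam_minus M (\<theta> x)) *\<^sub>R \<sigma>s i x)"
      if B: "(\<theta>, A) \<in> B \<Omega> M q" and J: "J \<Omega> f w (\<theta>, A) = Hs" for \<theta> A
    proof -
      have T: "\<theta> \<in> T \<Omega> q" by (rule B_T[OF B])
      \<comment> \<open>Here the design is an arbitrary feasible one; its energy at
        \<open>\<sigma>s\<close> is squeezed between
        \<open>J \<Omega> f w (\<theta>, A) = Hs\<close> and the saddle bound
        \<open>Hs\<close>.\<close>
      have eq: "J \<Omega> f w (\<theta>, A) = HH \<theta> \<sigma>s" using J_le[OF B \<sigma>S] le0[OF T] J by simp
      note Bs = scalar_in_B[OF T]
      \<comment> \<open>The equality case makes A act as the scalar coefficient on the gradients of
        its own solutions, so replacing A by it keeps the value.\<close>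
      have "J \<Omega> f w (\<theta>, scalar \<theta>) = J \<Omega> f w (\<theta>, A)"
      proof (rule J_value_of_flux[OF B Bs])
        fix i
        have "AE x in lebesgue_on \<Omega>. A x *v wgrad \<Omega> (dirichlet_solution \<Omega> A (f i)) x
            = lam_minus M (\<theta> x) *\<^sub>R wgrad \<Omega> (dirichlet_solution \<Omega> A (f i)) x"
          using eq J_eq_iff[OF B \<sigma>S] by auto
        then show "AE x in lebesgue_on \<Omega>. scalar \<theta> x *v wgrad \<Omega> (dirichlet_solution \<Omega> A (f i)) x
            = A x *v wgrad \<Omega> (dirichlet_solution \<Omega> A (f i)) x"
          by eventually_elim (simp add: scaleR_matrix_vector_assoc[symmetric])
      qed
      then have "I \<Omega> M f w \<theta> = Hs" using J by (simp add: I_def)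
      moreover have "I \<Omega> M f w \<eta> \<le> Hs" if "\<eta> \<in> T \<Omega> q" for \<eta>
        unfolding I_def by (rule a[OF scalar_in_B[OF that]])
      ultimately have "is_arg_max (I \<Omega> M f w) (\<lambda>\<theta>. \<theta> \<in> T \<Omega> q) \<theta>"
        using T by (force simp: is_arg_max_def not_less)
      then show ?thesis using flux_imp_matrix_inv[OF B \<sigma>S eq] by blast
    qed
    show ?thesis
    proof (intro conjI ballI allI impI)
      show "J \<Omega> f w p \<le> Hs" if "p \<in> B \<Omega> M q" for p by (rule a[OF that])
    next
      fix \<theta> assume \<theta>: "\<theta> \<in> Tstar \<Omega> M q f w"
      show "J \<Omega> f w (\<theta>, scalar \<theta>) = Hs" by (rule star(3)[OF \<theta>])
      show "is_arg_max (J \<Omega> f w) (\<lambda>p. p \<in> B \<Omega> M q) (\<theta>, scalar \<theta>)"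
        unfolding max_iff using star(3)[OF \<theta>] scalar_in_B[OF star(1)[OF \<theta>]] by (rule conjI[rotated])
    next
      fix \<theta> A assume \<theta>: "\<theta> \<in> Tstar \<Omega> M q f w" "(\<theta>, A) \<in> B \<Omega> M q"
      show "is_arg_max (J \<Omega> f w) (\<lambda>p. p \<in> B \<Omega> M q) (\<theta>, A) \<longleftrightarrow> (\<forall>i. AE x in lebesgue_on \<Omega>.
          matrix_inv (A x) *v \<sigma>s i x = (1 / lam_minus M (\<theta> x)) *\<^sub>R \<sigma>s i x)"
        unfolding max_iff c[OF \<theta>, symmetric] by (simp only: \<theta>(2) simp_thms)
    next
      fix \<theta> A assume "is_arg_max (J \<Omega> f w) (\<lambda>p. p \<in> B \<Omega> M q) (\<theta>, A)"
      then have *: "(\<theta>, A) \<in> B \<Omega> M q" "J \<Omega> f w (\<theta>, A) = Hs" unfolding max_iff by simp_all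
      show "is_arg_max (I \<Omega> M f w) (\<lambda>\<theta>. \<theta> \<in> T \<Omega> q) \<theta>" by (rule conjunct1[OF d[OF *]])
      show "AE x in lebesgue_on \<Omega>. matrix_inv (A x) *v \<sigma>s i x = (1 / lam_minus M (\<theta> x)) *\<^sub>R \<sigma>s i x" for i
        using conjunct2[OF d[OF *]] by (rule spec)
    qed
  qed
  show ?thesis
    by (intro conjI[OF saddle_points_nonempty] ballI) (rule main)
qed

end
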